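(* Suppose Assumptions A1, A2, A3 of the context hold. Consider the (infinite) sequence generated by the SLAM algorithm of the context, where $\{p_j\}$ is chosen so that $\lim_{K\to\infty}\frac{J(K)}{K}=0$. For $K>0$ let $R_K$ be uniformly distributed on $\{0,\dots,K-1\}$, independently of the algorithm's randomness. (i) If $N_k=b$ for all $k$, for some constant $b\in\mathbb N\setminus\{0\}$, then (i.a) $\displaystyle\limsup_{K\to\infty}\mathbb E\big[\|G_s(x_{R_K})\|^2\big]\le\frac{\left(\frac1L+6Ls^2+2\alpha c\right)\sigma^2}{\alpha c\,b}$; (i.b) $\displaystyle\liminf_{k\to\infty}\mathbb E\big[\|G_s(x_k)\|^2\big]\le\frac{\left(\frac1L+6Ls^2+2\alpha c\right)\sigma^2}{\alpha c\,b}$. If $b\ge\epsilon^{-1}$ (for $\epsilon>0$), then $\limsup_{K\to\infty}\mathbb E[\|G_s(x_{R_K})\|^2]=\mathcal O(\epsilon)$, with a constant independent of $\epsilon$ and $b$. (ii) If $\{N_k\}$ satisfies $\lim_{K\to\infty}\frac1K\sum_{k=0}^{K-1}\frac1{N_k}=0$, then (ii.a) $\displaystyle\lim_{K\to\infty}\mathbb E\big[\|G_s(x_{R_K})\|^2\big]=0$; (ii.b) $\displaystyle\liminf_{k\to\infty}\mathbb E\big[\|G_s(x_k)\|^2\big]=0$.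
   Context: Notation. $\mathbb N$ is the set of nonnegative integers, $\|\cdot\|$ the Euclidean norm on $\mathbb R^n$, $\mathrm{dom}(r)=\{x: r(x)<\infty\}$. Problem. Minimize $\phi(x)=f(x)+r(x)$ over $x\in\mathbb R^n$, where $f(x)=\mathbb E[F(x,\boldsymbol\xi)]$, $\boldsymbol\xi:\Omega\to\Xi\subseteq\mathbb R^d$ is a random variable on a probability space $(\Omega,\mathcal F,\mathbb P)$, and $F(\cdot,\xi)$ is real-valued for $\xi\in\Xi$. A1. (i) $r:\mathbb R^n\to(-\infty,\infty]$ is proper, closed, convex, and $L_r$-Lipschitz continuous on $\mathrm{dom}(r)$. (ii) $f$ is proper and closed, $\mathrm{dom}(f)$ is convex, $\mathrm{dom}(r)\subseteq\mathrm{int}(\mathrm{dom}(f))$, $f$ is continuously differentiable on $\mathrm{int}(\mathrm{dom}(f))$, and its gradient $g=\nabla f$ satisfies $\|g(x)\|\le B_g$ for all $x\in\mathrm{dom}(r)$, for some $B_g>0$. (iii) $\phi$ is bounded below on $\mathrm{dom}(r)$; $\phi_{\inf}=\inf\{\phi(x):x\in\mathrm{dom}(r)\}$. A2. For every $\xi\in\Xi$, $F(\cdot,\xi)$ is continuously differentiable on $\mathrm{int}(\mathrm{dom}(f))$ and $\nabla F(\cdot,\xi)$ (gradient in $x$) is Lipschitz continuous with constant $L>0$ (independent of $\xi$) on $\mathrm{dom}(r)$. A3. There is $\sigma>0$ such that for every $x\in\mathrm{dom}(r)$, $\mathbb E[F(x,\boldsymbol\xi)\mid x]=f(x)$, $\mathbb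 E[\nabla F(x,\boldsymbol\xi)\mid x]=g(x)$, $\mathbb E[\|\nabla F(x,\boldsymbol\xi)-g(x)\|^2\mid x]\le\sigma^2$ almost surely. Proximal operator and residual. For $t>0$, $\mathrm{prox}_{tr}(x)=\arg\min_y\{r(y)+\frac1{2t}\|y-x\|^2\}$ and $G_t(x)=\frac1t\big(x-\mathrm{prox}_{tr}(x-tg(x))\big)$. Algorithm SLAM. Inputs: $x_0\in\mathrm{dom}(r)$, $\alpha,\beta\in(0,1)$, $s\in(0,\infty)$, positive integers $p_0,p_1,\dots$ (cycle lengths) and $N_0,N_1,\dots$ (batch sizes). At iteration $k=0,1,2,\dots$: draw i.i.d. copies $\xi_{k,1},\dots,\xi_{k,N_k}$ of $\boldsymbol\xi$, independent of the past; set $\tilde f_k=\frac1{N_k}\sum_iF(\cdot,\xi_{k,i})$, $\tilde g_k=\frac1{N_k}\sum_i\nabla F(\cdot,\xi_{k,i})$, $\tilde\phi_k=\tilde f_k+r$, and $x_k(t)=\mathrm{prox}_{tr}(x_k-t\tilde g_k(x_k))$. Set $t_k^{\rm init}=s$ if $k\in\{0,p_0,p_0+p_1,p_0+p_1+p_2,\dots\}$ (start of a cycle) and $t_k^{\rm init}=t_{k-1}$ otherwise. Let $t_k=\beta^mt_k^{\rm init}$ with $m\in\mathbb N$ smallest such that $\tilde\phi_k(x_k(t_k))-\tilde\phi_k(x_k)\le-\frac{\alpha}{t_k}\|x_k-x_k(t_k)\|^2$. Set $x_{k+1}=x_k(t_k)$. Constants. $c=\min\{s,\frac{2(1-\alpha)\beta}{L}\}$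 and $J(K)=\min\{l\in\mathbb N:\sum_{j=0}^lp_j\ge K\}$. *)

theory Defs
  imports "HOL-Probability.Probability"
begin

section \<open>Extended-real-valued functions\<close>

definition edom :: "('a \<Rightarrow> ereal) \<Rightarrow> 'a set" where
  "edom h = {x. h x < \<infinity>}"

definition proper_fun :: "('a \<Rightarrow> ereal) \<Rightarrow> bool" where
  "proper_fun h \<longleftrightarrow> (\<forall>x. h x \<noteq> -\<infinity>) \<and> edom h \<noteq> {}"

definition closed_fun :: "('a::topological_space \<Rightarrow> ereal) \<Rightarrow> bool" where
  "closed_fun h \<longleftrightarrow> closed {(x, a::real). h x \<le> ereal a}"

definition convex_fun :: "('a::real_vector \<Rightarrow> ereal) \<Rightarrow> bool" where
  "convex_fun h \<longleftrightarrow> (\<forall>x y u v. 0 \<le> u \<and> 0 \<le> v \<and> u + v = 1 \<longrightarrow>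
     h (u *\<^sub>R x + v *\<^sub>R y) \<le> ereal u * h x + ereal v * h y)"


section \<open>Gradients\<close>

text \<open>Gradients of extended-real-valued functions are taken of their real parts, and only
  at interior points of the domain, where this is the usual gradient.\<close>

definition grad :: "('a::real_inner \<Rightarrow> real) \<Rightarrow> 'a \<Rightarrow> 'a" where
  "grad h x = (THE D. GDERIV h x :> D)"

definition cont_diff_on :: "'a::real_inner set \<Rightarrow> ('a \<Rightarrow> real) \<Rightarrow> bool" where
  "cont_diff_on U h \<longleftrightarrow> (\<forall>x\<in>U. \<exists>D. GDERIV h x :> D) \<and> continuous_on U (grad h)"


section \<open>The stochastic problem and its assumptions\<close>

text \<open>The expectation of a real random variable with values in the extended reals. If the
  positive part is not integrable, the value is \<open>\<infinity>\<close>, also when the negative part is not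
  integrable either (\<open>\<infinity> - \<infinity> = \<infinity>\<close> in \<^typ>\<open>ereal\<close>).\<close>

definition ext_expectation :: "'w measure \<Rightarrow> ('w \<Rightarrow> real) \<Rightarrow> ereal" where
  "ext_expectation \<Omega> Y =
     enn2ereal (\<integral>\<^sup>+ \<omega>. ennreal (Y \<omega>) \<partial>\<Omega>) - enn2ereal (\<integral>\<^sup>+ \<omega>. ennreal (- Y \<omega>) \<partial>\<Omega>)"

definition obj :: "'w measure \<Rightarrow> ('w \<Rightarrow> 'z) \<Rightarrow> ('x \<Rightarrow> 'z \<Rightarrow> real) \<Rightarrow> 'x \<Rightarrow> ereal" where
  "obj \<Omega> \<xi> F x = ext_expectation \<Omega> (\<lambda>\<omega>. F x (\<xi> \<omega>))"

definition obj_grad :: "'w measure \<Rightarrow> ('w \<Rightarrow> 'z) \<Rightarrow> ('x::real_inner \<Rightarrow> 'z \<Rightarrow> real) \<Rightarrow> 'x \<Rightarrow> 'x" where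
  "obj_grad \<Omega> \<xi> F = grad (\<lambda>x. real_of_ereal (obj \<Omega> \<xi> F x))"

text \<open>The set \<open>\<Xi>\<close> need not be Borel: it carries the trace of the Borel \<open>\<sigma>\<close>-algebra.\<close>

abbreviation sample_space :: "'z::topological_space set \<Rightarrow> 'z measure" where
  "sample_space \<Xi> \<equiv> restrict_space borel \<Xi>"

definition stochastic_problem ::
  "'w measure \<Rightarrow> ('w \<Rightarrow> real^'d) \<Rightarrow> (real^'d) set \<Rightarrow> (real^'n \<Rightarrow> real^'d \<Rightarrow> real) \<Rightarrow> bool" where
  "stochastic_problem \<Omega> \<xi> \<Xi> F \<longleftrightarrow>
     prob_space \<Omega> \<and>
     \<xi> \<in> \<Omega> \<rightarrow>\<^sub>M sample_space \<Xi> \<and>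
     (\<forall>x. F x \<in> borel_measurable (sample_space \<Xi>))"

definition assumption_A1 ::
  "'w measure \<Rightarrow> ('w \<Rightarrow> real^'d) \<Rightarrow> (real^'n \<Rightarrow> real^'d \<Rightarrow> real) \<Rightarrow> (real^'n \<Rightarrow> ereal) \<Rightarrow> real \<Rightarrow> bool" where
  "assumption_A1 \<Omega> \<xi> F r L\<^sub>r \<longleftrightarrow>
     (let f = obj \<Omega> \<xi> F; g = obj_grad \<Omega> \<xi> F in
       (proper_fun r \<and> closed_fun r \<and> convex_fun r \<and>
          L\<^sub>r-lipschitz_on (edom r) (\<lambda>x. real_of_ereal (r x))) \<and>
       (proper_fun f \<and> closed_fun f \<and> convex (edom f) \<and>
          edom r \<subseteq> interior (edom f) \<and>
          cont_diff_on (interior (edom f)) (\<lambda>x. real_of_ereal (f x)) \<and>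
          (\<exists>B>0. \<forall>x\<in>edom r. norm (g x) \<le> B)) \<and>
       (\<exists>m::real. \<forall>x\<in>edom r. ereal m \<le> f x + r x))"

definition assumption_A2 ::
  "'w measure \<Rightarrow> ('w \<Rightarrow> real^'d) \<Rightarrow> (real^'d) set \<Rightarrow> (real^'n \<Rightarrow> real^'d \<Rightarrow> real) \<Rightarrow>
     (real^'n \<Rightarrow> ereal) \<Rightarrow> real \<Rightarrow> bool" where
  "assumption_A2 \<Omega> \<xi> \<Xi> F r L \<longleftrightarrow> L > 0 \<and>
     (\<forall>z\<in>\<Xi>. cont_diff_on (interior (edom (obj \<Omega> \<xi> F))) (\<lambda>x. F x z) \<and>
            L-lipschitz_on (edom r) (grad (\<lambda>x. F x z)))"

text \<open>Here \<open>x\<close> is a fixed vector, so that conditioning on it is vacuous.\<close>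

definition assumption_A3 ::
  "'w measure \<Rightarrow> ('w \<Rightarrow> real^'d) \<Rightarrow> (real^'n \<Rightarrow> real^'d \<Rightarrow> real) \<Rightarrow> (real^'n \<Rightarrow> ereal) \<Rightarrow> real \<Rightarrow> bool" where
  "assumption_A3 \<Omega> \<xi> F r \<sigma> \<longleftrightarrow> \<sigma> > 0 \<and>
     (\<forall>x\<in>edom r.
        integrable \<Omega> (\<lambda>\<omega>. F x (\<xi> \<omega>)) \<and>
        ereal (\<integral>\<omega>. F x (\<xi> \<omega>) \<partial>\<Omega>) = obj \<Omega> \<xi> F x \<and>
        integrable \<Omega> (\<lambda>\<omega>. grad (\<lambda>y. F y (\<xi> \<omega>)) x) \<and>
        (\<integral>\<omega>. grad (\<lambda>y. F y (\<xi> \<omega>)) x \<partial>\<Omega>) = obj_grad \<Omega> \<xi> F x \<and>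
        (\<integral>\<^sup>+ \<omega>. ennreal ((norm (grad (\<lambda>y. F y (\<xi> \<omega>)) x - obj_grad \<Omega> \<xi> F x))\<^sup>2) \<partial>\<Omega>)
          \<le> ennreal (\<sigma>\<^sup>2))"


section \<open>Proximal operator and residual\<close>

definition prox :: "real \<Rightarrow> ('a::real_normed_vector \<Rightarrow> ereal) \<Rightarrow> 'a \<Rightarrow> 'a" where
  "prox t r x = (ARG_MIN (\<lambda>y. r y + ereal (1 / (2 * t) * (norm (y - x))\<^sup>2)) y. True)"

definition residual ::
  "('a::real_normed_vector \<Rightarrow> ereal) \<Rightarrow> ('a \<Rightarrow> 'a) \<Rightarrow> real \<Rightarrow> 'a \<Rightarrow> 'a" where
  "residual r g t x = (1 / t) *\<^sub>R (x - prox t r (x - t *\<^sub>R g x))"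


section \<open>The algorithm\<close>

text \<open>In the following definitions \<open>z k i\<close> is the realisation of the \<open>i\<close>-th sample
  (\<open>1 \<le> i \<le> N k\<close>) drawn at iteration \<open>k\<close>.\<close>

definition batch_f ::
  "('x \<Rightarrow> 'z \<Rightarrow> real) \<Rightarrow> (nat \<Rightarrow> nat) \<Rightarrow> (nat \<Rightarrow> nat \<Rightarrow> 'z) \<Rightarrow> nat \<Rightarrow> 'x \<Rightarrow> real" where
  "batch_f F N z k y = (1 / real (N k)) * (\<Sum>i = 1..N k. F y (z k i))"

definition batch_g ::
  "('x::real_inner \<Rightarrow> 'z \<Rightarrow> real) \<Rightarrow> (nat \<Rightarrow> nat) \<Rightarrow> (nat \<Rightarrow> nat \<Rightarrow> 'z) \<Rightarrow> nat \<Rightarrow> 'x \<Rightarrow> 'x" where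
  "batch_g F N z k y = (1 / real (N k)) *\<^sub>R (\<Sum>i = 1..N k. grad (\<lambda>y'. F y' (z k i)) y)"

definition batch_phi ::
  "('x \<Rightarrow> 'z \<Rightarrow> real) \<Rightarrow> ('x \<Rightarrow> ereal) \<Rightarrow> (nat \<Rightarrow> nat) \<Rightarrow> (nat \<Rightarrow> nat \<Rightarrow> 'z) \<Rightarrow> nat \<Rightarrow> 'x \<Rightarrow> ereal" where
  "batch_phi F r N z k y = ereal (batch_f F N z k y) + r y"

definition trial_point ::
  "('x::real_inner \<Rightarrow> 'z \<Rightarrow> real) \<Rightarrow> ('x \<Rightarrow> ereal) \<Rightarrow> (nat \<Rightarrow> nat) \<Rightarrow> (nat \<Rightarrow> nat \<Rightarrow> 'z) \<Rightarrow>
     nat \<Rightarrow> 'x \<Rightarrow> real \<Rightarrow> 'x" where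
  "trial_point F r N z k x t = prox t r (x - t *\<^sub>R batch_g F N z k x)"

definition sufficient_decrease ::
  "('x::real_inner \<Rightarrow> 'z \<Rightarrow> real) \<Rightarrow> ('x \<Rightarrow> ereal) \<Rightarrow> real \<Rightarrow> (nat \<Rightarrow> nat) \<Rightarrow>
     (nat \<Rightarrow> nat \<Rightarrow> 'z) \<Rightarrow> nat \<Rightarrow> 'x \<Rightarrow> real \<Rightarrow> bool" where
  "sufficient_decrease F r \<alpha> N z k x t \<longleftrightarrow>
     batch_phi F r N z k (trial_point F r N z k x t) - batch_phi F r N z k x
       \<le> ereal (- (\<alpha> / t) * (norm (x - trial_point F r N z k x t))\<^sup>2)"

definition cycle_start :: "(nat \<Rightarrow> nat) \<Rightarrow> nat \<Rightarrow> bool" where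
  "cycle_start p k \<longleftrightarrow> (\<exists>j. k = (\<Sum>i<j. p i))"

text \<open>\<open>k = 0\<close> always starts a cycle, so the value \<open>t (0 - 1)\<close> is never used.\<close>

definition slam_sequence ::
  "('x::real_inner \<Rightarrow> 'z \<Rightarrow> real) \<Rightarrow> ('x \<Rightarrow> ereal) \<Rightarrow> 'x \<Rightarrow> real \<Rightarrow> real \<Rightarrow> real \<Rightarrow> (nat \<Rightarrow> nat) \<Rightarrow>
     (nat \<Rightarrow> nat) \<Rightarrow> (nat \<Rightarrow> nat \<Rightarrow> 'z) \<Rightarrow> (nat \<Rightarrow> 'x) \<Rightarrow> (nat \<Rightarrow> real) \<Rightarrow> bool" where
  "slam_sequence F r x\<^sub>0 \<alpha> \<beta> s p N z x t \<longleftrightarrow>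
     x 0 = x\<^sub>0 \<and>
     (\<forall>k. let t_init = (if cycle_start p k then s else t (k - 1));
              m = (LEAST m. sufficient_decrease F r \<alpha> N z k (x k) (\<beta> ^ m * t_init))
          in t k = \<beta> ^ m * t_init \<and>
             x (Suc k) = trial_point F r N z k (x k) (t k))"

text \<open>\<open>M\<close> is the probability space of the algorithm's randomness: the samples \<open>X k i\<close>, jointly
  independent with the law of \<open>\<xi>\<close>, and, for each \<open>K > 0\<close>, the random index \<open>R K\<close>. No joint
  law of the \<open>R K\<close> for different \<open>K\<close> is prescribed.\<close>

definition slam_run ::
  "'w measure \<Rightarrow> ('w \<Rightarrow> real^'d) \<Rightarrow> (real^'d) set \<Rightarrow> (real^'n \<Rightarrow> real^'d \<Rightarrow> real) \<Rightarrow>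
     (real^'n \<Rightarrow> ereal) \<Rightarrow> real^'n \<Rightarrow> real \<Rightarrow> real \<Rightarrow> real \<Rightarrow> (nat \<Rightarrow> nat) \<Rightarrow> (nat \<Rightarrow> nat) \<Rightarrow>
     'v measure \<Rightarrow> (nat \<Rightarrow> nat \<Rightarrow> 'v \<Rightarrow> real^'d) \<Rightarrow> (nat \<Rightarrow> 'v \<Rightarrow> real^'n) \<Rightarrow> (nat \<Rightarrow> 'v \<Rightarrow> real) \<Rightarrow>
     (nat \<Rightarrow> 'v \<Rightarrow> nat) \<Rightarrow> bool" where
  "slam_run \<Omega> \<xi> \<Xi> F r x\<^sub>0 \<alpha> \<beta> s p N M X x t R \<longleftrightarrow>
     (let I = (SIGMA k:UNIV. {1..N k}) in
       prob_space M \<and>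
       (\<forall>k. N k > 0) \<and>
       prob_space.indep_vars M (\<lambda>_. sample_space \<Xi>) (case_prod X) I \<and>
       (\<forall>(k, i)\<in>I. distr M (sample_space \<Xi>) (X k i) = distr \<Omega> (sample_space \<Xi>) \<xi>) \<and>
       (\<forall>\<omega>\<in>space M. slam_sequence F r x\<^sub>0 \<alpha> \<beta> s p N (\<lambda>k i. X k i \<omega>) (\<lambda>k. x k \<omega>) (\<lambda>k. t k \<omega>)) \<and>
       (\<forall>K>0. distr M (count_space UNIV) (R K) = measure_pmf (pmf_of_set {..<K}) \<and>
          prob_space.indep_set M
            (sets (vimage_algebra (space M) (R K) (count_space UNIV)))
            (sets (vimage_algebra (space M) (\<lambda>\<omega>. \<lambda>q\<in>I. case_prod X q \<omega>)
               (Pi\<^sub>M I (\<lambda>_. sample_space \<Xi>))))))"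

definition cycle_index :: "(nat \<Rightarrow> nat) \<Rightarrow> nat \<Rightarrow> nat" where
  "cycle_index p K = (LEAST l. K \<le> (\<Sum>j\<le>l. p j))"

definition mean_sq_residual ::
  "'w measure \<Rightarrow> ('w \<Rightarrow> 'z) \<Rightarrow> ('x::real_inner \<Rightarrow> 'z \<Rightarrow> real) \<Rightarrow> ('x \<Rightarrow> ereal) \<Rightarrow> real \<Rightarrow>
     'v measure \<Rightarrow> ('v \<Rightarrow> 'x) \<Rightarrow> ennreal" where
  "mean_sq_residual \<Omega> \<xi> F r s M Y =
     (\<integral>\<^sup>+ \<omega>. ennreal ((norm (residual r (obj_grad \<Omega> \<xi> F) s (Y \<omega>)))\<^sup>2) \<partial>M)"

end

theory Submission
  imports Defs
begin

text \<open>
  Write \<open>\<phi> = f + r\<close>, let \<open>h\<close> be the empirical version of \<open>f\<close> in iteration \<open>k\<close>, \<open>q\<close> its gradient,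
  \<open>D = f - h\<close> the noise and \<open>e = g - q\<close> the gradient of \<open>D\<close>. The line search compares values of
  \<open>h + r\<close>, where \<open>q\<close> is \<open>L\<close>-Lipschitz. It therefore accepts every step up to
  \<open>2 (1 - \<alpha>) / L\<close>, all steps stay in \<open>[c, s]\<close>, and each iteration decreases \<open>h + r\<close> by at least
  \<open>\<alpha> t\<close> times the squared residual of \<open>q\<close>, which dominates \<open>\<alpha> c / 2\<close> times the squared true residual up to
  \<open>\<alpha> c \<parallel>e\<parallel>\<^sup>2\<close>. Telescoping requires the decrease of \<open>\<phi>\<close> instead of that of \<open>h + r\<close>, that is, an
  estimate of \<open>D x\<^sub>k\<^sub>+\<^sub>1 - D x\<^sub>k\<close> in expectation.

  This increment is not centred, since \<open>x\<^sub>k\<^sub>+\<^sub>1\<close> depends on the batch that defines \<open>D\<close>. It is compared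
  with the increment to the point \<open>w\<close> that is reached from \<open>x\<^sub>k\<close> by a step with the \<^emph>\<open>true\<close> gradient and
  the \<^emph>\<open>initial\<close> step size of the line search. Both are determined by the earlier batches, so
  \<open>D w - D x\<^sub>k\<close> has mean zero. If the line search does not shorten the step, nonexpansiveness of the
  proximal operator gives \<open>\<parallel>x\<^sub>k\<^sub>+\<^sub>1 - w\<parallel> \<le> s \<parallel>e x\<^sub>k\<parallel>\<close>, and the descent lemma for \<open>D\<close> together with Young's
  inequality bounds \<open>D x\<^sub>k\<^sub>+\<^sub>1 - D w\<close> by \<open>\<parallel>e w\<parallel>\<^sup>2 / (2 L) + 3 L s\<^sup>2 \<parallel>e x\<^sub>k\<parallel>\<^sup>2\<close>. If it does, the two points
  still have a bounded distance up to \<open>s \<parallel>e x\<^sub>k\<parallel>\<close>, because \<open>g\<close> is bounded and \<open>r\<close> is Lipschitz, and the bound holds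
  with an additional constant. This is the lemma \<open>iteration_bound\<close>.

  Within a cycle the step sizes \<open>\<beta>\<^sup>n s\<close> never grow and never fall below \<open>c\<close>. Hence a cycle contains a
  bounded number of iterations that shorten the step, and the first \<open>K\<close> iterations contain
  \<open>O(J(K) + 1) = o(K)\<close> of them (\<open>card_increases_le\<close>, \<open>card_cycle_starts_le\<close>), so that the additional
  constants disappear from the averages. Independence bounds the mean of \<open>\<parallel>e\<parallel>\<^sup>2\<close> at \<open>x\<^sub>k\<close> and at \<open>w\<close> by
  \<open>\<sigma>\<^sup>2 / N\<^sub>k\<close> (\<open>grad_noise_second_moment\<close>). Summation, expectation and multiplication by \<open>2 / (\<alpha> c)\<close>
  give \<open>sum_mean_sq_residual_le\<close>, whose leading constant is
  \<open>2 (1 / (2 L) + 3 L s\<^sup>2 + \<alpha> c) \<sigma>\<^sup>2 / (\<alpha> c)\<close>. The random index turns this sum into an average, and the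
  lower limit of a sequence is at most every limit of upper bounds for its averages.

  The expectations make sense because the iterates are measurable functions of the samples. Functions
  that are continuous in the point and measurable in the sample are jointly measurable, and all step
  sizes lie in a countable set, so this follows by induction on the iteration (\<open>state_predictable\<close>).
\<close>

section \<open>Proximal operators of convex functions\<close>

lemma grad_eqI:
  assumes "GDERIV h x :> D"
  shows "grad h x = D"
  unfolding grad_def
proof (rule the_equality)
  fix E assume "GDERIV h x :> E"
  with assms have "(\<lambda>v. inner v D) = (\<lambda>v. inner v E)"
    unfolding gderiv_def by (rule has_derivative_unique)
  then have "inner (E - D) E = inner (E - D) D"
    by metis
  then have "inner (E - D) (E - D) = 0"
    by (simp add: inner_diff_right)
  then show "E = D" by simp
qed (fact assms)

locale lipschitz_convex =
  fixes r :: "'a::euclidean_space \<Rightarrow> ereal" and L\<^sub>r :: real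
  assumes proper: "proper_fun r" and closed_r: "closed_fun r" and convex_r: "convex_fun r"
    and lipschitz_r: "L\<^sub>r-lipschitz_on (edom r) (\<lambda>x. real_of_ereal (r x))"
begin

definition \<rho> :: "'a \<Rightarrow> real" where "\<rho> x = real_of_ereal (r x)"

lemma r_eq: "x \<in> edom r \<Longrightarrow> r x = ereal (\<rho> x)"
  using proper unfolding \<rho>_def edom_def proper_fun_def
  by (auto simp: ereal_real)

lemma edom_nonempty: "edom r \<noteq> {}"
  using proper by (simp add: proper_fun_def)

lemma Lr_nonneg: "0 \<le> L\<^sub>r"
  using lipschitz_r by (rule lipschitz_on_nonneg)

lemma \<rho>_lipschitz: "x \<in> edom r \<Longrightarrow> y \<in> edom r \<Longrightarrow> \<bar>\<rho> x - \<rho> y\<bar> \<le> L\<^sub>r * norm (x - y)"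
  using lipschitz_onD[OF lipschitz_r, of x y] by (simp add: \<rho>_def dist_norm)

lemma \<rho>_continuous: "continuous_on (edom r) \<rho>"
  using lipschitz_on_continuous_on[OF lipschitz_r] by (simp add: \<rho>_def[abs_def])

text \<open>Along a convergent sequence in the domain the values stay bounded, since \<open>r\<close> is Lipschitz
  there, so that closedness of the epigraph puts the limit into the domain.\<close>

lemma closed_edom: "closed (edom r)"
proof (unfold closed_sequential_limits, intro allI impI)
  fix X l assume X: "(\<forall>n. X n \<in> edom r) \<and> X \<longlonglongrightarrow> l"
  obtain B where B: "\<And>n. norm (X n - X 0) \<le> B"
  proof -
    have "convergent X" using X convergentI by blast
    then have "Bseq X" by (rule convergent_imp_Bseq)
    then obtain K where "\<And>n. norm (X n) \<le> K" by (auto simp: Bseq_def)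
    then have "norm (X n - X 0) \<le> K + K" for n
      using norm_triangle_ineq4[of "X n" "X 0"] by (smt (verit))
    then show ?thesis using that by blast
  qed
  let ?a = "\<rho> (X 0) + L\<^sub>r * B"
  have "r (X n) \<le> ereal ?a" for n
  proof -
    have "\<rho> (X n) \<le> \<rho> (X 0) + L\<^sub>r * norm (X n - X 0)"
      using \<rho>_lipschitz[of "X n" "X 0"] X by auto
    also have "\<dots> \<le> ?a" using B[of n] Lr_nonneg by (simp add: mult_left_mono)
    finally show ?thesis using r_eq X by simp
  qed
  then have "(X n, ?a) \<in> {(x, a::real). r x \<le> ereal a}" for n by simp
  moreover have "(\<lambda>n. (X n, ?a)) \<longlonglongrightarrow> (l, ?a)"
    using X by (intro tendsto_Pair) auto
  ultimately have "(l, ?a) \<in> {(x, a::real). r x \<le> ereal a}"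
    by (intro closed_sequentially[OF closed_r[unfolded closed_fun_def], of "\<lambda>n. (X n, ?a)" "(l, ?a)"])
  then have "r l \<le> ereal ?a" by simp
  also have "\<dots> < \<infinity>" by simp
  finally show "l \<in> edom r" by (simp add: edom_def)
qed

lemma \<rho>_convex:
  assumes "x \<in> edom r" "y \<in> edom r" "0 \<le> u" "0 \<le> v" "u + v = 1"
  shows "u *\<^sub>R x + v *\<^sub>R y \<in> edom r" "\<rho> (u *\<^sub>R x + v *\<^sub>R y) \<le> u * \<rho> x + v * \<rho> y"
proof -
  have *: "r (u *\<^sub>R x + v *\<^sub>R y) \<le> ereal (u * \<rho> x + v * \<rho> y)"
  proof -
    have "r (u *\<^sub>R x + v *\<^sub>R y) \<le> ereal u * r x + ereal v * r y"
      using convex_r assms(3-5) unfolding convex_fun_def by blast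
    then show ?thesis using r_eq[OF assms(1)] r_eq[OF assms(2)] by simp
  qed
  also have "\<dots> < \<infinity>" by simp
  finally show 1: "u *\<^sub>R x + v *\<^sub>R y \<in> edom r" by (simp add: edom_def)
  show "\<rho> (u *\<^sub>R x + v *\<^sub>R y) \<le> u * \<rho> x + v * \<rho> y"
    using * r_eq[OF 1] by simp
qed

lemma convex_edom: "convex (edom r)"
  using \<rho>_convex(1) by (intro convexI)

text \<open>On the domain \<open>r\<close> decreases at most linearly and is dominated by the quadratic term. The
  objective of the proximal problem therefore attains its minimum on the closed domain, so that the
  choice in the definition of \<open>prox\<close> picks a true minimiser.\<close>

lemma prox_minimal:
  assumes t: "t > 0"
  shows "prox t r x \<in> edom r"
    and "y \<in> edom r \<Longrightarrow>
      \<rho> (prox t r x) + 1 / (2 * t) * (norm (prox t r x - x))\<^sup>2 \<le> \<rho> y + 1 / (2 * t) * (norm (y - x))\<^sup>2"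
proof -
  let ?q = "\<lambda>y. \<rho> y + 1 / (2 * t) * (norm (y - x))\<^sup>2"
  let ?Q = "\<lambda>y. r y + ereal (1 / (2 * t) * (norm (y - x))\<^sup>2)"
  obtain y0 where y0: "y0 \<in> edom r" using edom_nonempty by blast
  define d where "d = norm (y0 - x)"
  (* Beyond this radius the quadratic term outweighs what r can lose against its value at y0. *)
  define R where "R = 2 * d + 4 * t * L\<^sub>r + 1"
  have dR: "d \<le> R" "R > 0" using t Lr_nonneg by (auto simp: R_def d_def intro: add_nonneg_pos)
  let ?C = "edom r \<inter> cball x R"
  have "compact ?C" using closed_edom by (simp add: closed_Int_compact)
  moreover have "y0 \<in> ?C" using y0 dR by (simp add: d_def dist_norm norm_minus_commute)
  moreover have "continuous_on ?C ?q"
    by (intro continuous_intros continuous_on_subset[OF \<rho>_continuous]) auto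
  ultimately obtain p where p: "p \<in> ?C" "\<And>y. y \<in> ?C \<Longrightarrow> ?q p \<le> ?q y"
    using continuous_attains_inf[of ?C ?q] by blast
  have p_min: "?q p \<le> ?q y" if y: "y \<in> edom r" for y
  proof (cases "y \<in> cball x R")
    case True then show ?thesis using p y by blast
  next
    case False
    define n where "n = norm (y - x)"
    have n: "n > R" using False by (simp add: n_def dist_norm norm_minus_commute)
    have "norm (y - y0) \<le> n + d"
      using norm_triangle_ineq4[of "y - x" "y0 - x"] by (simp add: n_def d_def)
    then have 1: "\<rho> y0 - \<rho> y \<le> L\<^sub>r * (n + d)"
      using \<rho>_lipschitz[OF y y0] mult_left_mono[OF _ Lr_nonneg, of "norm (y - y0)" "n + d"] by linarith
    have "2 * t * (L\<^sub>r * (n + d)) + d\<^sup>2 \<le> n\<^sup>2"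
    proof -
      have "0 \<le> d" by (simp add: d_def)
      moreover have tL: "0 \<le> t * L\<^sub>r" using t Lr_nonneg by simp
      moreover have "n - d \<ge> 2 * (t * L\<^sub>r)" using n \<open>0 \<le> d\<close> tL unfolding R_def by linarith
      ultimately have "(n + d) * (2 * (t * L\<^sub>r)) \<le> (n + d) * (n - d)"
        using n dR by (intro mult_left_mono) auto
      then show ?thesis by (simp add: algebra_simps power2_eq_square)
    qed
    then have "L\<^sub>r * (n + d) + 1 / (2 * t) * d\<^sup>2 \<le> 1 / (2 * t) * n\<^sup>2"
      using t mult_left_mono[of "2 * t * (L\<^sub>r * (n + d)) + d\<^sup>2" "n\<^sup>2" "1 / (2 * t)"]
      by (simp only: distrib_left) simp
    then have "?q y0 \<le> ?q y" using 1 unfolding n_def d_def by linarith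
    then show ?thesis using p \<open>y0 \<in> ?C\<close> by fastforce
  qed
  have Q_min: "\<not> ?Q y < ?Q p" for y
  proof (cases "y \<in> edom r")
    case True
    then show ?thesis using p_min[of y] p(1) by (simp add: r_eq)
  next
    case False
    then show ?thesis by (simp add: edom_def)
  qed
  have amin: "?Q (prox t r x) \<le> ?Q y" for y
    unfolding prox_def
    by (rule arg_minI[where P = "\<lambda>_. True" and x = p and f = ?Q and Q = "\<lambda>z. ?Q z \<le> ?Q y"])
      (use Q_min in \<open>simp_all add: not_less\<close>)
  have "?Q (prox t r x) < \<infinity>"
    using amin[of p] p(1) by (auto simp: r_eq)
  then show 2: "prox t r x \<in> edom r" by (auto simp: edom_def)
  show "?q (prox t r x) \<le> ?q y" if "y \<in> edom r" for y
    using amin[of y] r_eq[OF 2] r_eq[OF that] by simp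
qed

text \<open>This is the optimality condition \<open>(x - prox t r x) / t \<in> \<partial>r (prox t r x)\<close>, obtained by
  comparing the minimiser with the points of the segment towards \<open>y\<close>.\<close>

lemma prox_subgradient:
  assumes t: "t > 0" and y: "y \<in> edom r"
  shows "\<rho> (prox t r x) + inner (x - prox t r x) (y - prox t r x) / t \<le> \<rho> y"
proof -
  define p where "p = prox t r x"
  have p: "p \<in> edom r" unfolding p_def by (rule prox_minimal(1)[OF t])
  define A where "A = \<rho> p - \<rho> y + inner (x - p) (y - p) / t"
  define B where "B = (norm (y - p))\<^sup>2 / (2 * t)"
  have "A \<le> \<epsilon> * B" if \<epsilon>: "0 < \<epsilon>" "\<epsilon> \<le> 1" for \<epsilon>
  proof -
    let ?w = "(1 - \<epsilon>) *\<^sub>R p + \<epsilon> *\<^sub>R y"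
    have w: "?w \<in> edom r" "\<rho> ?w \<le> (1 - \<epsilon>) * \<rho> p + \<epsilon> * \<rho> y"
      using \<rho>_convex[OF p y, of "1 - \<epsilon>" \<epsilon>] \<epsilon> by auto
    have "\<rho> p + 1 / (2 * t) * (norm (p - x))\<^sup>2 \<le> \<rho> ?w + 1 / (2 * t) * (norm (?w - x))\<^sup>2"
      unfolding p_def by (rule prox_minimal(2)[OF t w(1)[unfolded p_def]])
    moreover have "(norm (?w - x))\<^sup>2 = (norm (p - x))\<^sup>2 - 2 * \<epsilon> * inner (x - p) (y - p) + \<epsilon>\<^sup>2 * (norm (y - p))\<^sup>2"
    proof -
      have "?w - x = (p - x) + \<epsilon> *\<^sub>R (y - p)" by (simp add: algebra_simps)
      then show ?thesis
        by (simp only: power2_norm_eq_inner) (simp add: inner_simps inner_commute algebra_simps power2_eq_square)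
    qed
    ultimately have "\<rho> p + 1 / (2 * t) * (norm (p - x))\<^sup>2 \<le> \<rho> ?w + 1 / (2 * t) *
        ((norm (p - x))\<^sup>2 - 2 * \<epsilon> * inner (x - p) (y - p) + \<epsilon>\<^sup>2 * (norm (y - p))\<^sup>2)"
      by (simp only:)
    also have "1 / (2 * t) * ((norm (p - x))\<^sup>2 - 2 * \<epsilon> * inner (x - p) (y - p) + \<epsilon>\<^sup>2 * (norm (y - p))\<^sup>2)
        = 1 / (2 * t) * (norm (p - x))\<^sup>2 - \<epsilon> * (inner (x - p) (y - p) / t) + \<epsilon>\<^sup>2 * B"
      using t unfolding B_def by (simp add: divide_simps)
    finally have "\<rho> p \<le> (1 - \<epsilon>) * \<rho> p + \<epsilon> * \<rho> y - \<epsilon> * (inner (x - p) (y - p) / t) + \<epsilon>\<^sup>2 * B"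
      using w(2) by linarith
    then have "\<epsilon> * A \<le> \<epsilon> * (\<epsilon> * B)"
      unfolding A_def by (simp add: algebra_simps power2_eq_square)
    then show ?thesis using \<epsilon> by simp
  qed
  then have "\<forall>\<^sub>F n in sequentially. A \<le> inverse (real (Suc n)) * B"
    by (intro always_eventually allI) (auto intro!: \<open>\<And>\<epsilon>. 0 < \<epsilon> \<Longrightarrow> \<epsilon> \<le> 1 \<Longrightarrow> A \<le> \<epsilon> * B\<close> simp: inverse_le_1_iff)
  moreover have "(\<lambda>n. inverse (real (Suc n)) * B) \<longlonglongrightarrow> 0 * B"
    by (intro tendsto_mult LIMSEQ_inverse_real_of_nat tendsto_const)
  ultimately have "A \<le> 0 * B"
    by (intro tendsto_lowerbound) auto
  then show ?thesis unfolding A_def p_def by simp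
qed

text \<open>Each of the two proximal points is used as the competitor in the optimality condition of the
  other.\<close>

lemma prox_nonexpansive:
  assumes t: "t > 0"
  shows "norm (prox t r x - prox t r y) \<le> norm (x - y)"
proof -
  let ?p = "prox t r x" and ?q = "prox t r y"
  have "inner (x - ?p) (?q - ?p) / t + inner (y - ?q) (?p - ?q) / t \<le> 0"
    using prox_subgradient[OF t prox_minimal(1)[OF t], of x y]
      prox_subgradient[OF t prox_minimal(1)[OF t], of y x] by linarith
  then have "inner (x - ?p) (?q - ?p) + inner (y - ?q) (?p - ?q) \<le> 0"
    using t by (simp add: field_simps)
  moreover have "inner (x - ?p) (?q - ?p) + inner (y - ?q) (?p - ?q)
      = inner (?p - ?q) (?p - ?q) - inner (x - y) (?p - ?q)"
    by (simp add: inner_diff_left inner_diff_right inner_commute)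
  ultimately have "(norm (?p - ?q))\<^sup>2 \<le> inner (x - y) (?p - ?q)"
    by (simp add: power2_norm_eq_inner)
  also have "\<dots> \<le> norm (x - y) * norm (?p - ?q)"
    by (rule norm_cauchy_schwarz)
  finally show ?thesis
    by (cases "?p = ?q") (auto simp: power2_eq_square)
qed

lemma prox_continuous: "t > 0 \<Longrightarrow> continuous_on UNIV (prox t r)"
  by (rule lipschitz_on_continuous_on[of 1])
    (auto intro!: lipschitz_onI simp: dist_norm prox_nonexpansive)

text \<open>The optimality condition with the starting point of the step as competitor: a proximal gradient
  step gains \<open>\<parallel>x - y\<parallel>\<^sup>2 / t\<close> against the linearised model.\<close>

lemma prox_step_decrease:
  assumes "t > 0" "x \<in> edom r"
  shows "\<rho> (prox t r (x - t *\<^sub>R v)) + inner v (prox t r (x - t *\<^sub>R v) - x)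
      + (norm (x - prox t r (x - t *\<^sub>R v)))\<^sup>2 / t \<le> \<rho> x"
proof -
  have "inner (x - t *\<^sub>R v - q) (x - q) / t = (norm (x - q))\<^sup>2 / t + inner v (q - x)" for q
    using assms(1)
    by (simp add: power2_norm_eq_inner inner_diff_left inner_diff_right inner_commute diff_divide_distrib)
      (simp add: add_divide_distrib diff_divide_distrib)
  then show ?thesis using prox_subgradient[OF assms, of "x - t *\<^sub>R v"] by simp
qed

text \<open>The Lipschitz constant of \<open>r\<close> acts as a bound on its subgradients, so steps are as short as
  those of a subgradient method. With bounded gradients this bounds all steps uniformly.\<close>

lemma prox_step_bound:
  assumes "t > 0" "x \<in> edom r"
  shows "norm (x - prox t r (x - t *\<^sub>R v)) \<le> t * (norm v + L\<^sub>r)"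
proof -
  define p where "p = prox t r (x - t *\<^sub>R v)"
  have p: "p \<in> edom r" unfolding p_def by (rule prox_minimal(1)[OF assms(1)])
  have "(norm (x - p))\<^sup>2 / t \<le> \<rho> x - \<rho> p + inner v (x - p)"
    using prox_step_decrease[OF assms, of v] by (simp add: p_def inner_diff_right)
  also have "\<dots> \<le> L\<^sub>r * norm (x - p) + norm v * norm (x - p)"
    using \<rho>_lipschitz[OF assms(2) p] norm_cauchy_schwarz[of v "x - p"] by linarith
  finally have "norm (x - p) * norm (x - p) \<le> (t * (norm v + L\<^sub>r)) * norm (x - p)"
    using assms(1) by (simp add: field_simps power2_eq_square)
  then show ?thesis unfolding p_def[symmetric]
    using assms(1) Lr_nonneg by (cases "x = p") auto
qed

text \<open>Adding the optimality conditions of the two proximal points, each tested against the other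
  one, gives \<open>(a - b) \<bullet> (t a - s b) \<le> 0\<close> for the two residuals, and Cauchy--Schwarz turns this
  into \<open>(\<parallel>a\<parallel> - \<parallel>b\<parallel>) (t \<parallel>a\<parallel> - s \<parallel>b\<parallel>) \<le> 0\<close>.\<close>

lemma prox_residual_antimono:
  assumes t: "0 < t" and ts: "t \<le> s"
  shows "norm (residual r (\<lambda>_. v) s x) \<le> norm (residual r (\<lambda>_. v) t x)"
proof (rule ccontr)
  assume neg: "\<not> ?thesis"
  have s: "s > 0" using assms by simp
  define p where "p = prox t r (x - t *\<^sub>R v)"
  define q where "q = prox s r (x - s *\<^sub>R v)"
  define a where "a = residual r (\<lambda>_. v) t x"
  define b where "b = residual r (\<lambda>_. v) s x"
  have pa: "p = x - t *\<^sub>R a" and qb: "q = x - s *\<^sub>R b"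
    using t s by (simp_all add: a_def b_def residual_def p_def q_def)
  have "inner (x - t *\<^sub>R v - p) (q - p) / t = inner (a - v) (q - p)"
    using t by (simp add: pa scaleR_diff_right[symmetric])
  moreover have "inner (x - s *\<^sub>R v - q) (p - q) / s = inner (b - v) (p - q)"
    using s by (simp add: qb scaleR_diff_right[symmetric])
  moreover have "\<rho> p + inner (x - t *\<^sub>R v - p) (q - p) / t \<le> \<rho> q"
    unfolding p_def q_def by (intro prox_subgradient prox_minimal t s)
  moreover have "\<rho> q + inner (x - s *\<^sub>R v - q) (p - q) / s \<le> \<rho> p"
    unfolding p_def q_def by (intro prox_subgradient prox_minimal t s)
  ultimately have "inner (a - v) (q - p) + inner (b - v) (p - q) \<le> 0" by linarith
  then have "t * (norm a)\<^sup>2 + s * (norm b)\<^sup>2 \<le> (t + s) * inner a b"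
    by (simp add: pa qb power2_norm_eq_inner inner_diff_left inner_diff_right inner_commute algebra_simps)
  also have "\<dots> \<le> (t + s) * (norm a * norm b)"
    using t s by (intro mult_left_mono norm_cauchy_schwarz) auto
  finally have "(norm b - norm a) * (s * norm b - t * norm a) \<le> 0"
    by (simp add: power2_eq_square algebra_simps)
  moreover have ba: "norm b > norm a" using neg by (simp add: a_def b_def)
  moreover have "s * norm b > t * norm a"
    using ba ts t by (smt (verit) mult_left_mono mult_right_mono mult_less_cancel_left_pos norm_ge_zero)
  ultimately show False
    by (smt (verit) mult_pos_pos)
qed

end

section \<open>One iteration with an inexact gradient\<close>

text \<open>Along the segment from \<open>x\<close> to \<open>y\<close>, the difference of \<open>h\<close> and the quadratic on the right-hand side
  has a nonpositive derivative.\<close>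

lemma descent_lemma:
  fixes h :: "'a::real_inner \<Rightarrow> real"
  assumes S: "convex S" and h: "\<And>y. y \<in> S \<Longrightarrow> GDERIV h y :> G y"
    and G: "L-lipschitz_on S G" and x: "x \<in> S" and y: "y \<in> S"
  shows "h y \<le> h x + inner (G x) (y - x) + L / 2 * (norm (y - x))\<^sup>2"
proof -
  let ?z = "\<lambda>u. x + u *\<^sub>R (y - x)"
  define \<psi> where "\<psi> u = h (?z u) - u * inner (G x) (y - x) - L / 2 * u\<^sup>2 * (norm (y - x))\<^sup>2" for u
  have "\<psi> 1 \<le> \<psi> 0"
  proof (rule DERIV_nonpos_imp_nonincreasing[where f = \<psi>])
    show "(0::real) \<le> 1" by simp
    fix u :: real assume u: "0 \<le> u" "u \<le> 1"
    have z: "?z u \<in> S"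
      using convexD_alt[OF S x y, of u] u by (simp add: algebra_simps)
    have dh: "(h has_derivative (\<lambda>v. inner v (G (?z u)))) (at (?z u))"
      using h[OF z] by (simp add: gderiv_def)
    have dz: "(?z has_derivative (\<lambda>v. v *\<^sub>R (y - x))) (at u)"
      by (auto intro!: derivative_eq_intros)
    have "((\<lambda>u. h (?z u)) has_derivative (\<lambda>v. inner (v *\<^sub>R (y - x)) (G (?z u)))) (at u)"
      by (rule has_derivative_compose[OF dz dh])
    then have "((\<lambda>u. h (?z u)) has_real_derivative inner (G (?z u)) (y - x)) (at u)"
      unfolding has_field_derivative_def
      by (rule back_subst[where P = "\<lambda>D. (_ has_derivative D) _"]) (simp add: fun_eq_iff inner_commute)
    then have "(\<psi> has_real_derivative
        inner (G (?z u)) (y - x) - inner (G x) (y - x) - L * u * (norm (y - x))\<^sup>2) (at u)"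
      unfolding \<psi>_def by (auto intro!: derivative_eq_intros)
    moreover have "inner (G (?z u)) (y - x) - inner (G x) (y - x) \<le> L * u * (norm (y - x))\<^sup>2"
    proof -
      have "inner (G (?z u)) (y - x) - inner (G x) (y - x) \<le> norm (G (?z u) - G x) * norm (y - x)"
        by (simp add: inner_diff_left[symmetric] norm_cauchy_schwarz)
      also have "norm (G (?z u) - G x) \<le> L * (u * norm (y - x))"
        using lipschitz_onD[OF G z x] u by (simp add: dist_norm)
      finally show ?thesis
        by (simp add: mult_right_mono power2_eq_square mult.assoc)
    qed
    ultimately show "\<exists>y. DERIV \<psi> u :> y \<and> y \<le> 0" by force
  qed
  then show ?thesis by (simp add: \<psi>_def)
qed

text \<open>Either the first trial succeeds, or the trial before the accepted one was longer than \<open>T\<close>,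
  because shorter trials are always accepted.\<close>

lemma backtracking_bound:
  fixes \<beta> \<tau> T :: real
  assumes \<tau>: "0 < \<tau>" and \<beta>: "0 < \<beta>" "\<beta> < 1" and T: "0 < T"
    and P: "\<And>t. 0 < t \<Longrightarrow> t \<le> T \<Longrightarrow> P t"
  defines "m \<equiv> (LEAST m. P (\<beta> ^ m * \<tau>))"
  shows "P (\<beta> ^ m * \<tau>)" "min \<tau> (T * \<beta>) \<le> \<beta> ^ m * \<tau>" "\<beta> ^ m * \<tau> \<le> \<tau>"
proof -
  obtain n where "\<beta> ^ n < T / \<tau>"
    using real_arch_pow_inv[of "T / \<tau>" \<beta>] \<tau> \<beta> T by auto
  then have "P (\<beta> ^ n * \<tau>)"
    using \<tau> \<beta> by (intro P) (auto simp: field_simps)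
  then show "P (\<beta> ^ m * \<tau>)" unfolding m_def by (rule LeastI)
  show "min \<tau> (T * \<beta>) \<le> \<beta> ^ m * \<tau>"
  proof (cases m)
    case (Suc l)
    then have "\<not> P (\<beta> ^ l * \<tau>)" unfolding m_def by (metis lessI not_less_Least)
    then have "T < \<beta> ^ l * \<tau>" using P[of "\<beta> ^ l * \<tau>"] \<tau> \<beta> by force
    then have "T * \<beta> \<le> \<beta> ^ l * \<tau> * \<beta>" using \<beta> by simp
    then show ?thesis using Suc by (simp add: mult_ac)
  qed simp
  show "\<beta> ^ m * \<tau> \<le> \<tau>" using \<tau> \<beta> by (simp add: power_le_one)
qed

lemma inner_Young:
  assumes "L > 0"
  shows "inner u v \<le> (norm u)\<^sup>2 / (2 * L) + L / 2 * (norm v)\<^sup>2"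
proof -
  have "0 \<le> (norm u - L * norm v)\<^sup>2" by simp
  then have "norm u * norm v \<le> (norm u)\<^sup>2 / (2 * L) + L / 2 * (norm v)\<^sup>2"
    using assms by (simp add: field_simps power2_eq_square)
  then show ?thesis using norm_cauchy_schwarz[of u v] by linarith
qed

lemma mult_le_sum_squares:
  fixes a b :: real
  assumes "0 \<le> a" "0 \<le> b"
  shows "a * b \<le> a\<^sup>2 + b\<^sup>2"
proof -
  have "0 \<le> a * b" using assms by simp
  moreover have "2 * (a * b) \<le> a\<^sup>2 + b\<^sup>2" using sum_squares_bound[of a b] by (simp add: mult.assoc)
  ultimately show ?thesis by linarith
qed

lemma norm_add_sq_le:
  fixes u v :: "'a::real_normed_vector"
  shows "(norm (u + v))\<^sup>2 \<le> 2 * (norm u)\<^sup>2 + 2 * (norm v)\<^sup>2"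
proof -
  have "(norm (u + v))\<^sup>2 \<le> (norm u + norm v)\<^sup>2"
    by (intro power_mono norm_triangle_ineq) simp
  also have "\<dots> \<le> 2 * (norm u)\<^sup>2 + 2 * (norm v)\<^sup>2"
    using sum_squares_bound[of "norm u" "norm v"] by (simp add: power2_sum)
  finally show ?thesis .
qed

context lipschitz_convex
begin

definition line_search_ok :: "('a \<Rightarrow> real) \<Rightarrow> 'a \<Rightarrow> real \<Rightarrow> 'a \<Rightarrow> real \<Rightarrow> bool" where
  "line_search_ok h v \<alpha> x t \<longleftrightarrow> (let y = prox t r (x - t *\<^sub>R v) in
     h y + \<rho> y - (h x + \<rho> x) \<le> - (\<alpha> / t) * (norm (x - y))\<^sup>2)"

text \<open>The model gain \<open>\<parallel>x - y\<parallel>\<^sup>2 / t\<close> pays for the error \<open>L / 2 \<parallel>x - y\<parallel>\<^sup>2\<close> of the linearisation and leaves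
  the fraction \<open>\<alpha>\<close> over if \<open>t \<le> 2 (1 - \<alpha>) / L\<close>.\<close>

lemma line_search_short_step:
  assumes h: "\<And>y. y \<in> edom r \<Longrightarrow> GDERIV h y :> q y" and q: "L-lipschitz_on (edom r) q"
    and L: "L > 0" and x: "x \<in> edom r" and t: "0 < t" "t \<le> 2 * (1 - \<alpha>) / L"
  shows "line_search_ok h (q x) \<alpha> x t"
proof -
  define y where "y = prox t r (x - t *\<^sub>R q x)"
  have y: "y \<in> edom r" unfolding y_def by (rule prox_minimal(1)[OF t(1)])
  have "h y \<le> h x + inner (q x) (y - x) + L / 2 * (norm (y - x))\<^sup>2"
    by (rule descent_lemma[OF convex_edom h q x y])
  moreover have "\<rho> y + inner (q x) (y - x) + (norm (x - y))\<^sup>2 / t \<le> \<rho> x"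
    unfolding y_def by (rule prox_step_decrease[OF t(1) x])
  moreover have "(L / 2 - 1 / t) * (norm (x - y))\<^sup>2 \<le> - (\<alpha> / t) * (norm (x - y))\<^sup>2"
  proof (rule mult_right_mono)
    have "L \<le> 2 * (1 - \<alpha>) / t" using t L by (simp add: field_simps)
    then show "L / 2 - 1 / t \<le> - (\<alpha> / t)" by (simp add: diff_divide_distrib)
  qed simp
  ultimately show ?thesis unfolding line_search_ok_def Let_def y_def[symmetric]
    by (simp add: norm_minus_commute left_diff_distrib)
qed

end

locale composite = lipschitz_convex r L\<^sub>r
  for r :: "'a::euclidean_space \<Rightarrow> ereal" and L\<^sub>r :: real +
  fixes f :: "'a \<Rightarrow> real" and g :: "'a \<Rightarrow> 'a" and L B :: real
  assumes f_deriv: "\<And>y. y \<in> edom r \<Longrightarrow> GDERIV f y :> g y"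
    and g_lipschitz: "L-lipschitz_on (edom r) g"
    and L_pos: "L > 0"
    and g_bound: "\<And>y. y \<in> edom r \<Longrightarrow> norm (g y) \<le> B"
begin

text \<open>Here \<open>h\<close> is an arbitrary model of \<open>f\<close> with an \<open>L\<close>-Lipschitz gradient \<open>q\<close>; nothing is random. The point
  \<open>w\<close> uses the gradient of \<open>f\<close> and the initial step \<open>\<tau>\<close>, and thus does not depend on \<open>h\<close>: for a random
  \<open>h\<close> with mean \<open>f\<close> the term \<open>(f w - h w) - (f x - h x)\<close> has mean zero. The error between \<open>w\<close> and the point
  \<open>y\<close> that is actually reached is quadratic in the gradient error, except if the step is shortened, which costs
  a constant.\<close>

lemma iteration_bound:
  assumes h: "\<And>y. y \<in> edom r \<Longrightarrow> GDERIV h y :> q y" and q: "L-lipschitz_on (edom r) q"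
    and x: "x \<in> edom r" and \<alpha>: "0 < \<alpha>" "\<alpha> < 1" and \<beta>: "0 < \<beta>" "\<beta> < 1"
    and c: "c = min s (2 * (1 - \<alpha>) * \<beta> / L)" and \<tau>: "c \<le> \<tau>" "\<tau> \<le> s" "0 < c"
  defines "m \<equiv> (LEAST m. line_search_ok h (q x) \<alpha> x (\<beta> ^ m * \<tau>))"
  defines "t \<equiv> \<beta> ^ m * \<tau>"
  defines "y \<equiv> prox t r (x - t *\<^sub>R q x)" and "w \<equiv> prox \<tau> r (x - \<tau> *\<^sub>R g x)"
  shows "c \<le> t" "y \<in> edom r" "w \<in> edom r"
    "\<alpha> * c / 2 * (norm (residual r g s x))\<^sup>2 \<le> (f x + \<rho> x) - (f y + \<rho> y)
      + ((f w - h w) - (f x - h x)) + (norm (g w - q w))\<^sup>2 / (2 * L)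
      + (3 * L * s\<^sup>2 + \<alpha> * c) * (norm (g x - q x))\<^sup>2
      + (if m = 0 then 0 else 12 * L * (s * (B + L\<^sub>r))\<^sup>2)"
proof -
  have s: "0 < s" and \<tau>0: "0 < \<tau>" using \<tau> by auto
  define T where "T = 2 * (1 - \<alpha>) / L"
  have T: "0 < T" using \<alpha> L_pos by (simp add: T_def)
  note bt = backtracking_bound[where P = "line_search_ok h (q x) \<alpha> x", OF \<tau>0 \<beta> T
      line_search_short_step[OF h q L_pos x], folded m_def t_def, unfolded T_def, simplified]
  have ok: "line_search_ok h (q x) \<alpha> x t" and t\<tau>: "t \<le> \<tau>"
    using bt by auto
  show ct: "c \<le> t" using bt(2) \<tau>(1) c by auto
  have t0: "0 < t" using ct \<tau> by simp
  have ts: "t \<le> s" using t\<tau> \<tau> by simp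
  show y: "y \<in> edom r" unfolding y_def by (rule prox_minimal(1)[OF t0])
  show w: "w \<in> edom r" unfolding w_def by (rule prox_minimal(1)[OF \<tau>0])
  define e where "e = norm (g x - q x)"
  define C where "C = s * (B + L\<^sub>r)"
  define b where "b = (if m = 0 then 0 else 12 * L * C\<^sup>2)"

  (* The residual norm decreases with the step size, so passing from t to s loses nothing; passing
     from q to g halves the coefficient, by (a + b)^2 <= 2 a^2 + 2 b^2, and leaves the error e. *)
  have res: "\<alpha> * c / 2 * (norm (residual r g s x))\<^sup>2 \<le> \<alpha> / t * (norm (x - y))\<^sup>2 + \<alpha> * c * e\<^sup>2"
  proof -
    let ?A = "residual r (\<lambda>_. q x) s x"
    have "residual r g s x - ?A = (1 / s) *\<^sub>R (prox s r (x - s *\<^sub>R q x) - prox s r (x - s *\<^sub>R g x))"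
      by (simp add: residual_def scaleR_diff_right[symmetric])
    moreover have "norm (prox s r (x - s *\<^sub>R q x) - prox s r (x - s *\<^sub>R g x)) \<le> s * e"
    proof -
      have "(x - s *\<^sub>R q x) - (x - s *\<^sub>R g x) = s *\<^sub>R (g x - q x)" by (simp add: algebra_simps)
      then show ?thesis using prox_nonexpansive[OF s, of "x - s *\<^sub>R q x" "x - s *\<^sub>R g x"] s
        by (simp add: e_def)
    qed
    ultimately have "norm (residual r g s x - ?A) \<le> e"
      using s by (simp add: pos_divide_le_eq mult.commute)
    then have "(norm (residual r g s x - ?A))\<^sup>2 \<le> e\<^sup>2" by (intro power_mono) auto
    then have 1: "(norm (residual r g s x))\<^sup>2 \<le> 2 * (norm ?A)\<^sup>2 + 2 * e\<^sup>2"
      using norm_add_sq_le[of ?A "residual r g s x - ?A"] by simp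
    have "norm ?A \<le> norm (residual r (\<lambda>_. q x) t x)"
      by (rule prox_residual_antimono[OF t0 ts])
    also have "\<dots> = norm (x - y) / t"
      using t0 by (simp add: residual_def y_def)
    finally have "(norm ?A)\<^sup>2 \<le> (norm (x - y) / t)\<^sup>2" by (intro power_mono) auto
    then have "\<alpha> * c * (norm ?A)\<^sup>2 \<le> \<alpha> * t * (norm (x - y) / t)\<^sup>2"
      using ct \<alpha> \<tau> by (intro mult_mono) auto
    also have "\<dots> = \<alpha> / t * (norm (x - y))\<^sup>2"
      using t0 by (simp add: power2_eq_square)
    finally have 2: "\<alpha> * c * (norm ?A)\<^sup>2 \<le> \<alpha> / t * (norm (x - y))\<^sup>2" .
    have "\<alpha> * c / 2 * (norm (residual r g s x))\<^sup>2 \<le> \<alpha> * c / 2 * (2 * (norm ?A)\<^sup>2 + 2 * e\<^sup>2)"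
      using 1 \<alpha> \<tau> by (intro mult_left_mono) auto
    also have "\<dots> = \<alpha> * c * (norm ?A)\<^sup>2 + \<alpha> * c * e\<^sup>2" by (simp add: algebra_simps)
    finally show ?thesis using 2 by linarith
  qed

  (* Without a reduction, y and w are proximal points for the same step size. With one, both are
     compared with x, from which every step of the exact method has length at most C. *)
  have dist: "L * 3 / 2 * (norm (y - w))\<^sup>2 \<le> 3 * L * s\<^sup>2 * e\<^sup>2 + b"
  proof -
    let ?y' = "prox t r (x - t *\<^sub>R g x)"
    have "norm (y - ?y') \<le> norm ((x - t *\<^sub>R q x) - (x - t *\<^sub>R g x))"
      unfolding y_def by (rule prox_nonexpansive[OF t0])
    also have "(x - t *\<^sub>R q x) - (x - t *\<^sub>R g x) = t *\<^sub>R (g x - q x)" by (simp add: algebra_simps)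
    also have "norm \<dots> \<le> s * e"
      using t0 ts by (simp add: e_def mult_right_mono)
    finally have yy: "norm (y - ?y') \<le> s * e" .
    then have yy2: "(norm (y - ?y'))\<^sup>2 \<le> s\<^sup>2 * e\<^sup>2"
      by (metis norm_ge_zero power_mono power_mult_distrib)
    show ?thesis
    proof (cases "m = 0")
      case True
      then have "?y' = w" by (simp add: w_def t_def)
      then have "L * 3 / 2 * (norm (y - w))\<^sup>2 \<le> L * 3 / 2 * (s\<^sup>2 * e\<^sup>2)"
        using yy2 L_pos by (intro mult_left_mono) auto
      also have "\<dots> \<le> 3 * L * s\<^sup>2 * e\<^sup>2"
        using L_pos by simp
      finally show ?thesis using True by (simp add: b_def)
    next
      case False
      have step: "norm (x - prox u r (x - u *\<^sub>R g x)) \<le> C" if "0 < u" "u \<le> s" for u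
      proof -
        have "norm (x - prox u r (x - u *\<^sub>R g x)) \<le> u * (norm (g x) + L\<^sub>r)"
          by (rule prox_step_bound[OF that(1) x])
        also have "\<dots> \<le> s * (B + L\<^sub>r)"
          using that g_bound[OF x] Lr_nonneg by (intro mult_mono) auto
        finally show ?thesis by (simp add: C_def)
      qed
      have "norm (?y' - w) \<le> 2 * C"
        using norm_triangle_ineq4[of "x - w" "x - ?y'"] step[OF t0 ts] step[OF \<tau>0 \<tau>(2)]
        by (simp add: w_def)
      then have "(norm (?y' - w))\<^sup>2 \<le> (2 * C)\<^sup>2" by (intro power_mono) auto
      then have "(norm (y - w))\<^sup>2 \<le> 2 * (s\<^sup>2 * e\<^sup>2) + 8 * C\<^sup>2"
        using norm_add_sq_le[of "y - ?y'" "?y' - w"] yy2 by (simp add: power_mult_distrib)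
      then have "L * 3 / 2 * (norm (y - w))\<^sup>2 \<le> L * 3 / 2 * (2 * (s\<^sup>2 * e\<^sup>2) + 8 * C\<^sup>2)"
        using L_pos by (intro mult_left_mono) auto
      then show ?thesis using False by (simp add: b_def algebra_simps)
    qed
  qed

  (* The factor 3/2 above is the sum of 1 from the 2L-Lipschitz gradient of f - h and 1/2 from
     Young's inequality. *)
  have err: "(f y - h y) \<le> (f w - h w) + (norm (g w - q w))\<^sup>2 / (2 * L) + 3 * L * s\<^sup>2 * e\<^sup>2 + b"
  proof -
    have "(L + L)-lipschitz_on (edom r) (\<lambda>z. g z - q z)"
      by (rule lipschitz_on_diff[OF g_lipschitz q])
    moreover have "\<And>z. z \<in> edom r \<Longrightarrow> GDERIV (\<lambda>z. f z - h z) z :> g z - q z"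
      by (intro GDERIV_diff f_deriv h)
    ultimately have "f y - h y \<le> f w - h w + inner (g w - q w) (y - w) + (L + L) / 2 * (norm (y - w))\<^sup>2"
      by (intro descent_lemma[OF convex_edom _ _ w y, where h = "\<lambda>z. f z - h z" and G = "\<lambda>z. g z - q z"])
    also have "inner (g w - q w) (y - w) \<le> (norm (g w - q w))\<^sup>2 / (2 * L) + L / 2 * (norm (y - w))\<^sup>2"
      by (rule inner_Young[OF L_pos])
    finally show ?thesis using dist by (simp add: algebra_simps)
  qed
  have "\<alpha> / t * (norm (x - y))\<^sup>2 \<le> (h x + \<rho> x) - (h y + \<rho> y)"
    using ok unfolding line_search_ok_def Let_def y_def[symmetric] by simp
  then have "\<alpha> * c / 2 * (norm (residual r g s x))\<^sup>2 \<le> (h x + \<rho> x) - (h y + \<rho> y) + \<alpha> * c * e\<^sup>2"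
    using res by linarith
  also have "\<dots> \<le> (f x + \<rho> x) - (f y + \<rho> y) + ((f w - h w) - (f x - h x))
      + (norm (g w - q w))\<^sup>2 / (2 * L) + (3 * L * s\<^sup>2 + \<alpha> * c) * e\<^sup>2 + b"
    using err by (simp add: algebra_simps)
  finally show "\<alpha> * c / 2 * (norm (residual r g s x))\<^sup>2 \<le> (f x + \<rho> x) - (f y + \<rho> y)
      + ((f w - h w) - (f x - h x)) + (norm (g w - q w))\<^sup>2 / (2 * L)
      + (3 * L * s\<^sup>2 + \<alpha> * c) * (norm (g x - q x))\<^sup>2
      + (if m = 0 then 0 else 12 * L * (s * (B + L\<^sub>r))\<^sup>2)"
    unfolding e_def b_def C_def .
qed

end

section \<open>Counting the iterations that shorten the step\<close>

text \<open>A step that is not the first of a cycle starts from the exponent that the previous step ended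
  with. Exponents are bounded by \<open>n\<close>, so a cycle can increase them at most \<open>n\<close> times; the potential
  \<open>n - j (K - 1)\<close> counts the increases still available to the current cycle.\<close>

lemma card_increases_le:
  fixes j :: "nat \<Rightarrow> nat" and m :: "nat \<Rightarrow> nat" and start :: "nat \<Rightarrow> bool"
  assumes start0: "start 0"
    and j: "\<And>k. j k = (if start k then 0 else j (k - 1)) + m k"
    and n: "\<And>k. j k \<le> n"
  shows "card {k. k < K \<and> m k \<noteq> 0} \<le> n * card {k. k < K \<and> start k}"
proof -
  have set: "{k. k < Suc K \<and> P k} = (if P K then insert K {k. k < K \<and> P k} else {k. k < K \<and> P k})"
    for K and P :: "nat \<Rightarrow> bool" by (auto simp: less_Suc_eq)
  have "card {k. k < Suc K \<and> m k \<noteq> 0} + (n - j K) \<le> n * card {k. k < Suc K \<and> start k}" for K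
  proof (induction K)
    case 0
    have "j 0 = m 0" using j[of 0] start0 by simp
    moreover have "{k. k < Suc 0 \<and> m k \<noteq> 0} = (if m 0 = 0 then {} else {0})"
      "{k. k < Suc 0 \<and> start k} = {0}" using start0 by (auto intro: gr0I)
    ultimately show ?case using n[of 0] by (cases "m 0 = 0") auto
  next
    case (Suc K)
    show ?case
      using Suc j[of "Suc K"] n[of K] n[of "Suc K"]
      by (subst (1 2) set) (auto simp: not_le)
  qed
  note * = this
  show ?thesis
  proof (cases K)
    case (Suc l) then show ?thesis using add_leD1[OF *[of l]] by simp
  qed simp
qed

text \<open>Cycle \<open>j\<close> starts at \<open>p 0 + \<dots> + p (j - 1)\<close>. If that is below \<open>K\<close>, then \<open>j\<close> is at most the cycle index of
  \<open>K\<close>.\<close>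

lemma card_cycle_starts_le:
  assumes p: "\<forall>j. p j > (0::nat)"
  shows "card {k. k < K \<and> cycle_start p k} \<le> Suc (cycle_index p K)"
proof -
  have ge: "l \<le> (\<Sum>j<l. p j)" for l
  proof (induction l)
    case (Suc l) then show ?case using p[rule_format, of l] by simp
  qed simp
  have "K \<le> (\<Sum>j\<le>K. p j)"
    using ge[of "Suc K"] by (simp add: lessThan_Suc_atMost)
  then have J: "K \<le> (\<Sum>j\<le>cycle_index p K. p j)"
    unfolding cycle_index_def by (rule LeastI)
  have "{k. k < K \<and> cycle_start p k} \<subseteq> (\<lambda>j. \<Sum>i<j. p i) ` {..cycle_index p K}"
  proof
    fix k assume "k \<in> {k. k < K \<and> cycle_start p k}"
    then obtain j where j: "k = (\<Sum>i<j. p i)" "k < K" by (auto simp: cycle_start_def)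
    have "j \<le> cycle_index p K"
    proof (rule ccontr)
      assume "\<not> ?thesis"
      then have "(\<Sum>i\<le>cycle_index p K. p i) \<le> (\<Sum>i<j. p i)"
        by (intro sum_mono2) auto
      then show False using j J by simp
    qed
    then show "k \<in> (\<lambda>j. \<Sum>i<j. p i) ` {..cycle_index p K}" using j by auto
  qed
  then have "card {k. k < K \<and> cycle_start p k} \<le> card ((\<lambda>j. \<Sum>i<j. p i) ` {..cycle_index p K})"
    by (intro card_mono) auto
  also have "\<dots> \<le> Suc (cycle_index p K)"
    using card_image_le[of "{..cycle_index p K}"] by simp
  finally show ?thesis .
qed

section \<open>Independence: freezing one of two variables\<close>

context prob_space
begin

text \<open>The joint law of independent variables is the product of their laws. By Fubini's theorem one of
  them can be held fixed while the other one is integrated.\<close>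

lemma indep_var_nn_integral_freeze:
  assumes ind: "indep_var S X T Y" and h: "h \<in> borel_measurable (S \<Otimes>\<^sub>M T)"
  shows "(\<integral>\<^sup>+ \<omega>. h (X \<omega>, Y \<omega>) \<partial>M) = (\<integral>\<^sup>+ \<omega>. (\<integral>\<^sup>+ \<omega>'. h (X \<omega>, Y \<omega>') \<partial>M) \<partial>M)"
proof -
  have [measurable]: "X \<in> M \<rightarrow>\<^sub>M S" "Y \<in> M \<rightarrow>\<^sub>M T"
    using indep_var_rv1[OF ind] indep_var_rv2[OF ind] .
  interpret Y: prob_space "distr M T Y" by (rule prob_space_distr) simp
  have "(\<integral>\<^sup>+ \<omega>. h (X \<omega>, Y \<omega>) \<partial>M) = (\<integral>\<^sup>+ z. h z \<partial>distr M (S \<Otimes>\<^sub>M T) (\<lambda>\<omega>. (X \<omega>, Y \<omega>)))"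
    using h by (subst nn_integral_distr) auto
  also have "\<dots> = (\<integral>\<^sup>+ z. h z \<partial>(distr M S X \<Otimes>\<^sub>M distr M T Y))"
    using ind by (simp add: indep_var_distribution_eq)
  also have "\<dots> = (\<integral>\<^sup>+ x. (\<integral>\<^sup>+ y. h (x, y) \<partial>distr M T Y) \<partial>distr M S X)"
    using h by (subst Y.nn_integral_fst) (simp_all cong: measurable_cong_sets)
  also have "\<dots> = (\<integral>\<^sup>+ \<omega>. (\<integral>\<^sup>+ y. h (X \<omega>, y) \<partial>distr M T Y) \<partial>M)"
    using Y.borel_measurable_nn_integral_fst[of h S] h
    by (subst nn_integral_distr) (simp_all cong: measurable_cong_sets)
  also have "\<dots> = (\<integral>\<^sup>+ \<omega>. (\<integral>\<^sup>+ \<omega>'. h (X \<omega>, Y \<omega>') \<partial>M) \<partial>M)"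
  proof (intro nn_integral_cong)
    fix \<omega> assume "\<omega> \<in> space M"
    then have "X \<omega> \<in> space S" using measurable_space[of X M S] by simp
    then have "(\<lambda>y. h (X \<omega>, y)) \<in> borel_measurable T" using h by measurable
    then show "(\<integral>\<^sup>+ y. h (X \<omega>, y) \<partial>distr M T Y) = (\<integral>\<^sup>+ \<omega>'. h (X \<omega>, Y \<omega>') \<partial>M)"
      by (subst nn_integral_distr) simp_all
  qed
  finally show ?thesis .
qed

lemma indep_var_integral_eq_0_freeze:
  fixes h :: "'b \<times> 'b \<Rightarrow> real"
  assumes ind: "indep_var S X T Y" and h: "h \<in> borel_measurable (S \<Otimes>\<^sub>M T)"
    and int: "integrable M (\<lambda>\<omega>. h (X \<omega>, Y \<omega>))"
    and zero: "\<And>\<omega>. \<omega> \<in> space M \<Longrightarrow> (\<integral>\<omega>'. h (X \<omega>, Y \<omega>') \<partial>M) = 0"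
  shows "(\<integral>\<omega>. h (X \<omega>, Y \<omega>) \<partial>M) = 0"
proof -
  have [measurable]: "X \<in> M \<rightarrow>\<^sub>M S" "Y \<in> M \<rightarrow>\<^sub>M T"
    using indep_var_rv1[OF ind] indep_var_rv2[OF ind] .
  interpret X: prob_space "distr M S X" by (rule prob_space_distr) simp
  interpret Y: prob_space "distr M T Y" by (rule prob_space_distr) simp
  interpret XY: pair_sigma_finite "distr M S X" "distr M T Y" ..
  have eq: "distr M (S \<Otimes>\<^sub>M T) (\<lambda>\<omega>. (X \<omega>, Y \<omega>)) = distr M S X \<Otimes>\<^sub>M distr M T Y"
    using ind by (simp add: indep_var_distribution_eq)
  have "integrable (distr M (S \<Otimes>\<^sub>M T) (\<lambda>\<omega>. (X \<omega>, Y \<omega>))) h"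
    using h int by (subst integrable_distr_eq) auto
  then have int': "integrable (distr M S X \<Otimes>\<^sub>M distr M T Y) h" by (simp add: eq)
  have "(\<integral>\<omega>. h (X \<omega>, Y \<omega>) \<partial>M) = (\<integral>z. h z \<partial>distr M (S \<Otimes>\<^sub>M T) (\<lambda>\<omega>. (X \<omega>, Y \<omega>)))"
    using h by (subst integral_distr) auto
  also have "\<dots> = (\<integral>x. (\<integral>y. h (x, y) \<partial>distr M T Y) \<partial>distr M S X)"
    by (simp add: eq XY.integral_fst'[OF int'])
  also have "\<dots> = (\<integral>\<omega>. (\<integral>y. h (X \<omega>, y) \<partial>distr M T Y) \<partial>M)"
  proof (rule integral_distr)
    show "(\<lambda>x. \<integral>y. h (x, y) \<partial>distr M T Y) \<in> borel_measurable S"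
      using XY.integrable_fst'[OF int'] by (simp cong: measurable_cong_sets add: integrable_iff_bounded)
  qed simp
  also have "\<dots> = (\<integral>\<omega>. 0 \<partial>M)"
  proof (intro Bochner_Integration.integral_cong refl)
    fix \<omega> assume \<omega>: "\<omega> \<in> space M"
    then have "X \<omega> \<in> space S" using measurable_space[of X M S] by simp
    then have "(\<lambda>y. h (X \<omega>, y)) \<in> borel_measurable T" using h by measurable
    then show "(\<integral>y. h (X \<omega>, y) \<partial>distr M T Y) = 0"
      using zero[OF \<omega>] by (subst integral_distr) simp_all
  qed
  finally show ?thesis by simp
qed

lemma indep_vars_pair:
  assumes ind: "indep_vars N X A" and ij: "i \<in> A" "j \<in> A" "i \<noteq> j"
  shows "indep_var (N i) (X i) (N j) (X j)"
proof -
  have "indep_var (N i) ((\<lambda>f. f i) \<circ> (\<lambda>\<omega>. restrict (\<lambda>i. X i \<omega>) {i}))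
      (N j) ((\<lambda>f. f j) \<circ> (\<lambda>\<omega>. restrict (\<lambda>i. X i \<omega>) {j}))"
    using ij by (intro indep_var_compose[OF indep_var_restrict[OF ind]] measurable_component_singleton) auto
  then show ?thesis by (simp add: o_def)
qed

text \<open>Independent centred vectors are orthogonal in \<open>L\<^sup>2\<close>: freezing one factor of the inner
  product leaves the mean of the other.\<close>

lemma sum_indep_second_moment:
  fixes Y :: "'i \<Rightarrow> 'a \<Rightarrow> 'b::euclidean_space"
  assumes fin: "finite A" and ind: "indep_vars (\<lambda>_. borel) Y A"
    and mean: "\<And>i. i \<in> A \<Longrightarrow> integrable M (Y i)" "\<And>i. i \<in> A \<Longrightarrow> (\<integral>\<omega>. Y i \<omega> \<partial>M) = 0"
    and V: "\<And>i. i \<in> A \<Longrightarrow> (\<integral>\<^sup>+ \<omega>. ennreal ((norm (Y i \<omega>))\<^sup>2) \<partial>M) \<le> ennreal V" "0 \<le> V"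
  shows "(\<integral>\<^sup>+ \<omega>. ennreal ((norm (\<Sum>i\<in>A. Y i \<omega>))\<^sup>2) \<partial>M) \<le> ennreal (real (card A) * V)"
proof -
  have meas: "i \<in> A \<Longrightarrow> Y i \<in> borel_measurable M" for i
    using mean(1) by (rule borel_measurable_integrable)
  have sq: "integrable M (\<lambda>\<omega>. (norm (Y i \<omega>))\<^sup>2)" "(\<integral>\<omega>. (norm (Y i \<omega>))\<^sup>2 \<partial>M) \<le> V" if "i \<in> A" for i
  proof -
    show 1: "integrable M (\<lambda>\<omega>. (norm (Y i \<omega>))\<^sup>2)"
    proof (rule integrableI_bounded)
      show "(\<lambda>\<omega>. (norm (Y i \<omega>))\<^sup>2) \<in> borel_measurable M" using meas[OF that] by measurable
      show "(\<integral>\<^sup>+ \<omega>. ennreal (norm ((norm (Y i \<omega>))\<^sup>2)) \<partial>M) < \<infinity>"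
        using V(1)[OF that] le_less_trans[OF _ ennreal_less_top] by simp
    qed
    show "(\<integral>\<omega>. (norm (Y i \<omega>))\<^sup>2 \<partial>M) \<le> V"
      using V(1)[OF that] V(2) nn_integral_eq_integral[OF 1] by simp
  qed
  have inn: "integrable M (\<lambda>\<omega>. inner (Y i \<omega>) (Y j \<omega>))" if "i \<in> A" "j \<in> A" for i j
  proof (rule Bochner_Integration.integrable_bound)
    show "integrable M (\<lambda>\<omega>. (norm (Y i \<omega>))\<^sup>2 + (norm (Y j \<omega>))\<^sup>2)"
      using sq that by (intro Bochner_Integration.integrable_add) auto
    show "(\<lambda>\<omega>. inner (Y i \<omega>) (Y j \<omega>)) \<in> borel_measurable M"
      using meas[OF that(1)] meas[OF that(2)] by measurable
    have "\<bar>inner u v\<bar> \<le> (norm u)\<^sup>2 + (norm v)\<^sup>2" for u v :: 'b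
      using Cauchy_Schwarz_ineq2[of u v] sum_squares_bound[of "norm u" "norm v"]
        mult_nonneg_nonneg[of "norm u" "norm v"] by (simp add: mult.assoc)
    then show "AE \<omega> in M. norm (inner (Y i \<omega>) (Y j \<omega>)) \<le> norm ((norm (Y i \<omega>))\<^sup>2 + (norm (Y j \<omega>))\<^sup>2)"
      by (intro always_eventually) (simp add: abs_of_nonneg)
  qed
  have orth: "(\<integral>\<omega>. inner (Y i \<omega>) (Y j \<omega>) \<partial>M) = 0" if ij: "i \<in> A" "j \<in> A" "i \<noteq> j" for i j
    using indep_var_integral_eq_0_freeze[OF indep_vars_pair[OF ind ij],
        where h = "\<lambda>(u, v). inner u v"] inn[OF ij(1,2)] mean(1)[OF ij(2)] mean(2)[OF ij(2)]
    by simp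
  have expand: "(norm (\<Sum>i\<in>A. Y i \<omega>))\<^sup>2 = (\<Sum>i\<in>A. \<Sum>j\<in>A. inner (Y i \<omega>) (Y j \<omega>))" for \<omega>
    by (simp add: power2_norm_eq_inner inner_sum_left inner_sum_right) (rule sum.swap)
  have int: "integrable M (\<lambda>\<omega>. (norm (\<Sum>i\<in>A. Y i \<omega>))\<^sup>2)"
    unfolding expand using inn by (intro Bochner_Integration.integrable_sum) auto
  have "(\<integral>\<omega>. (norm (\<Sum>i\<in>A. Y i \<omega>))\<^sup>2 \<partial>M) = (\<Sum>i\<in>A. \<Sum>j\<in>A. \<integral>\<omega>. inner (Y i \<omega>) (Y j \<omega>) \<partial>M)"
    unfolding expand using inn by (simp add: Bochner_Integration.integral_sum Bochner_Integration.integrable_sum)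
  also have "\<dots> = (\<Sum>i\<in>A. \<Sum>j\<in>A. if j = i then \<integral>\<omega>. (norm (Y i \<omega>))\<^sup>2 \<partial>M else 0)"
    by (intro sum.cong refl) (auto simp: orth power2_norm_eq_inner)
  also have "\<dots> \<le> (\<Sum>i\<in>A. V)"
    using fin sq by (intro sum_mono) (simp add: sum.delta)
  finally have "(\<integral>\<omega>. (norm (\<Sum>i\<in>A. Y i \<omega>))\<^sup>2 \<partial>M) \<le> real (card A) * V" by simp
  then show ?thesis using nn_integral_eq_integral[OF int] by (simp add: ennreal_leI)
qed

end

section \<open>Measurability of functions of a point and a sample\<close>

text \<open>A function that is continuous in the first argument and measurable in the second is the
  limit of the functions obtained by replacing the first argument by the first point of a countable
  dense set within distance \<open>1 / n\<close>.\<close>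

lemma Caratheodory_measurable:
  fixes h :: "'a::{metric_space, second_countable_topology} \<Rightarrow> 'b \<Rightarrow> 'c::metric_space"
  assumes cont: "\<And>z. z \<in> space N \<Longrightarrow> continuous_on UNIV (\<lambda>x. h x z)"
    and meas: "\<And>x. h x \<in> borel_measurable N"
  shows "(\<lambda>(x, z). h x z) \<in> borel_measurable (borel \<Otimes>\<^sub>M N)"
proof -
  obtain D :: "'a set" where D: "countable D" "\<And>U. open U \<Longrightarrow> U \<noteq> {} \<Longrightarrow> \<exists>d\<in>D. d \<in> U"
    using countable_dense_exists by blast
  have Dne: "D \<noteq> {}" using D(2)[of UNIV] by auto
  define d where "d = from_nat_into D"
  have near: "\<exists>i. dist x (d i) < 1 / Suc n" for x n
  proof -
    have "ball x (1 / Suc n) \<noteq> {}" using centre_in_ball[of x "1 / Suc n"] by (metis empty_iff of_nat_0_less_iff zero_less_Suc zero_less_divide_1_iff)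
    then obtain y where "y \<in> D" "dist x y < 1 / Suc n"
      using D(2)[of "ball x (1 / Suc n)"] by auto
    then show ?thesis using from_nat_into_surj[OF D(1), of y] by (auto simp: d_def)
  qed
  define i where "i n x = (LEAST i. dist x (d i) < 1 / Suc n)" for n x
  have i: "dist x (d (i n x)) < 1 / Suc n" for n x
    unfolding i_def by (rule LeastI_ex[OF near])
  have [measurable]: "i n \<in> borel \<rightarrow>\<^sub>M count_space UNIV" for n
    unfolding i_def by measurable
  show ?thesis
  proof (rule borel_measurable_LIMSEQ_metric)
    fix n
    have "(\<lambda>w. h (d k) (snd w)) \<in> borel_measurable (borel \<Otimes>\<^sub>M N)" for k
      using meas by measurable
    then have "(\<lambda>w. h (d (i n (fst w))) (snd w)) \<in> borel_measurable (borel \<Otimes>\<^sub>M N)"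
      by (rule measurable_compose_countable) measurable
    then show "(\<lambda>(x, z). h (d (i n x)) z) \<in> borel_measurable (borel \<Otimes>\<^sub>M N)"
      by (simp add: case_prod_beta')
  next
    fix w assume w: "w \<in> space (borel \<Otimes>\<^sub>M N :: ('a \<times> 'b) measure)"
    obtain x z where xz: "w = (x, z)" by force
    have z: "z \<in> space N" using w by (simp add: xz space_pair_measure)
    have "(\<lambda>n. d (i n x)) \<longlonglongrightarrow> x"
    proof (rule metric_LIMSEQ_I)
      fix e :: real assume "0 < e"
      then obtain m where "1 / Suc m < e" using nat_approx_posE by blast
      then have "dist (d (i n x)) x < e" if "n \<ge> m" for n
        using i[of x n] that frac_le[of 1 1 "real (Suc m)" "real (Suc n)"] by (simp add: dist_commute)
      then show "\<exists>m. \<forall>n\<ge>m. dist (d (i n x)) x < e" by blast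
    qed
    then have "(\<lambda>n. h (d (i n x)) z) \<longlonglongrightarrow> h x z"
      by (intro continuous_on_tendsto_compose[OF cont[OF z]]) auto
    then show "(\<lambda>n. (\<lambda>(x, z). h (d (i n x)) z) w) \<longlonglongrightarrow> (\<lambda>(x, z). h x z) w" by (simp add: xz)
  qed
qed

text \<open>Coordinates of the gradient are limits of difference quotients.\<close>

lemma gradient_measurable:
  fixes F :: "'a::euclidean_space \<Rightarrow> 'b \<Rightarrow> real"
  assumes meas: "\<And>x. F x \<in> borel_measurable N"
    and deriv: "\<And>z. z \<in> space N \<Longrightarrow> GDERIV (\<lambda>x. F x z) x :> G z"
  shows "G \<in> borel_measurable N"
proof (rule borel_measurable_euclidean_space[THEN iffD2], rule ballI)
  fix b :: 'a assume "b \<in> Basis"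
  show "(\<lambda>z. inner (G z) b) \<in> borel_measurable N"
  proof (rule borel_measurable_LIMSEQ_real)
    show "(\<lambda>z. (F (x + inverse (real (Suc n)) *\<^sub>R b) z - F x z) / inverse (real (Suc n))) \<in> borel_measurable N" for n
      using meas by measurable
    fix z assume z: "z \<in> space N"
    have d1: "((\<lambda>x. F x z) has_derivative (\<lambda>v. inner v (G z))) (at (x + 0 *\<^sub>R b))"
      using deriv[OF z] by (simp add: gderiv_def)
    have d2: "((\<lambda>u. x + u *\<^sub>R b) has_derivative (\<lambda>u. u *\<^sub>R b)) (at (0::real))"
      by (auto intro!: derivative_eq_intros)
    have "((\<lambda>u. F (x + u *\<^sub>R b) z) has_derivative (\<lambda>u. inner (u *\<^sub>R b) (G z))) (at 0)"
      by (rule has_derivative_compose[OF d2 d1])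
    then have "((\<lambda>u. F (x + u *\<^sub>R b) z) has_real_derivative inner (G z) b) (at 0)"
      unfolding has_field_derivative_def
      by (rule back_subst[where P = "\<lambda>D. (_ has_derivative D) _"]) (simp add: fun_eq_iff inner_commute)
    then have lim: "((\<lambda>u. (F (x + u *\<^sub>R b) z - F x z) / u) \<longlongrightarrow> inner (G z) b) (at 0)"
      by (simp add: DERIV_def)
    have "filterlim (\<lambda>n. inverse (real (Suc n))) (at 0) sequentially"
      using LIMSEQ_inverse_real_of_nat by (simp add: filterlim_at)
    from filterlim_compose[OF lim this]
    show "(\<lambda>n. (F (x + inverse (real (Suc n)) *\<^sub>R b) z - F x z) / inverse (real (Suc n))) \<longlonglongrightarrow> inner (G z) b" .
  qed
qed

section \<open>The stochastic problem\<close>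

text \<open>The constants \<open>B\<close> and \<open>\<phi>_low\<close> are witnesses of the two existential statements of the first
  assumption. The error of an iteration that shortens its step depends on \<open>B\<close>.\<close>

locale stochastic_composite =
  fixes \<Omega> :: "'w measure" and \<xi> :: "'w \<Rightarrow> real^'d" and \<Xi> :: "(real^'d) set"
    and F :: "real^'n \<Rightarrow> real^'d \<Rightarrow> real" and r :: "real^'n \<Rightarrow> ereal"
    and L\<^sub>r L \<sigma> B \<phi>_low :: real
  assumes problem: "stochastic_problem \<Omega> \<xi> \<Xi> F"
    and A1: "assumption_A1 \<Omega> \<xi> F r L\<^sub>r"
    and A2: "assumption_A2 \<Omega> \<xi> \<Xi> F r L"
    and A3: "assumption_A3 \<Omega> \<xi> F r \<sigma>"
    and obj_grad_bound: "\<And>x. x \<in> edom r \<Longrightarrow> norm (obj_grad \<Omega> \<xi> F x) \<le> B"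
    and obj_lower_bound: "\<And>x. x \<in> edom r \<Longrightarrow> ereal \<phi>_low \<le> obj \<Omega> \<xi> F x + r x"
begin

abbreviation f :: "real^'n \<Rightarrow> real" where "f x \<equiv> real_of_ereal (obj \<Omega> \<xi> F x)"
abbreviation g :: "real^'n \<Rightarrow> real^'n" where "g \<equiv> obj_grad \<Omega> \<xi> F"

definition G :: "real^'n \<Rightarrow> real^'d \<Rightarrow> real^'n" where "G x z = grad (\<lambda>y. F y z) x"

lemma prob_space_\<Omega>: "prob_space \<Omega>"
  and \<xi>_measurable: "\<xi> \<in> \<Omega> \<rightarrow>\<^sub>M sample_space \<Xi>"
  and F_measurable: "F x \<in> borel_measurable (sample_space \<Xi>)"
  using problem by (simp_all add: stochastic_problem_def)

lemma space_sample [simp]: "space (sample_space \<Xi>) = \<Xi>"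
  by (simp add: space_restrict_space)

lemma \<xi>_in: "\<omega> \<in> space \<Omega> \<Longrightarrow> \<xi> \<omega> \<in> \<Xi>"
  using measurable_space[OF \<xi>_measurable] by simp

lemma edom_subset: "edom r \<subseteq> interior (edom (obj \<Omega> \<xi> F))"
  using A1 by (simp add: assumption_A1_def Let_def)

lemma L_gt_0: "L > 0"
  using A2 by (simp add: assumption_A2_def)

lemma \<sigma>_gt_0: "\<sigma> > 0"
  using A3 by (simp add: assumption_A3_def)

lemma F_deriv:
  assumes "x \<in> edom r" "z \<in> \<Xi>"
  shows "GDERIV (\<lambda>y. F y z) x :> G x z"
proof -
  obtain D where "GDERIV (\<lambda>y. F y z) x :> D"
    using A2 assms edom_subset unfolding assumption_A2_def cont_diff_on_def by blast
  then show ?thesis by (metis G_def grad_eqI)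
qed

lemma G_lipschitz: "z \<in> \<Xi> \<Longrightarrow> L-lipschitz_on (edom r) (\<lambda>x. G x z)"
  using A2 unfolding assumption_A2_def G_def by simp

lemma G_measurable: "x \<in> edom r \<Longrightarrow> G x \<in> borel_measurable (sample_space \<Xi>)"
  using gradient_measurable[of F "sample_space \<Xi>" x "G x"] F_measurable F_deriv by simp

lemma F_mean:
  assumes "x \<in> edom r"
  shows "integrable \<Omega> (\<lambda>\<omega>. F x (\<xi> \<omega>))" "(\<integral>\<omega>. F x (\<xi> \<omega>) \<partial>\<Omega>) = f x" "obj \<Omega> \<xi> F x = ereal (f x)"
  using A3 assms unfolding assumption_A3_def
  by (auto simp flip: ereal_real)
    (metis real_of_ereal.simps(1))+

lemma G_mean:
  assumes "x \<in> edom r"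
  shows "integrable \<Omega> (\<lambda>\<omega>. G x (\<xi> \<omega>))" "(\<integral>\<omega>. G x (\<xi> \<omega>) \<partial>\<Omega>) = g x"
    "(\<integral>\<^sup>+ \<omega>. ennreal ((norm (G x (\<xi> \<omega>) - g x))\<^sup>2) \<partial>\<Omega>) \<le> ennreal (\<sigma>\<^sup>2)"
  using A3 assms unfolding assumption_A3_def G_def by auto

text \<open>The gradient of \<open>f\<close> is the mean of the sample gradients and inherits their Lipschitz constant.\<close>

lemma composite: "composite r L\<^sub>r f g L B"
proof
  show "proper_fun r" "closed_fun r" "convex_fun r" "L\<^sub>r-lipschitz_on (edom r) (\<lambda>x. real_of_ereal (r x))"
    using A1 by (simp_all add: assumption_A1_def Let_def)
  show "GDERIV f y :> g y" if y: "y \<in> edom r" for y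
  proof -
    obtain D where "GDERIV f y :> D"
      using A1 y edom_subset unfolding assumption_A1_def Let_def cont_diff_on_def by blast
    then show ?thesis by (metis obj_grad_def grad_eqI)
  qed
  show "L-lipschitz_on (edom r) g"
  proof (rule lipschitz_onI)
    interpret \<Omega>: prob_space \<Omega> by (rule prob_space_\<Omega>)
    fix x y assume xy: "x \<in> edom r" "y \<in> edom r"
    have int: "integrable \<Omega> (\<lambda>\<omega>. G x (\<xi> \<omega>) - G y (\<xi> \<omega>))"
      using G_mean xy by (intro Bochner_Integration.integrable_diff) auto
    have "g x - g y = (\<integral>\<omega>. G x (\<xi> \<omega>) - G y (\<xi> \<omega>) \<partial>\<Omega>)"
      using G_mean xy by simp
    also have "norm \<dots> \<le> (\<integral>\<omega>. norm (G x (\<xi> \<omega>) - G y (\<xi> \<omega>)) \<partial>\<Omega>)"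
      by (rule integral_norm_bound)
    also have "\<dots> \<le> (\<integral>\<omega>. L * dist x y \<partial>\<Omega>)"
      using int lipschitz_onD[OF G_lipschitz[OF \<xi>_in] xy]
      by (intro integral_mono) (auto simp: dist_norm)
    finally show "dist (g x) (g y) \<le> L * dist x y"
      by (simp add: dist_norm \<Omega>.prob_space)
  qed (use L_gt_0 in simp)
qed (use L_gt_0 obj_grad_bound in auto)

end

sublocale stochastic_composite \<subseteq> composite r L\<^sub>r "\<lambda>x. real_of_ereal (obj \<Omega> \<xi> F x)" "obj_grad \<Omega> \<xi> F" L B
  by (rule composite)

context stochastic_composite
begin

lemma obj_lower: "x \<in> edom r \<Longrightarrow> \<phi>_low \<le> f x + \<rho> x"
  using obj_lower_bound[of x] F_mean(3)[of x] r_eq[of x] by (metis plus_ereal.simps(1) ereal_less_eq(3))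

section \<open>Measurability on the domain of the regulariser\<close>

text \<open>Functions that are only controlled on the closed convex domain of \<open>r\<close> are extended to the
  whole space by projecting their argument onto that domain.\<close>

abbreviation proj :: "real^'n \<Rightarrow> real^'n" where "proj \<equiv> closest_point (edom r)"

lemma proj_in: "proj x \<in> edom r"
  using closed_edom edom_nonempty by (rule closest_point_in_set)

lemma proj_continuous: "continuous_on UNIV proj"
  using continuous_on_closest_point[OF convex_edom closed_edom edom_nonempty] .

lemma continuous_on_proj: "continuous_on (edom r) h \<Longrightarrow> continuous_on UNIV (\<lambda>x. h (proj x))"
  using proj_in by (intro continuous_on_compose2[OF _ proj_continuous]) auto

lemma measurable_on_edom:
  assumes h: "continuous_on (edom r) h"
    and y: "y \<in> borel_measurable A" "\<And>\<omega>. \<omega> \<in> space A \<Longrightarrow> y \<omega> \<in> edom r"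
  shows "(\<lambda>\<omega>. h (y \<omega>)) \<in> borel_measurable A"
proof -
  have "(\<lambda>\<omega>. h (proj (y \<omega>))) \<in> borel_measurable A"
    using y(1) borel_measurable_continuous_onI[OF continuous_on_proj[OF h]]
    by (rule measurable_compose)
  then show ?thesis
    by (subst measurable_cong[where g = "\<lambda>\<omega>. h (proj (y \<omega>))"]) (auto simp: y(2) closest_point_self)
qed

lemma measurable_on_edom_sample:
  fixes h :: "real^'n \<Rightarrow> real^'d \<Rightarrow> 'c::metric_space"
  assumes h: "\<And>z. z \<in> \<Xi> \<Longrightarrow> continuous_on (edom r) (\<lambda>x. h x z)"
    "\<And>x. x \<in> edom r \<Longrightarrow> h x \<in> borel_measurable (sample_space \<Xi>)"
    and y: "y \<in> borel_measurable A" "\<And>\<omega>. \<omega> \<in> space A \<Longrightarrow> y \<omega> \<in> edom r"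
    and Z: "Z \<in> A \<rightarrow>\<^sub>M sample_space \<Xi>"
  shows "(\<lambda>\<omega>. h (y \<omega>) (Z \<omega>)) \<in> borel_measurable A"
proof -
  have "(\<lambda>(x, z). h (proj x) z) \<in> borel_measurable (borel \<Otimes>\<^sub>M sample_space \<Xi>)"
    by (rule Caratheodory_measurable) (auto intro: continuous_on_proj h proj_in)
  from measurable_compose[OF measurable_Pair[OF y(1) Z] this]
  have "(\<lambda>\<omega>. h (proj (y \<omega>)) (Z \<omega>)) \<in> borel_measurable A" by simp
  then show ?thesis
    by (subst measurable_cong[where g = "\<lambda>\<omega>. h (proj (y \<omega>)) (Z \<omega>)"]) (auto simp: y(2) closest_point_self)
qed

lemma GDERIV_continuous_on:
  fixes h :: "real^'n \<Rightarrow> real"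
  assumes "\<And>x. x \<in> U \<Longrightarrow> GDERIV h x :> D x"
  shows "continuous_on U h"
  using assms unfolding gderiv_def
  by (meson continuous_at_imp_continuous_on has_derivative_continuous)

lemma f_continuous: "continuous_on (edom r) f"
  by (rule GDERIV_continuous_on[OF f_deriv])

lemma g_continuous: "continuous_on (edom r) g"
  by (rule lipschitz_on_continuous_on[OF g_lipschitz])

context
  fixes A :: "'a measure" and y :: "'a \<Rightarrow> real^'n"
  assumes y: "y \<in> borel_measurable A" "\<And>\<omega>. \<omega> \<in> space A \<Longrightarrow> y \<omega> \<in> edom r"
begin

lemma F_comp_measurable: "Z \<in> A \<rightarrow>\<^sub>M sample_space \<Xi> \<Longrightarrow> (\<lambda>\<omega>. F (y \<omega>) (Z \<omega>)) \<in> borel_measurable A"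
  by (rule measurable_on_edom_sample[OF GDERIV_continuous_on[OF F_deriv] F_measurable y])

lemma G_comp_measurable: "Z \<in> A \<rightarrow>\<^sub>M sample_space \<Xi> \<Longrightarrow> (\<lambda>\<omega>. G (y \<omega>) (Z \<omega>)) \<in> borel_measurable A"
  by (rule measurable_on_edom_sample[OF lipschitz_on_continuous_on[OF G_lipschitz] G_measurable y])

lemma batch_f_measurable:
  assumes "\<And>i. i \<in> {1..N k} \<Longrightarrow> (\<lambda>\<omega>. z \<omega> k i) \<in> A \<rightarrow>\<^sub>M sample_space \<Xi>"
  shows "(\<lambda>\<omega>. batch_f F N (z \<omega>) k (y \<omega>)) \<in> borel_measurable A"
  unfolding batch_f_def using F_comp_measurable[OF assms] by measurable

lemma batch_g_measurable:
  assumes "\<And>i. i \<in> {1..N k} \<Longrightarrow> (\<lambda>\<omega>. z \<omega> k i) \<in> A \<rightarrow>\<^sub>M sample_space \<Xi>"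
  shows "(\<lambda>\<omega>. batch_g F N (z \<omega>) k (y \<omega>)) \<in> borel_measurable A"
  unfolding batch_g_def G_def[symmetric] using G_comp_measurable[OF assms] by measurable

end

lemma prox_measurable:
  "t > 0 \<Longrightarrow> v \<in> borel_measurable A \<Longrightarrow> (\<lambda>\<omega>. prox t r (v \<omega>)) \<in> borel_measurable A"
  using borel_measurable_continuous_onI[OF prox_continuous] by (rule measurable_compose[rotated])

section \<open>The empirical objective\<close>

lemma batch_f_deriv:
  assumes z: "\<And>i. i \<in> {1..N k} \<Longrightarrow> z k i \<in> \<Xi>" and y: "y \<in> edom r"
  shows "GDERIV (batch_f F N z k) y :> batch_g F N z k y"
proof -
  have "((\<lambda>y. 1 / real (N k) * (\<Sum>i = 1..N k. F y (z k i))) has_derivative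
      (\<lambda>v. 1 / real (N k) * (\<Sum>i = 1..N k. inner v (G y (z k i))))) (at y)"
    using F_deriv[OF y z] unfolding gderiv_def
    by (intro has_derivative_mult_right has_derivative_sum) auto
  then show ?thesis
    unfolding gderiv_def batch_f_def[abs_def] batch_g_def G_def[symmetric]
    by (simp add: inner_sum_right)
qed

lemma batch_g_lipschitz:
  assumes z: "\<And>i. i \<in> {1..N k} \<Longrightarrow> z k i \<in> \<Xi>" and N: "N k > 0"
  shows "L-lipschitz_on (edom r) (batch_g F N z k)"
proof (rule lipschitz_onI)
  fix x y assume xy: "x \<in> edom r" "y \<in> edom r"
  have "batch_g F N z k x - batch_g F N z k y = (1 / real (N k)) *\<^sub>R (\<Sum>i = 1..N k. G x (z k i) - G y (z k i))"
    by (simp add: batch_g_def G_def sum_subtractf scaleR_diff_right)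
  also have "norm \<dots> \<le> 1 / real (N k) * (\<Sum>i = 1..N k. norm (G x (z k i) - G y (z k i)))"
    by (simp add: divide_right_mono norm_sum)
  also have "\<dots> \<le> 1 / real (N k) * (\<Sum>i = 1..N k. L * dist x y)"
    using lipschitz_onD[OF G_lipschitz[OF z] xy]
    by (intro mult_left_mono sum_mono) (auto simp: dist_norm)
  also have "\<dots> = L * dist x y" using N by simp
  finally show "dist (batch_g F N z k x) (batch_g F N z k y) \<le> L * dist x y"
    by (simp add: dist_norm)
qed (use L_gt_0 in simp)

lemma sufficient_decrease_iff:
  assumes "x \<in> edom r" "t > 0"
  shows "sufficient_decrease F r \<alpha> N z k x t \<longleftrightarrow> line_search_ok (batch_f F N z k) (batch_g F N z k x) \<alpha> x t"
  using assms prox_minimal(1)[OF assms(2)]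
  by (simp add: sufficient_decrease_def line_search_ok_def Let_def batch_phi_def trial_point_def r_eq)

end

section \<open>Sample paths of the algorithm\<close>

locale slam_setting = stochastic_composite \<Omega> \<xi> \<Xi> F r L\<^sub>r L \<sigma> B \<phi>_low
  for \<Omega> :: "'w measure" and \<xi> :: "'w \<Rightarrow> real^'d" and \<Xi> :: "(real^'d) set"
    and F :: "real^'n \<Rightarrow> real^'d \<Rightarrow> real" and r :: "real^'n \<Rightarrow> ereal"
    and L\<^sub>r L \<sigma> B \<phi>_low :: real +
  fixes \<alpha> \<beta> s c :: real and x\<^sub>0 :: "real^'n" and p :: "nat \<Rightarrow> nat"
  assumes x0: "x\<^sub>0 \<in> edom r" and \<alpha>: "0 < \<alpha>" "\<alpha> < 1" and \<beta>: "0 < \<beta>" "\<beta> < 1" and s: "0 < s"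
    and p: "\<forall>j. p j > 0" and c: "c = min s (2 * (1 - \<alpha>) * \<beta> / L)"
begin

lemma c_pos: "0 < c" and c_le_s: "c \<le> s"
  using \<alpha> \<beta> s L_gt_0 by (auto simp: c)

text \<open>Step sizes \<open>\<beta>\<^sup>n s\<close> never fall below \<open>c\<close>, which bounds the exponents \<open>n\<close>.\<close>

definition max_exponent :: nat where "max_exponent = (LEAST n. \<beta> ^ n * s < c)"

lemma exponent_le:
  assumes "c \<le> \<beta> ^ j * s"
  shows "j \<le> max_exponent"
proof (rule ccontr)
  assume "\<not> ?thesis"
  then have "\<beta> ^ j * s \<le> \<beta> ^ max_exponent * s"
    using \<beta> s by (intro mult_right_mono power_decreasing) auto
  also have "\<beta> ^ max_exponent * s < c"
    unfolding max_exponent_def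
  proof (rule LeastI_ex)
    obtain n where "\<beta> ^ n < c / s"
      using real_arch_pow_inv[of "c / s" \<beta>] c_pos s \<beta> by auto
    then show "\<exists>n. \<beta> ^ n * s < c" using s by (auto simp: field_simps)
  qed
  finally show False using assms by simp
qed

text \<open>All step sizes have the form \<open>\<beta>\<^sup>n s\<close>. The exponents at which the line searches start
  and the number of reductions they perform are natural numbers, which makes both the counting of
  reductions and the measurability of the step sizes elementary.\<close>

definition reductions ::
  "(nat \<Rightarrow> nat) \<Rightarrow> (nat \<Rightarrow> nat \<Rightarrow> real^'d) \<Rightarrow> nat \<Rightarrow> real^'n \<Rightarrow> nat \<Rightarrow> nat" where
  "reductions N z k x j =
     (LEAST m. sufficient_decrease F r \<alpha> N z k x (\<beta> ^ m * (\<beta> ^ j * s)))"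

fun start_exponent ::
  "(nat \<Rightarrow> nat) \<Rightarrow> (nat \<Rightarrow> nat \<Rightarrow> real^'d) \<Rightarrow> (nat \<Rightarrow> real^'n) \<Rightarrow> nat \<Rightarrow> nat" where
  "start_exponent N z x 0 = 0"
| "start_exponent N z x (Suc k) = (if cycle_start p (Suc k) then 0
     else start_exponent N z x k + reductions N z k (x k) (start_exponent N z x k))"

text \<open>The comparison point \<open>w\<close>: a step with the exact gradient and the step size from which the line
  search starts.\<close>

definition gradient_step :: "real^'n \<Rightarrow> nat \<Rightarrow> real^'n" where
  "gradient_step x j = prox (\<beta> ^ j * s) r (x - (\<beta> ^ j * s) *\<^sub>R g x)"

lemma cycle_start_0: "cycle_start p 0"
  by (auto simp: cycle_start_def intro: exI[of _ 0])

definition noise :: "(nat \<Rightarrow> nat) \<Rightarrow> (nat \<Rightarrow> nat \<Rightarrow> real^'d) \<Rightarrow> nat \<Rightarrow> real^'n \<Rightarrow> real" where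
  "noise N z k y = f y - batch_f F N z k y"

definition grad_noise :: "(nat \<Rightarrow> nat) \<Rightarrow> (nat \<Rightarrow> nat \<Rightarrow> real^'d) \<Rightarrow> nat \<Rightarrow> real^'n \<Rightarrow> real^'n" where
  "grad_noise N z k y = g y - batch_g F N z k y"

lemma gradient_step_in: "gradient_step x j \<in> edom r"
  unfolding gradient_step_def using \<beta> s by (intro prox_minimal(1)) simp

lemma gradient_step_dist:
  assumes "x \<in> edom r"
  shows "norm (gradient_step x j - x) \<le> s * (B + L\<^sub>r)"
proof -
  have t: "0 < \<beta> ^ j * s" "\<beta> ^ j * s \<le> s" using \<beta> s by (auto simp: power_le_one)
  have "norm (x - gradient_step x j) \<le> (\<beta> ^ j * s) * (norm (g x) + L\<^sub>r)"
    unfolding gradient_step_def by (rule prox_step_bound[OF t(1) assms])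
  also have "\<dots> \<le> s * (B + L\<^sub>r)"
    using t g_bound[OF assms] Lr_nonneg by (intro mult_mono) auto
  finally show ?thesis by (simp add: norm_minus_commute)
qed

context
  fixes N :: "nat \<Rightarrow> nat" and z :: "nat \<Rightarrow> nat \<Rightarrow> real^'d" and x :: "nat \<Rightarrow> real^'n" and t :: "nat \<Rightarrow> real"
  assumes N: "\<And>k. N k > 0" and z: "\<And>k i. i \<in> {1..N k} \<Longrightarrow> z k i \<in> \<Xi>"
    and slam: "slam_sequence F r x\<^sub>0 \<alpha> \<beta> s p N z x t"
begin

lemma empirical_deriv: "y \<in> edom r \<Longrightarrow> GDERIV (batch_f F N z k) y :> batch_g F N z k y"
  using batch_f_deriv[of N k z y] z by blast

lemma empirical_lipschitz: "L-lipschitz_on (edom r) (batch_g F N z k)"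
  by (rule batch_g_lipschitz) (use z N in auto)

private abbreviation "j \<equiv> start_exponent N z x"
private abbreviation "m k \<equiv> reductions N z k (x k) (j k)"

lemma path_step: "t k = \<beta> ^ (j k + m k) * s"
    "x (Suc k) = trial_point F r N z k (x k) (\<beta> ^ (j k + m k) * s)"
proof -
  have *: "t k = \<beta> ^ (LEAST m. sufficient_decrease F r \<alpha> N z k (x k) (\<beta> ^ m * (if cycle_start p k then s else t (k - 1))))
      * (if cycle_start p k then s else t (k - 1))" for k
    using slam unfolding slam_sequence_def Let_def by blast
  have init: "(if cycle_start p k then s else t (k - 1)) = \<beta> ^ j k * s" if "k > 0 \<Longrightarrow> t (k - 1) = \<beta> ^ (j (k - 1) + m (k - 1)) * s" for k
  proof (cases k)
    case 0 then show ?thesis by (simp add: cycle_start_0)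
  next
    case (Suc l)
    then have "t l = \<beta> ^ (j l + m l) * s" using that by simp
    then show ?thesis by (simp add: Suc)
  qed
  show 1: "t k = \<beta> ^ (j k + m k) * s" for k
  proof (induction k)
    case 0
    show ?case using *[of 0] unfolding init[of 0, simplified] by (simp add: reductions_def power_add mult_ac)
  next
    case (Suc k)
    then have eq: "(if cycle_start p (Suc k) then s else t (Suc k - 1)) = \<beta> ^ j (Suc k) * s"
      by (intro init) (simp only: diff_Suc_1)
    show ?case
      using *[of "Suc k"] unfolding eq reductions_def power_add by (simp only: mult_ac)
  qed
  show "x (Suc k) = trial_point F r N z k (x k) (\<beta> ^ (j k + m k) * s)"
    using slam 1[of k] unfolding slam_sequence_def Let_def by metis
qed

text \<open>The two invariants keep each other going: a starting step of at least \<open>c\<close> in the domain is what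
  \<open>iteration_bound\<close> requires, and that lemma returns them for the next iteration, which starts either
  from the accepted step or from \<open>s \<ge> c\<close>.\<close>

lemma path_invariants: "x k \<in> edom r \<and> c \<le> \<beta> ^ j k * s"
  and path_iteration: "c \<le> \<beta> ^ (j k + m k) * s"
    "\<alpha> * c / 2 * (norm (residual r g s (x k)))\<^sup>2 \<le> (f (x k) + \<rho> (x k)) - (f (x (Suc k)) + \<rho> (x (Suc k)))
      + (noise N z k (gradient_step (x k) (j k)) - noise N z k (x k))
      + (norm (grad_noise N z k (gradient_step (x k) (j k))))\<^sup>2 / (2 * L)
      + (3 * L * s\<^sup>2 + \<alpha> * c) * (norm (grad_noise N z k (x k)))\<^sup>2
      + (if m k = 0 then 0 else 12 * L * (s * (B + L\<^sub>r))\<^sup>2)"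
proof -
  have step: "c \<le> \<beta> ^ (j k + m k) * s \<and> x (Suc k) \<in> edom r \<and>
    \<alpha> * c / 2 * (norm (residual r g s (x k)))\<^sup>2 \<le> (f (x k) + \<rho> (x k)) - (f (x (Suc k)) + \<rho> (x (Suc k)))
      + (noise N z k (gradient_step (x k) (j k)) - noise N z k (x k))
      + (norm (grad_noise N z k (gradient_step (x k) (j k))))\<^sup>2 / (2 * L)
      + (3 * L * s\<^sup>2 + \<alpha> * c) * (norm (grad_noise N z k (x k)))\<^sup>2
      + (if m k = 0 then 0 else 12 * L * (s * (B + L\<^sub>r))\<^sup>2)"
    if x: "x k \<in> edom r" and cj: "c \<le> \<beta> ^ j k * s" for k
  proof -
    let ?\<tau> = "\<beta> ^ j k * s"
    have \<tau>: "?\<tau> \<le> s" "0 < ?\<tau>" using \<beta> s by (auto simp: power_le_one)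
    have m: "m k = (LEAST m. line_search_ok (batch_f F N z k) (batch_g F N z k (x k)) \<alpha> (x k) (\<beta> ^ m * ?\<tau>))"
      unfolding reductions_def using \<beta> \<tau> by (simp add: sufficient_decrease_iff[OF x])
    have t: "\<beta> ^ (j k + m k) * s = \<beta> ^ m k * ?\<tau>" by (simp add: power_add)
    have y: "x (Suc k) = prox (\<beta> ^ m k * ?\<tau>) r (x k - (\<beta> ^ m k * ?\<tau>) *\<^sub>R batch_g F N z k (x k))"
      unfolding path_step(2) trial_point_def t ..
    note iter = iteration_bound[OF empirical_deriv[of _ k] empirical_lipschitz[of k] x \<alpha> \<beta> c cj \<tau>(1) c_pos, folded m]
    show ?thesis
      unfolding noise_def grad_noise_def gradient_step_def y t
      by (intro conjI iter)
  qed
  show inv: "x k \<in> edom r \<and> c \<le> \<beta> ^ j k * s" for k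
  proof (induction k)
    case 0
    have "x 0 = x\<^sub>0" using slam by (simp add: slam_sequence_def)
    then show ?case using x0 c_le_s by simp
  next
    case (Suc k)
    then show ?case using step[of k] c_le_s by (auto simp: mult_ac)
  qed
  show "c \<le> \<beta> ^ (j k + m k) * s"
    using step[of k] inv[of k] by blast
  show "\<alpha> * c / 2 * (norm (residual r g s (x k)))\<^sup>2 \<le> (f (x k) + \<rho> (x k)) - (f (x (Suc k)) + \<rho> (x (Suc k)))
      + (noise N z k (gradient_step (x k) (j k)) - noise N z k (x k))
      + (norm (grad_noise N z k (gradient_step (x k) (j k))))\<^sup>2 / (2 * L)
      + (3 * L * s\<^sup>2 + \<alpha> * c) * (norm (grad_noise N z k (x k)))\<^sup>2
      + (if m k = 0 then 0 else 12 * L * (s * (B + L\<^sub>r))\<^sup>2)"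
    using step[of k] inv[of k] by blast
qed

lemma card_reductions_le: "card {k. k < K \<and> m k \<noteq> 0} \<le> max_exponent * Suc (cycle_index p K)"
proof -
  have "card {k. k < K \<and> m k \<noteq> 0} \<le> max_exponent * card {k. k < K \<and> cycle_start p k}"
  proof (rule card_increases_le[where j = "\<lambda>k. j k + m k"])
    show "cycle_start p 0" by (rule cycle_start_0)
    show "j k + m k = (if cycle_start p k then 0 else j (k - 1) + m (k - 1)) + m k" for k
      by (cases k) (simp_all add: cycle_start_0)
    show "j k + m k \<le> max_exponent" for k
      by (rule exponent_le[OF path_iteration(1)])
  qed
  also have "\<dots> \<le> max_exponent * Suc (cycle_index p K)"
    by (intro mult_left_mono card_cycle_starts_le[OF p]) simp
  finally show ?thesis .
qed

text \<open>Summation over the iterations. The values of the objective telescope, and the constants of the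
  iterations that shorten the step are replaced by a bound for their number, which does not depend on
  the sample path.\<close>

lemma path_bound:
  "\<alpha> * c / 2 * (\<Sum>k<K. (norm (residual r g s (x k)))\<^sup>2) \<le> (f x\<^sub>0 + \<rho> x\<^sub>0 - \<phi>_low)
    + (\<Sum>k<K. noise N z k (gradient_step (x k) (j k)) - noise N z k (x k))
    + (\<Sum>k<K. (norm (grad_noise N z k (gradient_step (x k) (j k))))\<^sup>2) / (2 * L)
    + (3 * L * s\<^sup>2 + \<alpha> * c) * (\<Sum>k<K. (norm (grad_noise N z k (x k)))\<^sup>2)
    + 12 * L * (s * (B + L\<^sub>r))\<^sup>2 * real (max_exponent * Suc (cycle_index p K))"
proof -
  let ?C = "12 * L * (s * (B + L\<^sub>r))\<^sup>2"
  have C: "0 \<le> ?C" using L_gt_0 by simp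
  have "\<alpha> * c / 2 * (\<Sum>k<K. (norm (residual r g s (x k)))\<^sup>2) \<le>
     (\<Sum>k<K. (f (x k) + \<rho> (x k)) - (f (x (Suc k)) + \<rho> (x (Suc k)))
      + (noise N z k (gradient_step (x k) (j k)) - noise N z k (x k))
      + (norm (grad_noise N z k (gradient_step (x k) (j k))))\<^sup>2 / (2 * L)
      + (3 * L * s\<^sup>2 + \<alpha> * c) * (norm (grad_noise N z k (x k)))\<^sup>2
      + (if m k = 0 then 0 else ?C))"
    unfolding sum_distrib_left by (intro sum_mono path_iteration(2))
  also have "\<dots> = (\<Sum>k<K. (f (x k) + \<rho> (x k)) - (f (x (Suc k)) + \<rho> (x (Suc k))))
    + (\<Sum>k<K. noise N z k (gradient_step (x k) (j k)) - noise N z k (x k))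
    + (\<Sum>k<K. (norm (grad_noise N z k (gradient_step (x k) (j k))))\<^sup>2) / (2 * L)
    + (3 * L * s\<^sup>2 + \<alpha> * c) * (\<Sum>k<K. (norm (grad_noise N z k (x k)))\<^sup>2)
    + (\<Sum>k<K. if m k = 0 then 0 else ?C)"
    by (simp only: sum.distrib sum_distrib_left sum_divide_distrib)
  also have "(\<Sum>k<K. (f (x k) + \<rho> (x k)) - (f (x (Suc k)) + \<rho> (x (Suc k)))) =
      (f (x 0) + \<rho> (x 0)) - (f (x K) + \<rho> (x K))"
    by (rule sum_lessThan_telescope')
  also have "\<dots> \<le> f x\<^sub>0 + \<rho> x\<^sub>0 - \<phi>_low"
    using obj_lower[of "x K"] path_invariants[of K] slam by (simp add: slam_sequence_def)
  also have "(\<Sum>k<K. if m k = 0 then 0 else ?C) = ?C * real (card {k. k < K \<and> m k \<noteq> 0})"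
  proof -
    have "(\<Sum>k<K. if m k = 0 then 0 else ?C) = (\<Sum>k\<in>{k. k < K \<and> m k \<noteq> 0}. ?C)"
      by (intro sum.mono_neutral_cong_right) auto
    then show ?thesis by (simp add: mult.commute)
  qed
  also have "\<dots> \<le> ?C * real (max_exponent * Suc (cycle_index p K))"
    using card_reductions_le[of K] C by (intro mult_left_mono) (simp_all only: of_nat_le_iff)
  finally show ?thesis by simp
qed

text \<open>The step to the comparison point has bounded length, so the increment of the noise is integrable
  as soon as the squared noise gradient is. The two signs in the absolute value come from the descent lemma for
  the noise and for its negative.\<close>

lemma noise_increment_bound:
  "\<bar>noise N z k (gradient_step (x k) (j k)) - noise N z k (x k)\<bar>
    \<le> (norm (grad_noise N z k (x k)))\<^sup>2 + (L + 1) * (s * (B + L\<^sub>r))\<^sup>2"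
proof -
  let ?w = "gradient_step (x k) (j k)" and ?C = "s * (B + L\<^sub>r)"
  let ?e = "grad_noise N z k" and ?D = "noise N z k"
  have x: "x k \<in> edom r" using path_invariants by blast
  have w: "?w \<in> edom r" by (rule gradient_step_in)
  have d: "norm (?w - x k) \<le> ?C" by (rule gradient_step_dist[OF x])
  have lip: "(L + L)-lipschitz_on (edom r) ?e"
    unfolding grad_noise_def[abs_def] by (rule lipschitz_on_diff[OF g_lipschitz empirical_lipschitz])
  have deriv: "GDERIV ?D y :> ?e y" if "y \<in> edom r" for y
    unfolding noise_def[abs_def] grad_noise_def using that by (intro GDERIV_diff f_deriv empirical_deriv)
  have "?D ?w \<le> ?D (x k) + inner (?e (x k)) (?w - x k) + (L + L) / 2 * (norm (?w - x k))\<^sup>2"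
    by (rule descent_lemma[OF convex_edom deriv lip x w])
  moreover have "- ?D ?w \<le> - ?D (x k) + inner (- ?e (x k)) (?w - x k) + (L + L) / 2 * (norm (?w - x k))\<^sup>2"
    by (rule descent_lemma[OF convex_edom GDERIV_minus[OF deriv] lipschitz_on_minus[OF lip] x w])
  ultimately have 1: "\<bar>?D ?w - ?D (x k)\<bar> \<le> \<bar>inner (?e (x k)) (?w - x k)\<bar> + L * (norm (?w - x k))\<^sup>2"
    by simp
  have "\<bar>inner (?e (x k)) (?w - x k)\<bar> \<le> norm (?e (x k)) * norm (?w - x k)"
    by (rule Cauchy_Schwarz_ineq2)
  also have "\<dots> \<le> (norm (?e (x k)))\<^sup>2 + (norm (?w - x k))\<^sup>2"
    by (intro mult_le_sum_squares) auto
  finally have "\<bar>?D ?w - ?D (x k)\<bar> \<le> (norm (?e (x k)))\<^sup>2 + (L + 1) * (norm (?w - x k))\<^sup>2"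
    using 1 unfolding distrib_right by linarith
  also have "\<dots> \<le> (norm (?e (x k)))\<^sup>2 + (L + 1) * ?C\<^sup>2"
    using d L_gt_0 by (intro add_left_mono mult_left_mono power_mono) auto
  finally show ?thesis .
qed

end

end

section \<open>Measurable dependence of an iteration on its data\<close>

text \<open>An iteration reads only its own batch. This allows replacing the samples by their restriction to
  an index set that contains the batch.\<close>

lemma batch_cong:
  assumes "\<And>i. i \<in> {1..N k} \<Longrightarrow> z k i = z' k i"
  shows "batch_f F N z k = batch_f F N z' k" "batch_g F N z k = batch_g F N z' k"
  unfolding batch_f_def[abs_def] batch_g_def[abs_def] using assms by simp_all

context slam_setting
begin

lemma iteration_cong:
  assumes "\<And>i. i \<in> {1..N k} \<Longrightarrow> z k i = z' k i"
  shows "reductions N z k = reductions N z' k" "trial_point F r N z k = trial_point F r N z' k"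
    "noise N z k = noise N z' k" "grad_noise N z k = grad_noise N z' k"
  unfolding reductions_def[abs_def] sufficient_decrease_def[abs_def] trial_point_def[abs_def]
    batch_phi_def[abs_def] noise_def[abs_def] grad_noise_def[abs_def]
  by (simp_all only: batch_cong[of N k z z', OF assms])

lemma residual_measurable:
  assumes "y \<in> borel_measurable A" "\<And>\<omega>. \<omega> \<in> space A \<Longrightarrow> y \<omega> \<in> edom r"
  shows "(\<lambda>\<omega>. residual r g s (y \<omega>)) \<in> borel_measurable A"
proof -
  have [measurable]: "(\<lambda>\<omega>. g (y \<omega>)) \<in> borel_measurable A"
    by (rule measurable_on_edom[OF g_continuous assms])
  note [measurable] = assms(1)
  have [measurable]: "(\<lambda>\<omega>. prox s r (y \<omega> - s *\<^sub>R g (y \<omega>))) \<in> borel_measurable A"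
    by (intro prox_measurable s) measurable
  show ?thesis unfolding residual_def by measurable
qed

context
  fixes A :: "'a measure" and y :: "'a \<Rightarrow> real^'n" and n :: "'a \<Rightarrow> nat"
  assumes y: "y \<in> borel_measurable A" "\<And>\<omega>. \<omega> \<in> space A \<Longrightarrow> y \<omega> \<in> edom r"
    and n [measurable]: "n \<in> A \<rightarrow>\<^sub>M count_space UNIV"
begin

lemma gradient_step_measurable: "(\<lambda>\<omega>. gradient_step (y \<omega>) (n \<omega>)) \<in> borel_measurable A"
proof (rule measurable_compose_countable[OF _ n])
  fix j
  have [measurable]: "(\<lambda>\<omega>. g (y \<omega>)) \<in> borel_measurable A"
    by (rule measurable_on_edom[OF g_continuous y])
  note [measurable] = y(1)
  show "(\<lambda>\<omega>. gradient_step (y \<omega>) j) \<in> borel_measurable A"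
    unfolding gradient_step_def using \<beta> s by (intro prox_measurable) measurable
qed

context
  fixes z :: "'a \<Rightarrow> nat \<Rightarrow> nat \<Rightarrow> real^'d" and N :: "nat \<Rightarrow> nat" and k :: nat
  assumes z: "\<And>i. i \<in> {1..N k} \<Longrightarrow> (\<lambda>\<omega>. z \<omega> k i) \<in> A \<rightarrow>\<^sub>M sample_space \<Xi>"
begin

lemma grad_noise_measurable: "(\<lambda>\<omega>. grad_noise N (z \<omega>) k (y \<omega>)) \<in> borel_measurable A"
  unfolding grad_noise_def
  by (intro borel_measurable_diff measurable_on_edom[OF g_continuous] batch_g_measurable y z)

lemma noise_measurable: "(\<lambda>\<omega>. noise N (z \<omega>) k (y \<omega>)) \<in> borel_measurable A"
  unfolding noise_def
  by (intro borel_measurable_diff measurable_on_edom[OF f_continuous] batch_f_measurable y z)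

lemma trial_point_measurable:
  assumes e: "e \<in> A \<rightarrow>\<^sub>M count_space UNIV"
  shows "(\<lambda>\<omega>. trial_point F r N (z \<omega>) k (y \<omega>) (\<beta> ^ e \<omega> * s)) \<in> borel_measurable A"
proof (rule measurable_compose_countable[OF _ e])
  fix j
  have [measurable]: "(\<lambda>\<omega>. batch_g F N (z \<omega>) k (y \<omega>)) \<in> borel_measurable A"
    by (intro batch_g_measurable y z)
  note [measurable] = y(1)
  show "(\<lambda>\<omega>. trial_point F r N (z \<omega>) k (y \<omega>) (\<beta> ^ j * s)) \<in> borel_measurable A"
    unfolding trial_point_def using \<beta> s by (intro prox_measurable) measurable
qed

lemma trial_point_in: "trial_point F r N z' k y' (\<beta> ^ j * s) \<in> edom r"
  unfolding trial_point_def using \<beta> s by (intro prox_minimal(1)) simp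

lemma reductions_measurable:
  "(\<lambda>\<omega>. reductions N (z \<omega>) k (y \<omega>) (n \<omega>)) \<in> A \<rightarrow>\<^sub>M count_space UNIV"
proof (rule measurable_compose_countable[OF _ n])
  fix j
  have "(\<lambda>\<omega>. sufficient_decrease F r \<alpha> N (z \<omega>) k (y \<omega>) (\<beta> ^ m * (\<beta> ^ j * s))) \<in> A \<rightarrow>\<^sub>M count_space UNIV" for m
  proof -
    let ?t = "\<beta> ^ (m + j) * s"
    have t: "?t > 0" using \<beta> s by simp
    have trial: "(\<lambda>\<omega>. trial_point F r N (z \<omega>) k (y \<omega>) ?t) \<in> borel_measurable A"
      by (rule trial_point_measurable) simp
    have [measurable]: "(\<lambda>\<omega>. batch_f F N (z \<omega>) k (trial_point F r N (z \<omega>) k (y \<omega>) ?t)) \<in> borel_measurable A"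
      by (intro batch_f_measurable trial trial_point_in z)
    have [measurable]: "(\<lambda>\<omega>. \<rho> (trial_point F r N (z \<omega>) k (y \<omega>) ?t)) \<in> borel_measurable A"
      by (intro measurable_on_edom[OF \<rho>_continuous] trial trial_point_in)
    have [measurable]: "(\<lambda>\<omega>. batch_f F N (z \<omega>) k (y \<omega>)) \<in> borel_measurable A"
      by (intro batch_f_measurable y z)
    have [measurable]: "(\<lambda>\<omega>. \<rho> (y \<omega>)) \<in> borel_measurable A"
      by (rule measurable_on_edom[OF \<rho>_continuous y])
    note [measurable] = y(1) trial
    have meas: "(\<lambda>\<omega>. batch_f F N (z \<omega>) k (trial_point F r N (z \<omega>) k (y \<omega>) ?t) + \<rho> (trial_point F r N (z \<omega>) k (y \<omega>) ?t)
        - (batch_f F N (z \<omega>) k (y \<omega>) + \<rho> (y \<omega>))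
        \<le> - (\<alpha> / ?t) * (norm (y \<omega> - trial_point F r N (z \<omega>) k (y \<omega>) ?t))\<^sup>2) \<in> A \<rightarrow>\<^sub>M count_space UNIV"
      by measurable
    have eq: "sufficient_decrease F r \<alpha> N (z \<omega>) k (y \<omega>) ?t \<longleftrightarrow>
        batch_f F N (z \<omega>) k (trial_point F r N (z \<omega>) k (y \<omega>) ?t) + \<rho> (trial_point F r N (z \<omega>) k (y \<omega>) ?t)
        - (batch_f F N (z \<omega>) k (y \<omega>) + \<rho> (y \<omega>))
        \<le> - (\<alpha> / ?t) * (norm (y \<omega> - trial_point F r N (z \<omega>) k (y \<omega>) ?t))\<^sup>2" if "\<omega> \<in> space A" for \<omega>
      by (simp only: sufficient_decrease_iff[OF y(2)[OF that] t] line_search_ok_def Let_def trial_point_def)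
    have "(\<lambda>\<omega>. sufficient_decrease F r \<alpha> N (z \<omega>) k (y \<omega>) ?t) \<in> A \<rightarrow>\<^sub>M count_space UNIV"
      using measurable_cong[OF eq, THEN iffD2, OF _ meas] by blast
    then show ?thesis by (simp add: power_add mult.assoc)
  qed
  then show "(\<lambda>\<omega>. reductions N (z \<omega>) k (y \<omega>) j) \<in> A \<rightarrow>\<^sub>M count_space UNIV"
    unfolding reductions_def by (rule measurable_Least)
qed

end

end

end

section \<open>Executions of the algorithm\<close>

locale slam_execution = slam_setting \<Omega> \<xi> \<Xi> F r L\<^sub>r L \<sigma> B \<phi>_low \<alpha> \<beta> s c x\<^sub>0 p
  for \<Omega> :: "'w measure" and \<xi> :: "'w \<Rightarrow> real^'d" and \<Xi> :: "(real^'d) set"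
    and F :: "real^'n \<Rightarrow> real^'d \<Rightarrow> real" and r :: "real^'n \<Rightarrow> ereal"
    and L\<^sub>r L \<sigma> B \<phi>_low \<alpha> \<beta> s c :: real and x\<^sub>0 :: "real^'n" and p :: "nat \<Rightarrow> nat" +
  fixes M :: "'v measure" and N :: "nat \<Rightarrow> nat" and X :: "nat \<Rightarrow> nat \<Rightarrow> 'v \<Rightarrow> real^'d"
    and x :: "nat \<Rightarrow> 'v \<Rightarrow> real^'n" and t :: "nat \<Rightarrow> 'v \<Rightarrow> real" and R :: "nat \<Rightarrow> 'v \<Rightarrow> nat"
  assumes run: "slam_run \<Omega> \<xi> \<Xi> F r x\<^sub>0 \<alpha> \<beta> s p N M X x t R"
begin

abbreviation I :: "(nat \<times> nat) set" where "I \<equiv> SIGMA k:UNIV. {1..N k}"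
abbreviation past :: "nat \<Rightarrow> (nat \<times> nat) set" where "past k \<equiv> SIGMA l:{..<k}. {1..N l}"
abbreviation batch :: "nat \<Rightarrow> (nat \<times> nat) set" where "batch k \<equiv> {k} \<times> {1..N k}"
abbreviation observe :: "(nat \<times> nat) set \<Rightarrow> 'v \<Rightarrow> nat \<times> nat \<Rightarrow> real^'d" where
  "observe J \<omega> \<equiv> restrict (\<lambda>q. case_prod X q \<omega>) J"
abbreviation samples :: "(nat \<times> nat) set \<Rightarrow> (nat \<times> nat \<Rightarrow> real^'d) measure" where
  "samples J \<equiv> Pi\<^sub>M J (\<lambda>_. sample_space \<Xi>)"
abbreviation Z :: "'v \<Rightarrow> nat \<Rightarrow> nat \<Rightarrow> real^'d" where "Z \<omega> \<equiv> \<lambda>k i. X k i \<omega>"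

end

sublocale slam_execution \<subseteq> M: prob_space M
  using run by (simp add: slam_run_def Let_def)

context slam_execution
begin

lemma N_pos: "N k > 0"
  using run by (simp add: slam_run_def Let_def)

lemma indep_samples: "M.indep_vars (\<lambda>_. sample_space \<Xi>) (case_prod X) I"
  using run by (simp add: slam_run_def Let_def)

lemma X_measurable: "i \<in> {1..N k} \<Longrightarrow> X k i \<in> M \<rightarrow>\<^sub>M sample_space \<Xi>"
  using indep_samples unfolding M.indep_vars_def2 by fastforce

lemma X_in: "\<omega> \<in> space M \<Longrightarrow> i \<in> {1..N k} \<Longrightarrow> X k i \<omega> \<in> \<Xi>"
  using measurable_space[OF X_measurable] by simp

lemma X_distr: "i \<in> {1..N k} \<Longrightarrow> distr M (sample_space \<Xi>) (X k i) = distr \<Omega> (sample_space \<Xi>) \<xi>"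
  using run unfolding slam_run_def Let_def by auto

lemma path: "\<omega> \<in> space M \<Longrightarrow> slam_sequence F r x\<^sub>0 \<alpha> \<beta> s p N (Z \<omega>) (\<lambda>k. x k \<omega>) (\<lambda>k. t k \<omega>)"
  using run unfolding slam_run_def Let_def by blast

lemma observe_measurable: "J \<subseteq> I \<Longrightarrow> observe J \<in> M \<rightarrow>\<^sub>M samples J"
  using X_measurable by (intro measurable_restrict) auto

abbreviation J :: "nat \<Rightarrow> 'v \<Rightarrow> nat" where "J k \<omega> \<equiv> start_exponent N (Z \<omega>) (\<lambda>k. x k \<omega>) k"

lemma x_in: "\<omega> \<in> space M \<Longrightarrow> x k \<omega> \<in> edom r"
  using path_invariants[of N "Z \<omega>" "\<lambda>k. x k \<omega>" "\<lambda>k. t k \<omega>" k, OF N_pos X_in path] by blast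

lemma x_Suc:
  assumes "\<omega> \<in> space M"
  shows "x (Suc k) \<omega> = trial_point F r N (Z \<omega>) k (x k \<omega>) (\<beta> ^ (J k \<omega> + reductions N (Z \<omega>) k (x k \<omega>) (J k \<omega>)) * s)"
  using path_step(2)[of N "Z \<omega>" "\<lambda>k. x k \<omega>" "\<lambda>k. t k \<omega>" k, OF N_pos X_in path] assms by blast

text \<open>Iteration \<open>k\<close> starts from data that are functions of the samples of the earlier iterations
  alone; such random variables are called predictable.\<close>

definition predictable :: "nat \<Rightarrow> 'c measure \<Rightarrow> ('v \<Rightarrow> 'c) \<Rightarrow> bool" where
  "predictable k T Y \<longleftrightarrow> (\<exists>h \<in> samples (past k) \<rightarrow>\<^sub>M T. \<forall>\<omega>\<in>space M. Y \<omega> = h (observe (past k) \<omega>))"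

text \<open>Composition with the projection makes the representing function map into the domain, also on
  samples that no execution produces.\<close>

lemma predictable_edom:
  assumes "predictable k borel Y" "\<And>\<omega>. \<omega> \<in> space M \<Longrightarrow> Y \<omega> \<in> edom r"
  obtains h where "h \<in> borel_measurable (samples (past k))" "\<And>u. h u \<in> edom r"
    "\<And>\<omega>. \<omega> \<in> space M \<Longrightarrow> Y \<omega> = h (observe (past k) \<omega>)"
proof -
  obtain h where h: "h \<in> borel_measurable (samples (past k))" "\<And>\<omega>. \<omega> \<in> space M \<Longrightarrow> Y \<omega> = h (observe (past k) \<omega>)"
    using assms(1) unfolding predictable_def by blast
  have "(\<lambda>u. proj (h u)) \<in> borel_measurable (samples (past k))"
    using h(1) borel_measurable_continuous_onI[OF proj_continuous] by (rule measurable_compose)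
  moreover have "Y \<omega> = proj (h (observe (past k) \<omega>))" if "\<omega> \<in> space M" for \<omega>
    using assms(2)[OF that] by (simp add: h(2)[OF that] closest_point_self)
  ultimately show ?thesis using that proj_in by blast
qed

text \<open>By induction, the next state is a measurable function of the current state and the batch. Functions
  on the smaller sample space are transferred to the larger one by restricting their argument.\<close>

lemma state_predictable: "predictable k borel (x k)" "predictable k (count_space UNIV) (J k)"
proof (induction k)
  case 0
  have "x 0 \<omega> = x\<^sub>0" if "\<omega> \<in> space M" for \<omega>
    using path[OF that] by (simp add: slam_sequence_def)
  then have "\<forall>\<omega>\<in>space M. x 0 \<omega> = (\<lambda>_. x\<^sub>0) (observe (past 0) \<omega>)" by simp
  then show "predictable 0 borel (x 0)"
    unfolding predictable_def by (intro bexI) auto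
  have "\<forall>\<omega>\<in>space M. J 0 \<omega> = (\<lambda>_. 0) (observe (past 0) \<omega>)" by simp
  then show "predictable 0 (count_space UNIV) (J 0)"
    unfolding predictable_def by (intro bexI) auto
next
  case (Suc k)
  obtain h where h: "h \<in> borel_measurable (samples (past k))" "\<And>u. h u \<in> edom r"
      "\<And>\<omega>. \<omega> \<in> space M \<Longrightarrow> x k \<omega> = h (observe (past k) \<omega>)"
    using predictable_edom[OF Suc(1) x_in] by blast
  obtain n where n: "n \<in> samples (past k) \<rightarrow>\<^sub>M count_space UNIV"
      "\<And>\<omega>. \<omega> \<in> space M \<Longrightarrow> J k \<omega> = n (observe (past k) \<omega>)"
    using Suc(2) unfolding predictable_def by blast
  let ?A = "samples (past (Suc k))"
  have res: "(\<lambda>u. restrict u (past k)) \<in> ?A \<rightarrow>\<^sub>M samples (past k)"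
    by (intro measurable_restrict_subset) auto
  let ?y = "\<lambda>u. h (restrict u (past k))" and ?n = "\<lambda>u. n (restrict u (past k))"
    and ?z = "\<lambda>u k i. u (k, i)"
  have y: "?y \<in> borel_measurable ?A" using res h(1) by (rule measurable_compose)
  have n': "?n \<in> ?A \<rightarrow>\<^sub>M count_space UNIV" using res n(1) by (rule measurable_compose)
  have z: "(\<lambda>u. ?z u k i) \<in> ?A \<rightarrow>\<^sub>M sample_space \<Xi>" if "i \<in> {1..N k}" for i
    using that by (intro measurable_component_singleton) auto
  let ?m = "\<lambda>u. reductions N (?z u) k (?y u) (?n u)"
  have m: "?m \<in> ?A \<rightarrow>\<^sub>M count_space UNIV"
    by (rule reductions_measurable[where N = N and k = k and z = ?z, OF y h(2) n' z])
  have e: "(\<lambda>u. ?n u + ?m u) \<in> ?A \<rightarrow>\<^sub>M count_space UNIV"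
    using m n' by measurable
  have obs: "restrict (observe (past (Suc k)) \<omega>) (past k) = observe (past k) \<omega>" for \<omega>
    by (auto simp: restrict_def fun_eq_iff)
  have red: "reductions N (?z (observe (past (Suc k)) \<omega>)) k = reductions N (Z \<omega>) k"
    and tri: "trial_point F r N (?z (observe (past (Suc k)) \<omega>)) k = trial_point F r N (Z \<omega>) k" for \<omega>
    by (rule iteration_cong; simp)+
  show "predictable (Suc k) borel (x (Suc k))"
    unfolding predictable_def
  proof (intro bexI ballI)
    show "(\<lambda>u. trial_point F r N (?z u) k (?y u) (\<beta> ^ (?n u + ?m u) * s)) \<in> borel_measurable ?A"
      by (rule trial_point_measurable[where N = N and k = k and z = ?z, OF y h(2) n' z e])
    fix \<omega> assume \<omega>: "\<omega> \<in> space M"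
    show "x (Suc k) \<omega> = (\<lambda>u. trial_point F r N (?z u) k (?y u) (\<beta> ^ (?n u + ?m u) * s)) (observe (past (Suc k)) \<omega>)"
      unfolding x_Suc[OF \<omega>] obs red tri h(3)[OF \<omega>, symmetric] n(2)[OF \<omega>, symmetric] ..
  qed
  show "predictable (Suc k) (count_space UNIV) (J (Suc k))"
    unfolding predictable_def
  proof (intro bexI ballI)
    show "(\<lambda>u. if cycle_start p (Suc k) then 0 else ?n u + ?m u) \<in> ?A \<rightarrow>\<^sub>M count_space UNIV"
      using e by (cases "cycle_start p (Suc k)") simp_all
    fix \<omega> assume \<omega>: "\<omega> \<in> space M"
    show "J (Suc k) \<omega> = (\<lambda>u. if cycle_start p (Suc k) then 0 else ?n u + ?m u) (observe (past (Suc k)) \<omega>)"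
      unfolding obs red h(3)[OF \<omega>, symmetric] n(2)[OF \<omega>, symmetric] by simp
  qed
qed

lemma gradient_step_predictable: "predictable k borel (\<lambda>\<omega>. gradient_step (x k \<omega>) (J k \<omega>))"
proof -
  obtain h where h: "h \<in> borel_measurable (samples (past k))" "\<And>u. h u \<in> edom r"
      "\<And>\<omega>. \<omega> \<in> space M \<Longrightarrow> x k \<omega> = h (observe (past k) \<omega>)"
    using predictable_edom[OF state_predictable(1) x_in] by blast
  obtain n where n: "n \<in> samples (past k) \<rightarrow>\<^sub>M count_space UNIV"
      "\<And>\<omega>. \<omega> \<in> space M \<Longrightarrow> J k \<omega> = n (observe (past k) \<omega>)"
    using state_predictable(2) unfolding predictable_def by blast
  show ?thesis unfolding predictable_def
    by (rule bexI[where x = "\<lambda>u. gradient_step (h u) (n u)"])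
      (use h(3) n(2) gradient_step_measurable[OF h(1) h(2) n(1)] in \<open>auto simp del: One_nat_def\<close>)
qed

end

section \<open>Moments of the noise\<close>

context slam_execution
begin

lemma sample_nn_integral:
  assumes "i \<in> {1..N k}" "h \<in> borel_measurable (sample_space \<Xi>)"
  shows "(\<integral>\<^sup>+ \<omega>. h (X k i \<omega>) \<partial>M) = (\<integral>\<^sup>+ \<omega>. h (\<xi> \<omega>) \<partial>\<Omega>)"
  using nn_integral_distr[OF X_measurable[OF assms(1)], of h]
    nn_integral_distr[OF \<xi>_measurable, of h] assms(2) by (simp add: X_distr[OF assms(1)])

lemma sample_integral:
  fixes h :: "real^'d \<Rightarrow> 'c::{banach, second_countable_topology}"
  assumes i: "i \<in> {1..N k}" and h: "h \<in> borel_measurable (sample_space \<Xi>)"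
  shows "integrable M (\<lambda>\<omega>. h (X k i \<omega>)) \<longleftrightarrow> integrable \<Omega> (\<lambda>\<omega>. h (\<xi> \<omega>))"
    and "(\<integral>\<omega>. h (X k i \<omega>) \<partial>M) = (\<integral>\<omega>. h (\<xi> \<omega>) \<partial>\<Omega>)"
  using integrable_distr_eq[OF X_measurable[OF i] h] integrable_distr_eq[OF \<xi>_measurable h]
    integral_distr[OF X_measurable[OF i] h] integral_distr[OF \<xi>_measurable h]
  by (simp_all add: X_distr[OF i])

lemma noise_mean_fixed:
  assumes y: "y \<in> edom r"
  shows "integrable M (\<lambda>\<omega>. noise N (Z \<omega>) k y)" "(\<integral>\<omega>. noise N (Z \<omega>) k y \<partial>M) = 0"
proof -
  have int: "integrable M (\<lambda>\<omega>. F y (X k i \<omega>))" "(\<integral>\<omega>. F y (X k i \<omega>) \<partial>M) = f y" if "i \<in> {1..N k}" for i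
    using sample_integral[OF that F_measurable] F_mean[OF y] by simp_all
  have fb: "integrable M (\<lambda>\<omega>. batch_f F N (Z \<omega>) k y)"
    unfolding batch_f_def using int(1) by (intro integrable_mult_right Bochner_Integration.integrable_sum)
  have "(\<integral>\<omega>. batch_f F N (Z \<omega>) k y \<partial>M) = (1 / real (N k)) * (\<Sum>i = 1..N k. \<integral>\<omega>. F y (X k i \<omega>) \<partial>M)"
    unfolding batch_f_def using int(1) by (subst integral_mult_right_zero, subst Bochner_Integration.integral_sum) auto
  also have "\<dots> = f y" using int(2) N_pos[of k] by simp
  finally have mean: "(\<integral>\<omega>. batch_f F N (Z \<omega>) k y \<partial>M) = f y" .
  show "integrable M (\<lambda>\<omega>. noise N (Z \<omega>) k y)"
    unfolding noise_def using fb by simp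
  show "(\<integral>\<omega>. noise N (Z \<omega>) k y \<partial>M) = 0"
    unfolding noise_def using fb mean by (simp add: M.prob_space)
qed

text \<open>The deviations of the sample gradients at a fixed point are independent and centred, so averaging
  \<open>N k\<close> of them divides the second moment by \<open>N k\<close>.\<close>

lemma grad_noise_second_moment_fixed:
  assumes y: "y \<in> edom r"
  shows "(\<integral>\<^sup>+ \<omega>. ennreal ((norm (grad_noise N (Z \<omega>) k y))\<^sup>2) \<partial>M) \<le> ennreal (\<sigma>\<^sup>2 / real (N k))"
proof -
  let ?n = "real (N k)"
  define Y where "Y q \<omega> = G y (case_prod X q \<omega>) - g y" for q \<omega>
  have n: "?n > 0" using N_pos by simp
  have G_meas [measurable]: "G y \<in> borel_measurable (sample_space \<Xi>)" by (rule G_measurable[OF y])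
  have dev: "(\<lambda>z. G y z - g y) \<in> borel_measurable (sample_space \<Xi>)" by measurable
  have eq: "(norm (grad_noise N (Z \<omega>) k y))\<^sup>2 = (1 / ?n)\<^sup>2 * (norm (\<Sum>q\<in>batch k. Y q \<omega>))\<^sup>2" for \<omega>
  proof -
    have "(\<Sum>q\<in>batch k. Y q \<omega>) = (\<Sum>(l, i)\<in>batch k. Y (l, i) \<omega>)" by simp
    also have "\<dots> = (\<Sum>l\<in>{k}. \<Sum>i = 1..N k. Y (l, i) \<omega>)"
      by (rule sum.cartesian_product[symmetric])
    also have "\<dots> = (\<Sum>i = 1..N k. G y (X k i \<omega>) - g y)" by (simp add: Y_def)
    finally have "batch_g F N (Z \<omega>) k y - g y = (1 / ?n) *\<^sub>R (\<Sum>q\<in>batch k. Y q \<omega>)"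
      using n by (simp add: batch_g_def G_def sum_subtractf scaleR_diff_right sum_constant_scaleR del: sum_constant)
    then have "norm (grad_noise N (Z \<omega>) k y) = (1 / ?n) * norm (\<Sum>q\<in>batch k. Y q \<omega>)"
      unfolding grad_noise_def by (subst norm_minus_commute) simp
    then show ?thesis by (simp only: power_mult_distrib)
  qed
  have "(\<integral>\<^sup>+ \<omega>. ennreal ((norm (\<Sum>q\<in>batch k. Y q \<omega>))\<^sup>2) \<partial>M) \<le> ennreal (real (card (batch k)) * \<sigma>\<^sup>2)"
  proof (rule M.sum_indep_second_moment)
    have "M.indep_vars (\<lambda>_. sample_space \<Xi>) (case_prod X) (batch k)"
      by (rule M.indep_vars_subset[OF indep_samples]) auto
    then show "M.indep_vars (\<lambda>_. borel) Y (batch k)"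
      unfolding Y_def by (rule M.indep_vars_compose2) (rule dev)
    fix q assume "q \<in> batch k"
    then obtain i where q: "q = (k, i)" "i \<in> {1..N k}" by auto
    show "integrable M (Y q)" "(\<integral>\<omega>. Y q \<omega> \<partial>M) = 0"
      using sample_integral[OF q(2) G_meas] G_mean[OF y] by (simp_all add: Y_def[abs_def] q(1) M.prob_space)
    have "(\<integral>\<^sup>+ \<omega>. ennreal ((norm (Y q \<omega>))\<^sup>2) \<partial>M) = (\<integral>\<^sup>+ \<omega>. ennreal ((norm (G y (\<xi> \<omega>) - g y))\<^sup>2) \<partial>\<Omega>)"
      unfolding Y_def q(1) prod.case using q(2) by (rule sample_nn_integral) measurable
    then show "(\<integral>\<^sup>+ \<omega>. ennreal ((norm (Y q \<omega>))\<^sup>2) \<partial>M) \<le> ennreal (\<sigma>\<^sup>2)"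
      using G_mean(3)[OF y] by simp
  qed auto
  also have "real (card (batch k)) = ?n" by (simp add: card_cartesian_product)
  finally have *: "(\<integral>\<^sup>+ \<omega>. ennreal ((norm (\<Sum>q\<in>batch k. Y q \<omega>))\<^sup>2) \<partial>M) \<le> ennreal (?n * \<sigma>\<^sup>2)" .
  have meas: "(\<lambda>\<omega>. \<Sum>q\<in>batch k. Y q \<omega>) \<in> borel_measurable M"
  proof (rule borel_measurable_sum)
    fix q assume "q \<in> batch k"
    then obtain i where q: "q = (k, i)" "i \<in> {1..N k}" by auto
    show "Y q \<in> borel_measurable M"
      unfolding Y_def[abs_def] q(1) prod.case using X_measurable[OF q(2)] dev by (rule measurable_compose)
  qed
  have "(\<integral>\<^sup>+ \<omega>. ennreal ((norm (grad_noise N (Z \<omega>) k y))\<^sup>2) \<partial>M) =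
      ennreal ((1 / ?n)\<^sup>2) * (\<integral>\<^sup>+ \<omega>. ennreal ((norm (\<Sum>q\<in>batch k. Y q \<omega>))\<^sup>2) \<partial>M)"
    unfolding eq using meas by (subst nn_integral_cmult[symmetric]) (auto simp: ennreal_mult)
  also have "\<dots> \<le> ennreal ((1 / ?n)\<^sup>2) * ennreal (?n * \<sigma>\<^sup>2)"
    by (intro mult_left_mono *) simp
  also have "\<dots> = ennreal (\<sigma>\<^sup>2 / ?n)"
    using n by (simp add: ennreal_mult[symmetric] power2_eq_square)
  finally show ?thesis .
qed

text \<open>The batch of iteration \<open>k\<close> is independent of the data it is evaluated at, so that these data
  may be frozen.\<close>

lemma past_indep_batch:
  "M.indep_var (samples (past k)) (observe (past k)) (samples (batch k)) (observe (batch k))"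
  by (rule M.indep_var_restrict[OF indep_samples]) auto

lemma batch_coordinate_measurable:
  assumes "i \<in> {1..N k}"
  shows "(\<lambda>w. snd w (k, i)) \<in> T \<Otimes>\<^sub>M samples (batch k) \<rightarrow>\<^sub>M sample_space \<Xi>"
  using assms by (intro measurable_compose[OF measurable_snd] measurable_component_singleton) auto

lemma grad_noise_second_moment:
  assumes Y: "predictable k borel Y" "\<And>\<omega>. \<omega> \<in> space M \<Longrightarrow> Y \<omega> \<in> edom r"
  shows "integrable M (\<lambda>\<omega>. (norm (grad_noise N (Z \<omega>) k (Y \<omega>)))\<^sup>2)"
    "(\<integral>\<omega>. (norm (grad_noise N (Z \<omega>) k (Y \<omega>)))\<^sup>2 \<partial>M) \<le> \<sigma>\<^sup>2 / real (N k)"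
proof -
  obtain h where h: "h \<in> borel_measurable (samples (past k))" "\<And>u. h u \<in> edom r"
      "\<And>\<omega>. \<omega> \<in> space M \<Longrightarrow> Y \<omega> = h (observe (past k) \<omega>)"
    using predictable_edom[OF Y] by blast
  let ?T = "samples (past k) \<Otimes>\<^sub>M samples (batch k)"
  let ?q = "\<lambda>w. grad_noise N (\<lambda>k i. snd w (k, i)) k (h (fst w))"
  have y: "(\<lambda>w. h (fst w)) \<in> borel_measurable ?T" using h(1) by measurable
  have q: "?q \<in> borel_measurable ?T"
    by (rule grad_noise_measurable[where N = N and k = k and z = "\<lambda>w k i. snd w (k, i)",
        OF y h(2) measurable_const batch_coordinate_measurable]) auto
  have Yq: "grad_noise N (Z \<omega>) k (Y \<omega>) = ?q (observe (past k) \<omega>, observe (batch k) \<omega>)" if "\<omega> \<in> space M" for \<omega>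
    using iteration_cong(4)[of N k "\<lambda>k' i. observe (batch k) \<omega> (k', i)" "Z \<omega>"] by (simp add: h(3)[OF that])
  have meas: "(\<lambda>\<omega>. grad_noise N (Z \<omega>) k (Y \<omega>)) \<in> borel_measurable M"
  proof -
    have "(\<lambda>\<omega>. ?q (observe (past k) \<omega>, observe (batch k) \<omega>)) \<in> borel_measurable M"
      by (intro measurable_compose[OF _ q] measurable_Pair observe_measurable) auto
    then show ?thesis by (rule measurable_cong[THEN iffD2, rotated]) (rule Yq)
  qed
  have "(\<integral>\<^sup>+ \<omega>. ennreal ((norm (grad_noise N (Z \<omega>) k (Y \<omega>)))\<^sup>2) \<partial>M) =
      (\<integral>\<^sup>+ \<omega>. ennreal ((norm (?q (observe (past k) \<omega>, observe (batch k) \<omega>)))\<^sup>2) \<partial>M)"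
    by (intro nn_integral_cong) (simp only: Yq)
  also have "\<dots> = (\<integral>\<^sup>+ \<omega>. (\<integral>\<^sup>+ \<omega>'. ennreal ((norm (?q (observe (past k) \<omega>, observe (batch k) \<omega>')))\<^sup>2) \<partial>M) \<partial>M)"
    using q by (intro M.indep_var_nn_integral_freeze[OF past_indep_batch,
        where h = "\<lambda>w. ennreal ((norm (?q w))\<^sup>2)"]) measurable
  also have "\<dots> \<le> (\<integral>\<^sup>+ \<omega>. ennreal (\<sigma>\<^sup>2 / real (N k)) \<partial>M)"
  proof (rule nn_integral_mono)
    fix \<omega>
    have "?q (observe (past k) \<omega>, observe (batch k) \<omega>') = grad_noise N (Z \<omega>') k (h (observe (past k) \<omega>))" for \<omega>'
      using iteration_cong(4)[of N k "\<lambda>k' i. observe (batch k) \<omega>' (k', i)" "Z \<omega>'"] by simp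
    then show "(\<integral>\<^sup>+ \<omega>'. ennreal ((norm (?q (observe (past k) \<omega>, observe (batch k) \<omega>')))\<^sup>2) \<partial>M) \<le> ennreal (\<sigma>\<^sup>2 / real (N k))"
      using grad_noise_second_moment_fixed[OF h(2)] by simp
  qed
  also have "\<dots> = ennreal (\<sigma>\<^sup>2 / real (N k))" by (simp add: M.emeasure_space_1)
  finally have bound: "(\<integral>\<^sup>+ \<omega>. ennreal ((norm (grad_noise N (Z \<omega>) k (Y \<omega>)))\<^sup>2) \<partial>M) \<le> ennreal (\<sigma>\<^sup>2 / real (N k))" .
  show int: "integrable M (\<lambda>\<omega>. (norm (grad_noise N (Z \<omega>) k (Y \<omega>)))\<^sup>2)"
  proof (rule integrableI_bounded)
    show "(\<lambda>\<omega>. (norm (grad_noise N (Z \<omega>) k (Y \<omega>)))\<^sup>2) \<in> borel_measurable M" using meas by measurable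
    show "(\<integral>\<^sup>+ \<omega>. ennreal (norm ((norm (grad_noise N (Z \<omega>) k (Y \<omega>)))\<^sup>2)) \<partial>M) < \<infinity>"
      using le_less_trans[OF bound ennreal_less_top] by simp
  qed
  show "(\<integral>\<omega>. (norm (grad_noise N (Z \<omega>) k (Y \<omega>)))\<^sup>2 \<partial>M) \<le> \<sigma>\<^sup>2 / real (N k)"
    using bound nn_integral_eq_integral[OF int] by simp
qed

abbreviation w :: "nat \<Rightarrow> 'v \<Rightarrow> real^'n" where "w k \<omega> \<equiv> gradient_step (x k \<omega>) (J k \<omega>)"

lemma noise_increment_mean:
  "integrable M (\<lambda>\<omega>. noise N (Z \<omega>) k (w k \<omega>) - noise N (Z \<omega>) k (x k \<omega>))"
  "(\<integral>\<omega>. noise N (Z \<omega>) k (w k \<omega>) - noise N (Z \<omega>) k (x k \<omega>) \<partial>M) = 0"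
proof -
  obtain h where h: "h \<in> borel_measurable (samples (past k))" "\<And>u. h u \<in> edom r"
      "\<And>\<omega>. \<omega> \<in> space M \<Longrightarrow> x k \<omega> = h (observe (past k) \<omega>)"
    using predictable_edom[OF state_predictable(1) x_in] by blast
  obtain h' where h': "h' \<in> borel_measurable (samples (past k))" "\<And>u. h' u \<in> edom r"
      "\<And>\<omega>. \<omega> \<in> space M \<Longrightarrow> w k \<omega> = h' (observe (past k) \<omega>)"
    using predictable_edom[OF gradient_step_predictable gradient_step_in] by blast
  let ?T = "samples (past k) \<Otimes>\<^sub>M samples (batch k)"
  let ?z = "\<lambda>w k i. snd w (k, i)"
  let ?q = "\<lambda>w. noise N (?z w) k (h' (fst w)) - noise N (?z w) k (h (fst w))"
  have q: "?q \<in> borel_measurable ?T"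
  proof (rule borel_measurable_diff)
    show "(\<lambda>w. noise N (?z w) k (h' (fst w))) \<in> borel_measurable ?T"
      by (rule noise_measurable[where N = N and k = k and z = ?z,
          OF measurable_compose[OF measurable_fst h'(1)] h'(2) measurable_const batch_coordinate_measurable]) auto
    show "(\<lambda>w. noise N (?z w) k (h (fst w))) \<in> borel_measurable ?T"
      by (rule noise_measurable[where N = N and k = k and z = ?z,
          OF measurable_compose[OF measurable_fst h(1)] h(2) measurable_const batch_coordinate_measurable]) auto
  qed
  have freeze: "?q (u, observe (batch k) \<omega>) = noise N (Z \<omega>) k (h' u) - noise N (Z \<omega>) k (h u)" for u \<omega>
    using iteration_cong(3)[of N k "\<lambda>k' i. observe (batch k) \<omega> (k', i)" "Z \<omega>"] by simp
  let ?D = "\<lambda>\<omega>. noise N (Z \<omega>) k (w k \<omega>) - noise N (Z \<omega>) k (x k \<omega>)"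
  have D: "?D \<omega> = ?q (observe (past k) \<omega>, observe (batch k) \<omega>)" if "\<omega> \<in> space M" for \<omega>
    by (simp only: freeze h(3)[OF that, symmetric] h'(3)[OF that, symmetric])
  have meas: "(\<lambda>\<omega>. ?q (observe (past k) \<omega>, observe (batch k) \<omega>)) \<in> borel_measurable M"
    by (intro measurable_compose[OF _ q] measurable_Pair observe_measurable) auto
  show int: "integrable M ?D"
  proof (rule Bochner_Integration.integrable_bound)
    show "integrable M (\<lambda>\<omega>. (norm (grad_noise N (Z \<omega>) k (x k \<omega>)))\<^sup>2 + (L + 1) * (s * (B + L\<^sub>r))\<^sup>2)"
      using grad_noise_second_moment(1)[OF state_predictable(1) x_in] by simp
    show "?D \<in> borel_measurable M"
      using meas by (rule measurable_cong[THEN iffD2, rotated]) (rule D)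
    show "AE \<omega> in M. norm (?D \<omega>) \<le> norm ((norm (grad_noise N (Z \<omega>) k (x k \<omega>)))\<^sup>2 + (L + 1) * (s * (B + L\<^sub>r))\<^sup>2)"
    proof (rule AE_I2)
      fix \<omega> assume \<omega>: "\<omega> \<in> space M"
      have "\<bar>?D \<omega>\<bar> \<le> (norm (grad_noise N (Z \<omega>) k (x k \<omega>)))\<^sup>2 + (L + 1) * (s * (B + L\<^sub>r))\<^sup>2"
        using noise_increment_bound[of N "Z \<omega>" "\<lambda>k. x k \<omega>" "\<lambda>k. t k \<omega>" k, OF N_pos X_in path] \<omega> by blast
      then show "norm (?D \<omega>) \<le> norm ((norm (grad_noise N (Z \<omega>) k (x k \<omega>)))\<^sup>2 + (L + 1) * (s * (B + L\<^sub>r))\<^sup>2)"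
        by simp
    qed
  qed
  have "(\<integral>\<omega>. ?D \<omega> \<partial>M) = (\<integral>\<omega>. ?q (observe (past k) \<omega>, observe (batch k) \<omega>) \<partial>M)"
    by (intro Bochner_Integration.integral_cong refl D)
  also have "\<dots> = 0"
  proof (rule M.indep_var_integral_eq_0_freeze[OF past_indep_batch q])
    show "integrable M (\<lambda>\<omega>. ?q (observe (past k) \<omega>, observe (batch k) \<omega>))"
      using int by (rule Bochner_Integration.integrable_cong[OF refl, THEN iffD1, rotated]) (rule D)
    fix \<omega>
    show "(\<integral>\<omega>'. ?q (observe (past k) \<omega>, observe (batch k) \<omega>') \<partial>M) = 0"
      unfolding freeze
      by (subst Bochner_Integration.integral_diff) (simp_all add: noise_mean_fixed h(2) h'(2))
  qed
  finally show "(\<integral>\<omega>. ?D \<omega> \<partial>M) = 0" .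
qed

section \<open>Bounds in expectation\<close>

definition sq_res :: "nat \<Rightarrow> 'v \<Rightarrow> real" where
  "sq_res k \<omega> = (norm (residual r g s (x k \<omega>)))\<^sup>2"

text \<open>The expectation of the right-hand side of \<open>path_bound\<close>, estimated by the second moments of the
  noise gradient and divided by the factor \<open>\<alpha> c / 2\<close> of its left-hand side.\<close>

definition error_bound :: "nat \<Rightarrow> real" where
  "error_bound K = 2 / (\<alpha> * c) * (f x\<^sub>0 + \<rho> x\<^sub>0 - \<phi>_low
     + (1 / (2 * L) + 3 * L * s\<^sup>2 + \<alpha> * c) * \<sigma>\<^sup>2 * (\<Sum>k<K. 1 / real (N k))
     + 12 * L * (s * (B + L\<^sub>r))\<^sup>2 * real (max_exponent * Suc (cycle_index p K)))"

lemma sq_res_predictable: "predictable k borel (sq_res k)"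
proof -
  obtain h where h: "h \<in> borel_measurable (samples (past k))" "\<And>u. h u \<in> edom r"
      "\<And>\<omega>. \<omega> \<in> space M \<Longrightarrow> x k \<omega> = h (observe (past k) \<omega>)"
    using predictable_edom[OF state_predictable(1) x_in] by blast
  have "(\<lambda>u. residual r g s (h u)) \<in> borel_measurable (samples (past k))"
    by (rule residual_measurable[OF h(1,2)])
  then have "(\<lambda>u. (norm (residual r g s (h u)))\<^sup>2) \<in> borel_measurable (samples (past k))"
    by measurable
  then show ?thesis unfolding predictable_def sq_res_def
    by (rule bexI[rotated]) (use h(3) in \<open>auto simp del: One_nat_def\<close>)
qed

text \<open>The random index is independent of the \<open>\<sigma>\<close>-algebra generated by all samples, so predictable
  variables have to be measurable with respect to that one.\<close>

lemma predictable_measurable_samples: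
  assumes "predictable k T Y"
  shows "Y \<in> vimage_algebra (space M) (observe I) (samples I) \<rightarrow>\<^sub>M T"
proof -
  obtain h where h: "h \<in> samples (past k) \<rightarrow>\<^sub>M T" "\<And>\<omega>. \<omega> \<in> space M \<Longrightarrow> Y \<omega> = h (observe (past k) \<omega>)"
    using assms unfolding predictable_def by blast
  let ?V = "vimage_algebra (space M) (observe I) (samples I)"
  have obs: "observe I \<in> ?V \<rightarrow>\<^sub>M samples I"
    using measurable_space[OF observe_measurable[OF subset_refl]] by (intro measurable_vimage_algebra1) auto
  have res: "(\<lambda>u. restrict u (past k)) \<in> samples I \<rightarrow>\<^sub>M samples (past k)"
    by (intro measurable_restrict_subset) auto
  have "(\<lambda>\<omega>. h (restrict (observe I \<omega>) (past k))) \<in> ?V \<rightarrow>\<^sub>M T"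
    by (rule measurable_compose[OF measurable_compose[OF obs res] h(1)])
  moreover have "Y \<omega> = h (restrict (observe I \<omega>) (past k))" if "\<omega> \<in> space ?V" for \<omega>
  proof -
    have "restrict (observe I \<omega>) (past k) = observe (past k) \<omega>"
      by (auto simp: restrict_def fun_eq_iff)
    then show ?thesis using that h(2) by simp
  qed
  ultimately show ?thesis using measurable_cong[of ?V Y "\<lambda>\<omega>. h (restrict (observe I \<omega>) (past k))" T] by blast
qed

lemma predictable_measurable:
  assumes "predictable k T Y"
  shows "Y \<in> M \<rightarrow>\<^sub>M T"
proof -
  obtain h where h: "h \<in> samples (past k) \<rightarrow>\<^sub>M T" "\<And>\<omega>. \<omega> \<in> space M \<Longrightarrow> Y \<omega> = h (observe (past k) \<omega>)"
    using assms unfolding predictable_def by blast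
  have "(\<lambda>\<omega>. h (observe (past k) \<omega>)) \<in> M \<rightarrow>\<^sub>M T"
    by (rule measurable_compose[OF observe_measurable h(1)]) auto
  then show ?thesis by (rule measurable_cong[THEN iffD2, rotated]) (rule h(2))
qed

text \<open>Integration of \<open>path_bound\<close>: the noise increments have mean zero, and the squared noise gradients at
  \<open>x k\<close> and \<open>w k\<close> have means of at most \<open>\<sigma>\<^sup>2 / N k\<close>.\<close>

lemma sum_mean_sq_residual_le:
  "(\<Sum>k<K. mean_sq_residual \<Omega> \<xi> F r s M (x k)) \<le> ennreal (error_bound K)"
proof -
  define A where "A = f x\<^sub>0 + \<rho> x\<^sub>0 - \<phi>_low"
  define W where "W = 12 * L * (s * (B + L\<^sub>r))\<^sup>2 * real (max_exponent * Suc (cycle_index p K))"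
  define V where "V = 3 * L * s\<^sup>2 + \<alpha> * c"
  define S where "S = (\<Sum>k<K. 1 / real (N k))"
  let ?D = "\<lambda>k \<omega>. noise N (Z \<omega>) k (w k \<omega>) - noise N (Z \<omega>) k (x k \<omega>)"
  let ?ew = "\<lambda>k \<omega>. (norm (grad_noise N (Z \<omega>) k (w k \<omega>)))\<^sup>2"
  let ?ex = "\<lambda>k \<omega>. (norm (grad_noise N (Z \<omega>) k (x k \<omega>)))\<^sup>2"
  let ?H = "\<lambda>\<omega>. A + (\<Sum>k<K. ?D k \<omega>) + (\<Sum>k<K. ?ew k \<omega>) / (2 * L) + V * (\<Sum>k<K. ?ex k \<omega>) + W"
  have V: "0 \<le> V" using L_gt_0 \<alpha> c_pos by (simp add: V_def)
  have ac: "0 < \<alpha> * c" using \<alpha> c_pos by simp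
  note ew = grad_noise_second_moment[OF gradient_step_predictable gradient_step_in]
  note ex = grad_noise_second_moment[OF state_predictable(1) x_in]
  have H: "integrable M ?H"
    using noise_increment_mean(1) ew(1) ex(1) by auto
  have sums: "(\<Sum>k<K. \<integral>\<omega>. ?ew k \<omega> \<partial>M) \<le> \<sigma>\<^sup>2 * S" "(\<Sum>k<K. \<integral>\<omega>. ?ex k \<omega> \<partial>M) \<le> \<sigma>\<^sup>2 * S"
    using ew(2) ex(2) unfolding S_def sum_distrib_left by (auto intro!: sum_mono)
  have "(\<integral>\<omega>. ?H \<omega> \<partial>M) = A + (\<Sum>k<K. \<integral>\<omega>. ?ew k \<omega> \<partial>M) / (2 * L) + V * (\<Sum>k<K. \<integral>\<omega>. ?ex k \<omega> \<partial>M) + W"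
    using noise_increment_mean ew(1) ex(1)
    by (simp add: Bochner_Integration.integral_sum M.prob_space del: Bochner_Integration.integral_diff)
  also have "\<dots> \<le> A + \<sigma>\<^sup>2 * S / (2 * L) + V * (\<sigma>\<^sup>2 * S) + W"
    using sums V L_gt_0 by (intro add_mono mult_left_mono divide_right_mono) auto
  finally have int_H: "2 / (\<alpha> * c) * (\<integral>\<omega>. ?H \<omega> \<partial>M) \<le> error_bound K"
    using ac unfolding error_bound_def A_def[symmetric] W_def[symmetric] S_def[symmetric]
    by (intro mult_left_mono) (auto simp: V_def algebra_simps)
  have pathwise: "(\<Sum>k<K. sq_res k \<omega>) \<le> 2 / (\<alpha> * c) * ?H \<omega>" if \<omega>: "\<omega> \<in> space M" for \<omega>
  proof -
    have "\<alpha> * c / 2 * (\<Sum>k<K. sq_res k \<omega>) \<le> ?H \<omega>"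
      using path_bound[of N "Z \<omega>" "\<lambda>k. x k \<omega>" "\<lambda>k. t k \<omega>" K, OF N_pos X_in path] \<omega>
      unfolding A_def W_def V_def sq_res_def by blast
    then show ?thesis using ac by (simp add: field_simps)
  qed
  have meas: "sq_res k \<in> borel_measurable M" for k
    by (rule predictable_measurable[OF sq_res_predictable])
  have nonneg: "0 \<le> sq_res k \<omega>" for k \<omega> by (simp add: sq_res_def)
  have "(\<Sum>k<K. mean_sq_residual \<Omega> \<xi> F r s M (x k)) = (\<integral>\<^sup>+ \<omega>. (\<Sum>k<K. ennreal (sq_res k \<omega>)) \<partial>M)"
    unfolding mean_sq_residual_def sq_res_def[symmetric] using meas by (subst nn_integral_sum) auto
  also have "\<dots> = (\<integral>\<^sup>+ \<omega>. ennreal (\<Sum>k<K. sq_res k \<omega>) \<partial>M)"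
    using nonneg by (simp add: sum_ennreal)
  also have "\<dots> \<le> (\<integral>\<^sup>+ \<omega>. ennreal (2 / (\<alpha> * c) * ?H \<omega>) \<partial>M)"
    using pathwise by (intro nn_integral_mono ennreal_leI)
  also have "\<dots> = ennreal (\<integral>\<omega>. 2 / (\<alpha> * c) * ?H \<omega> \<partial>M)"
  proof (rule nn_integral_eq_integral)
    show "integrable M (\<lambda>\<omega>. 2 / (\<alpha> * c) * ?H \<omega>)" using H by (rule integrable_mult_right)
    show "AE \<omega> in M. 0 \<le> 2 / (\<alpha> * c) * ?H \<omega>"
      by (rule AE_I2) (rule order_trans[OF sum_nonneg[OF nonneg] pathwise])
  qed
  also have "\<dots> \<le> ennreal (error_bound K)"
    using int_H by (intro ennreal_leI) (simp only: integral_mult_right_zero)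
  finally show ?thesis .
qed

lemma random_index_facts:
  assumes K: "K > 0"
  shows "R K \<in> vimage_algebra (space M) (R K) (count_space UNIV) \<rightarrow>\<^sub>M count_space UNIV"
    and "R K \<in> M \<rightarrow>\<^sub>M count_space UNIV"
    and "emeasure M {\<omega> \<in> space M. R K \<omega> = k} = (if k < K then ennreal (1 / real K) else 0)"
    and "M.indep_set (sets (vimage_algebra (space M) (R K) (count_space UNIV)))
       (sets (vimage_algebra (space M) (observe I) (samples I)))"
proof -
  let ?V = "vimage_algebra (space M) (R K) (count_space UNIV)"
  show 1: "R K \<in> ?V \<rightarrow>\<^sub>M count_space UNIV"
    by (rule measurable_vimage_algebra1) auto
  show ind: "M.indep_set (sets ?V) (sets (vimage_algebra (space M) (observe I) (samples I)))"
    using run K unfolding slam_run_def Let_def by blast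
  then have "sets ?V \<subseteq> sets M" unfolding M.indep_sets2_eq by blast
  then show 2: "R K \<in> M \<rightarrow>\<^sub>M count_space UNIV"
    using measurable_sets[OF 1] by (intro measurableI) auto
  have distr: "distr M (count_space UNIV) (R K) = measure_pmf (pmf_of_set {..<K})"
    using run K unfolding slam_run_def Let_def by blast
  have "emeasure M {\<omega> \<in> space M. R K \<omega> = k} = emeasure (distr M (count_space UNIV) (R K)) {k}"
    using 2 by (subst emeasure_distr) (auto simp: vimage_def Int_def conj_commute)
  also have "\<dots> = ennreal (pmf (pmf_of_set {..<K}) k)"
    unfolding distr by (simp add: emeasure_pmf_single)
  also have "pmf (pmf_of_set {..<K}) k = (if k < K then 1 / real K else 0)"
    using K by (subst pmf_of_set) (auto simp: indicator_def lessThan_empty_iff)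
  finally show "emeasure M {\<omega> \<in> space M. R K \<omega> = k} = (if k < K then ennreal (1 / real K) else 0)"
    by simp
qed

text \<open>A uniform index independent of the samples turns the expectation into an average.\<close>

lemma mean_sq_residual_random_index:
  assumes K: "K > 0"
  shows "mean_sq_residual \<Omega> \<xi> F r s M (\<lambda>\<omega>. x (R K \<omega>) \<omega>)
    = ennreal (1 / real K) * (\<Sum>k<K. mean_sq_residual \<Omega> \<xi> F r s M (x k))"
proof -
  note R = random_index_facts[OF K]
  let ?i = "\<lambda>k \<omega>. if R K \<omega> = k then 1 else 0 :: ennreal"
  let ?VR = "vimage_algebra (space M) (R K) (count_space UNIV)"
  let ?VX = "vimage_algebra (space M) (observe I) (samples I)"
  have "AE \<omega> in M. R K \<omega> \<noteq> k" if "\<not> k < K" for k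
    using R(3)[of k] that R(2) by (intro AE_I[where N = "{\<omega> \<in> space M. R K \<omega> = k}"]) auto
  then have "AE \<omega> in M. \<forall>k. \<not> k < K \<longrightarrow> R K \<omega> \<noteq> k"
    unfolding AE_all_countable by auto
  then have AE: "AE \<omega> in M. R K \<omega> < K" by (rule AE_mp) (rule AE_I2, blast)
  have indep: "(\<integral>\<^sup>+ \<omega>. ?i k \<omega> * ennreal (sq_res k \<omega>) \<partial>M) = ennreal (1 / real K) * (\<integral>\<^sup>+ \<omega>. ennreal (sq_res k \<omega>) \<partial>M)"
    if k: "k < K" for k
  proof -
    have i: "?i k \<in> borel_measurable ?VR" using R(1) by measurable
    have iM: "?i k \<in> borel_measurable M" using R(2) by measurable
    have a: "(\<lambda>\<omega>. ennreal (sq_res k \<omega>)) \<in> borel_measurable ?VX"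
      using predictable_measurable_samples[OF sq_res_predictable] by measurable
    have aM: "(\<lambda>\<omega>. ennreal (sq_res k \<omega>)) \<in> borel_measurable M"
      using predictable_measurable[OF sq_res_predictable] by measurable
    have sub: "sigma_sets (space M) {Y -` S \<inter> space M |S. S \<in> sets borel} \<subseteq> sets V"
      if "Y \<in> borel_measurable V" "space V = space M" for Y :: "'v \<Rightarrow> ennreal" and V
    proof -
      have "{Y -` S \<inter> space M |S. S \<in> sets borel} \<subseteq> sets V"
        using measurable_sets[OF that(1)] that(2) by auto
      from sets.sigma_sets_subset[OF this] show ?thesis by (simp only: that(2))
    qed
    have "M.indep_var borel (?i k) borel (\<lambda>\<omega>. ennreal (sq_res k \<omega>))"
      unfolding M.indep_var_eq
    proof (intro conjI iM aM)
      show "M.indep_set (sigma_sets (space M) {?i k -` S \<inter> space M |S. S \<in> sets borel})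
          (sigma_sets (space M) {(\<lambda>\<omega>. ennreal (sq_res k \<omega>)) -` S \<inter> space M |S. S \<in> sets borel})"
      proof -
        have mono: "M.indep_set S' T'" if "M.indep_set S T" "S' \<subseteq> S" "T' \<subseteq> T" for S T S' T'
          using that unfolding M.indep_sets2_eq by blast
        show ?thesis by (rule mono[OF R(4) sub[OF i] sub[OF a]]) simp_all
      qed
    qed
    from M.indep_var_nn_integral_freeze[OF this, where h = "\<lambda>(u, v). u * v"]
    have "(\<integral>\<^sup>+ \<omega>. ?i k \<omega> * ennreal (sq_res k \<omega>) \<partial>M) = (\<integral>\<^sup>+ \<omega>. (\<integral>\<^sup>+ \<omega>'. ?i k \<omega> * ennreal (sq_res k \<omega>') \<partial>M) \<partial>M)"
      by simp
    also have "\<dots> = (\<integral>\<^sup>+ \<omega>. ?i k \<omega> * (\<integral>\<^sup>+ \<omega>'. ennreal (sq_res k \<omega>') \<partial>M) \<partial>M)"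
      using aM by (simp only: nn_integral_cmult)
    also have "\<dots> = (\<integral>\<^sup>+ \<omega>. ?i k \<omega> \<partial>M) * (\<integral>\<^sup>+ \<omega>'. ennreal (sq_res k \<omega>') \<partial>M)"
      using iM by (simp only: nn_integral_multc)
    also have "(\<integral>\<^sup>+ \<omega>. ?i k \<omega> \<partial>M) = (\<integral>\<^sup>+ \<omega>. indicator {\<omega> \<in> space M. R K \<omega> = k} \<omega> \<partial>M)"
      by (intro nn_integral_cong) (auto simp: indicator_def)
    also have "\<dots> = emeasure M {\<omega> \<in> space M. R K \<omega> = k}"
      using R(2) by (intro nn_integral_indicator) measurable
    also have "\<dots> = ennreal (1 / real K)" using R(3)[of k] k by simp
    finally show ?thesis .
  qed
  have aM: "(\<lambda>\<omega>. ennreal (sq_res k \<omega>)) \<in> borel_measurable M" for k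
    using predictable_measurable[OF sq_res_predictable] by measurable
  have "mean_sq_residual \<Omega> \<xi> F r s M (\<lambda>\<omega>. x (R K \<omega>) \<omega>) = (\<integral>\<^sup>+ \<omega>. ennreal (sq_res (R K \<omega>) \<omega>) \<partial>M)"
    unfolding mean_sq_residual_def sq_res_def ..
  also have "\<dots> = (\<integral>\<^sup>+ \<omega>. (\<Sum>k<K. ?i k \<omega> * ennreal (sq_res k \<omega>)) \<partial>M)"
  proof (rule nn_integral_cong_AE)
    show "AE \<omega> in M. ennreal (sq_res (R K \<omega>) \<omega>) = (\<Sum>k<K. ?i k \<omega> * ennreal (sq_res k \<omega>))"
      using AE
    proof eventually_elim
      case (elim \<omega>)
      have "(\<Sum>k<K. ?i k \<omega> * ennreal (sq_res k \<omega>)) = (\<Sum>k<K. if k = R K \<omega> then ennreal (sq_res (R K \<omega>) \<omega>) else 0)"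
        by (intro sum.cong) auto
      then show ?case using elim by simp
    qed
  qed
  also have "\<dots> = (\<Sum>k<K. \<integral>\<^sup>+ \<omega>. ?i k \<omega> * ennreal (sq_res k \<omega>) \<partial>M)"
  proof (rule nn_integral_sum)
    fix k
    have [measurable]: "?i k \<in> borel_measurable M" using R(2) by measurable
    show "(\<lambda>\<omega>. ?i k \<omega> * ennreal (sq_res k \<omega>)) \<in> borel_measurable M" using aM by measurable
  qed
  also have "\<dots> = ennreal (1 / real K) * (\<Sum>k<K. \<integral>\<^sup>+ \<omega>. ennreal (sq_res k \<omega>) \<partial>M)"
    using indep by (simp add: sum_distrib_left)
  finally show ?thesis unfolding mean_sq_residual_def sq_res_def .
qed

lemma mean_sq_residual_random_index_le:
  assumes "K > 0"
  shows "mean_sq_residual \<Omega> \<xi> F r s M (\<lambda>\<omega>. x (R K \<omega>) \<omega>) \<le> ennreal (error_bound K / real K)"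
proof -
  have "ennreal (1 / real K) * (\<Sum>k<K. mean_sq_residual \<Omega> \<xi> F r s M (x k)) \<le> ennreal (1 / real K) * ennreal (error_bound K)"
    by (intro mult_left_mono sum_mean_sq_residual_le) simp
  also have "\<dots> = ennreal (error_bound K / real K)"
    using ennreal_mult'[of "1 / real K" "error_bound K"] by simp
  finally show ?thesis using mean_sq_residual_random_index[OF assms] by simp
qed

end

section \<open>Asymptotics\<close>

lemma limsup_le_lim:
  fixes a b :: "nat \<Rightarrow> ennreal"
  assumes "\<forall>\<^sub>F K in sequentially. a K \<le> b K" "b \<longlonglongrightarrow> l"
  shows "limsup a \<le> l"
proof -
  have "limsup a \<le> limsup b" using assms(1) by (rule Limsup_mono)
  also have "limsup b = l" using assms(2) by (intro lim_imp_Limsup) simp_all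
  finally show ?thesis .
qed

text \<open>If a sequence eventually exceeds \<open>q\<close>, its first finitely many terms do not matter for the
  averages, which are therefore asymptotically at least \<open>q\<close>.\<close>

lemma liminf_le_average_bound:
  fixes a b :: "nat \<Rightarrow> ennreal"
  assumes bound: "\<forall>\<^sub>F K in sequentially. ennreal (1 / real K) * (\<Sum>k<K. a k) \<le> b K"
    and lim: "b \<longlonglongrightarrow> l"
  shows "liminf a \<le> l"
proof (rule ccontr)
  assume "\<not> ?thesis"
  then obtain q where q: "l < q" "q < liminf a"
    using dense[of l "liminf a"] by (auto simp: not_le)
  obtain q' where q': "q = ennreal q'" "0 \<le> q'"
    using q(2) by (cases q) auto
  obtain k0 where k0: "\<And>k. k \<ge> k0 \<Longrightarrow> q < a k"
    using less_LiminfD[OF q(2)] by (auto simp: eventually_sequentially)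
  have "\<forall>\<^sub>F K in sequentially. ennreal ((1 - real k0 / real K) * q') \<le> b K"
    using bound eventually_ge_at_top[of k0] eventually_gt_at_top[of 0]
  proof eventually_elim
    case (elim K)
    have "ennreal (real (K - k0) * q') = (\<Sum>k\<in>{k0..<K}. q)"
      using q' by (simp add: ennreal_mult ennreal_of_nat_eq_real_of_nat)
    also have "\<dots> \<le> (\<Sum>k\<in>{k0..<K}. a k)"
      using k0 by (intro sum_mono less_imp_le) auto
    also have "\<dots> \<le> (\<Sum>k<K. a k)"
      by (intro sum_mono2) auto
    finally have "ennreal (1 / real K) * ennreal (real (K - k0) * q') \<le> ennreal (1 / real K) * (\<Sum>k<K. a k)"
      by (intro mult_left_mono) simp_all
    also have "\<dots> \<le> b K" by (rule elim)
    also have "ennreal (1 / real K) * ennreal (real (K - k0) * q') = ennreal ((1 - real k0 / real K) * q')"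
    proof -
      have "ennreal (1 / real K) * ennreal (real (K - k0) * q') = ennreal ((1 / real K) * (real (K - k0) * q'))"
        using q'(2) by (intro ennreal_mult[symmetric]) auto
      also have "(1 / real K) * (real (K - k0) * q') = (1 - real k0 / real K) * q'"
        using elim by (simp add: of_nat_diff field_simps)
      finally show ?thesis .
    qed
    finally show ?case .
  qed
  moreover have "(\<lambda>K. ennreal ((1 - real k0 / real K) * q')) \<longlonglongrightarrow> ennreal ((1 - 0) * q')"
    by (intro tendsto_ennrealI tendsto_intros lim_const_over_n)
  ultimately have "ennreal ((1 - 0) * q') \<le> l"
    using lim by (intro tendsto_le[OF _ lim]) auto
  then show False using q(1) q' by simp
qed

context slam_execution
begin

lemma error_bound_tendsto:
  assumes cycles: "(\<lambda>K. real (cycle_index p K) / real K) \<longlonglongrightarrow> 0"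
    and batches: "(\<lambda>K. (1 / real K) * (\<Sum>k<K. 1 / real (N k))) \<longlonglongrightarrow> v"
  shows "(\<lambda>K. error_bound K / real K) \<longlonglongrightarrow> (1 / L + 6 * L * s\<^sup>2 + 2 * \<alpha> * c) * \<sigma>\<^sup>2 * v / (\<alpha> * c)"
proof -
  let ?A = "f x\<^sub>0 + \<rho> x\<^sub>0 - \<phi>_low" and ?W = "12 * L * (s * (B + L\<^sub>r))\<^sup>2 * real max_exponent"
  let ?V = "(1 / (2 * L) + 3 * L * s\<^sup>2 + \<alpha> * c) * \<sigma>\<^sup>2"
  have "(\<lambda>K. 2 / (\<alpha> * c) * (?A / real K + ?V * ((1 / real K) * (\<Sum>k<K. 1 / real (N k)))
      + ?W * (1 / real K + real (cycle_index p K) / real K)))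
     \<longlonglongrightarrow> 2 / (\<alpha> * c) * (0 + ?V * v + ?W * (0 + 0))"
    by (intro tendsto_intros batches cycles lim_const_over_n)
  moreover have "2 / (\<alpha> * c) * (?A / real K + ?V * ((1 / real K) * (\<Sum>k<K. 1 / real (N k)))
      + ?W * (1 / real K + real (cycle_index p K) / real K)) = error_bound K / real K" for K
  proof -
    have "?W * (1 / real K + real (cycle_index p K) / real K)
        = 12 * L * (s * (B + L\<^sub>r))\<^sup>2 * real (max_exponent * Suc (cycle_index p K)) / real K"
      by (simp add: add_divide_distrib[symmetric] distrib_left)
    then show ?thesis unfolding error_bound_def by (simp add: add_divide_distrib mult.commute[of "real K"])
  qed
  moreover have "2 / (\<alpha> * c) * (0 + ?V * v + ?W * (0 + 0)) = (1 / L + 6 * L * s\<^sup>2 + 2 * \<alpha> * c) * \<sigma>\<^sup>2 * v / (\<alpha> * c)"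
  proof -
    have "2 * (1 / (2 * L) + 3 * L * s\<^sup>2 + \<alpha> * c) = 1 / L + 6 * L * s\<^sup>2 + 2 * \<alpha> * c"
      by (simp add: distrib_left)
    then have "2 * ?V * v = (1 / L + 6 * L * s\<^sup>2 + 2 * \<alpha> * c) * \<sigma>\<^sup>2 * v"
      by (metis mult.assoc)
    then show ?thesis by simp
  qed
  ultimately show ?thesis by (simp only:)
qed

lemma asymptotic_bounds:
  assumes "(\<lambda>K. real (cycle_index p K) / real K) \<longlonglongrightarrow> 0"
    and "(\<lambda>K. (1 / real K) * (\<Sum>k<K. 1 / real (N k))) \<longlonglongrightarrow> v"
  defines "l \<equiv> ennreal ((1 / L + 6 * L * s\<^sup>2 + 2 * \<alpha> * c) * \<sigma>\<^sup>2 * v / (\<alpha> * c))"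
  shows "limsup (\<lambda>K. mean_sq_residual \<Omega> \<xi> F r s M (\<lambda>\<omega>. x (R K \<omega>) \<omega>)) \<le> l"
    and "liminf (\<lambda>k. mean_sq_residual \<Omega> \<xi> F r s M (x k)) \<le> l"
proof -
  let ?b = "\<lambda>K. ennreal (error_bound K / real K)"
  have lim: "?b \<longlonglongrightarrow> l"
    unfolding l_def by (intro tendsto_ennrealI error_bound_tendsto assms)
  have ev: "\<forall>\<^sub>F K in sequentially. mean_sq_residual \<Omega> \<xi> F r s M (\<lambda>\<omega>. x (R K \<omega>) \<omega>) \<le> ?b K"
    using eventually_gt_at_top[of 0] by eventually_elim (rule mean_sq_residual_random_index_le)
  show "limsup (\<lambda>K. mean_sq_residual \<Omega> \<xi> F r s M (\<lambda>\<omega>. x (R K \<omega>) \<omega>)) \<le> l"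
    using ev lim by (rule limsup_le_lim)
  have "\<forall>\<^sub>F K in sequentially. ennreal (1 / real K) * (\<Sum>k<K. mean_sq_residual \<Omega> \<xi> F r s M (x k)) \<le> ?b K"
    using ev eventually_gt_at_top[of 0]
    by eventually_elim (simp add: mean_sq_residual_random_index)
  then show "liminf (\<lambda>k. mean_sq_residual \<Omega> \<xi> F r s M (x k)) \<le> l"
    using lim by (rule liminf_le_average_bound)
qed

end

theorem proposition4:
  fixes \<Omega> :: "'w measure" and \<xi> :: "'w \<Rightarrow> real^'d" and \<Xi> :: "(real^'d) set"
    and F :: "real^'n \<Rightarrow> real^'d \<Rightarrow> real" and r :: "real^'n \<Rightarrow> ereal"
    and L\<^sub>r L \<sigma> \<alpha> \<beta> s c :: real and x\<^sub>0 :: "real^'n" and p :: "nat \<Rightarrow> nat"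
  assumes "stochastic_problem \<Omega> \<xi> \<Xi> F"
    and "assumption_A1 \<Omega> \<xi> F r L\<^sub>r"
    and "assumption_A2 \<Omega> \<xi> \<Xi> F r L"
    and "assumption_A3 \<Omega> \<xi> F r \<sigma>"
    and "x\<^sub>0 \<in> edom r"
    and "0 < \<alpha>" "\<alpha> < 1" and "0 < \<beta>" "\<beta> < 1" and "0 < s"
    and "\<forall>j. p j > 0"
    and "(\<lambda>K. real (cycle_index p K) / real K) \<longlonglongrightarrow> 0"
    and "c = min s (2 * (1 - \<alpha>) * \<beta> / L)"
  shows "(\<forall>(M :: 'v measure) N X x t R. slam_run \<Omega> \<xi> \<Xi> F r x\<^sub>0 \<alpha> \<beta> s p N M X x t R \<longrightarrow>
            (\<forall>b. b > 0 \<and> (\<forall>k. N k = b) \<longrightarrow>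
               limsup (\<lambda>K. mean_sq_residual \<Omega> \<xi> F r s M (\<lambda>\<omega>. x (R K \<omega>) \<omega>))
                 \<le> ennreal ((1 / L + 6 * L * s\<^sup>2 + 2 * \<alpha> * c) * \<sigma>\<^sup>2 / (\<alpha> * c * real b)) \<and>
               liminf (\<lambda>k. mean_sq_residual \<Omega> \<xi> F r s M (x k))
                 \<le> ennreal ((1 / L + 6 * L * s\<^sup>2 + 2 * \<alpha> * c) * \<sigma>\<^sup>2 / (\<alpha> * c * real b))) \<and>
            ((\<lambda>K. (1 / real K) * (\<Sum>k<K. 1 / real (N k))) \<longlonglongrightarrow> 0 \<longrightarrow>
               (\<lambda>K. mean_sq_residual \<Omega> \<xi> F r s M (\<lambda>\<omega>. x (R K \<omega>) \<omega>)) \<longlonglongrightarrow> 0 \<and>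
               liminf (\<lambda>k. mean_sq_residual \<Omega> \<xi> F r s M (x k)) = 0))
       \<and> (\<exists>C>0. \<forall>\<epsilon>>0. \<forall>b>0. real b \<ge> inverse \<epsilon> \<longrightarrow>
            (\<forall>(M :: 'v measure) N X x t R.
               slam_run \<Omega> \<xi> \<Xi> F r x\<^sub>0 \<alpha> \<beta> s p N M X x t R \<and> (\<forall>k. N k = b) \<longrightarrow>
               limsup (\<lambda>K. mean_sq_residual \<Omega> \<xi> F r s M (\<lambda>\<omega>. x (R K \<omega>) \<omega>)) \<le> ennreal (C * \<epsilon>)))"
proof -
  obtain B where B: "\<And>x. x \<in> edom r \<Longrightarrow> norm (obj_grad \<Omega> \<xi> F x) \<le> B"
    using assms(2) unfolding assumption_A1_def Let_def by blast
  obtain \<phi>_low where \<phi>_low: "\<And>x. x \<in> edom r \<Longrightarrow> ereal \<phi>_low \<le> obj \<Omega> \<xi> F x + r x"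
    using assms(2) unfolding assumption_A1_def Let_def by blast
  interpret slam_setting \<Omega> \<xi> \<Xi> F r L\<^sub>r L \<sigma> B \<phi>_low \<alpha> \<beta> s c x\<^sub>0 p
    by unfold_locales (use assms B \<phi>_low in auto)
  define C where "C = (1 / L + 6 * L * s\<^sup>2 + 2 * \<alpha> * c) * \<sigma>\<^sup>2 / (\<alpha> * c)"
  have C: "C > 0"
    using L_gt_0 c_pos s assms(6) \<sigma>_gt_0 unfolding C_def
    by (intro divide_pos_pos mult_pos_pos add_pos_pos) auto
  have exec: "slam_execution \<Omega> \<xi> \<Xi> F r L\<^sub>r L \<sigma> B \<phi>_low \<alpha> \<beta> s c x\<^sub>0 p M N X x t R"
    if "slam_run \<Omega> \<xi> \<Xi> F r x\<^sub>0 \<alpha> \<beta> s p N M X x t R"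
    for M :: "'v measure" and N X x t R
    using that by unfold_locales
  have main: "limsup (\<lambda>K. mean_sq_residual \<Omega> \<xi> F r s M (\<lambda>\<omega>. x (R K \<omega>) \<omega>)) \<le> ennreal (C * v)"
      "liminf (\<lambda>k. mean_sq_residual \<Omega> \<xi> F r s M (x k)) \<le> ennreal (C * v)"
    if "slam_run \<Omega> \<xi> \<Xi> F r x\<^sub>0 \<alpha> \<beta> s p N M X x t R"
      "(\<lambda>K. (1 / real K) * (\<Sum>k<K. 1 / real (N k))) \<longlonglongrightarrow> v"
    for M :: "'v measure" and N X x t R v
    using slam_execution.asymptotic_bounds[OF exec[OF that(1)] assms(12) that(2)]
    by (simp_all add: C_def)
  have const: "(\<lambda>K. (1 / real K) * (\<Sum>k<K. 1 / real (N k))) \<longlonglongrightarrow> 1 / real b"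
    if "\<forall>k. N k = b" for N :: "nat \<Rightarrow> nat" and b
  proof (rule Lim_transform_eventually[OF tendsto_const])
    show "\<forall>\<^sub>F K in sequentially. 1 / real b = (1 / real K) * (\<Sum>k<K. 1 / real (N k))"
      using eventually_gt_at_top[of 0] by eventually_elim (simp add: that)
  qed
  have C_b: "C * (1 / real b) = (1 / L + 6 * L * s\<^sup>2 + 2 * \<alpha> * c) * \<sigma>\<^sup>2 / (\<alpha> * c * real b)" for b
    by (simp add: C_def)
  have zero: "a \<longlonglongrightarrow> 0" if "limsup a \<le> 0" for a :: "nat \<Rightarrow> ennreal"
  proof (rule Liminf_eq_Limsup)
    show "limsup a = 0" using that by simp
    have "liminf a \<le> limsup a" by (rule Liminf_le_Limsup) simp
    then show "liminf a = 0" using that by simp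
  qed simp
  show ?thesis
  proof (intro conjI allI impI)
    fix M :: "'v measure" and N X x t R
    assume run: "slam_run \<Omega> \<xi> \<Xi> F r x\<^sub>0 \<alpha> \<beta> s p N M X x t R"
    {
      fix b assume b: "b > 0 \<and> (\<forall>k. N k = b)"
      show "limsup (\<lambda>K. mean_sq_residual \<Omega> \<xi> F r s M (\<lambda>\<omega>. x (R K \<omega>) \<omega>))
          \<le> ennreal ((1 / L + 6 * L * s\<^sup>2 + 2 * \<alpha> * c) * \<sigma>\<^sup>2 / (\<alpha> * c * real b))"
        and "liminf (\<lambda>k. mean_sq_residual \<Omega> \<xi> F r s M (x k))
          \<le> ennreal ((1 / L + 6 * L * s\<^sup>2 + 2 * \<alpha> * c) * \<sigma>\<^sup>2 / (\<alpha> * c * real b))"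
        using main[OF run const] b unfolding C_b by blast+
    next
      assume "(\<lambda>K. (1 / real K) * (\<Sum>k<K. 1 / real (N k))) \<longlonglongrightarrow> 0"
      note main[OF run this]
      then show "(\<lambda>K. mean_sq_residual \<Omega> \<xi> F r s M (\<lambda>\<omega>. x (R K \<omega>) \<omega>)) \<longlonglongrightarrow> 0"
        and "liminf (\<lambda>k. mean_sq_residual \<Omega> \<xi> F r s M (x k)) = 0"
        by (simp_all add: zero)
    }
  next
    show "\<exists>C>0. \<forall>\<epsilon>>0. \<forall>b>0. real b \<ge> inverse \<epsilon> \<longrightarrow>
        (\<forall>(M :: 'v measure) N X x t R.
           slam_run \<Omega> \<xi> \<Xi> F r x\<^sub>0 \<alpha> \<beta> s p N M X x t R \<and> (\<forall>k. N k = b) \<longrightarrow>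
           limsup (\<lambda>K. mean_sq_residual \<Omega> \<xi> F r s M (\<lambda>\<omega>. x (R K \<omega>) \<omega>)) \<le> ennreal (C * \<epsilon>))"
    proof (intro exI[of _ C] conjI allI impI C)
      fix \<epsilon> :: real and b :: nat and M :: "'v measure" and N X x t R
      assume \<epsilon>: "\<epsilon> > 0" and b: "b > 0" "real b \<ge> inverse \<epsilon>"
        and run: "slam_run \<Omega> \<xi> \<Xi> F r x\<^sub>0 \<alpha> \<beta> s p N M X x t R \<and> (\<forall>k. N k = b)"
      have "limsup (\<lambda>K. mean_sq_residual \<Omega> \<xi> F r s M (\<lambda>\<omega>. x (R K \<omega>) \<omega>)) \<le> ennreal (C * (1 / real b))"
        using main(1) const run by blast
      also have "\<dots> \<le> ennreal (C * \<epsilon>)"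
        using \<epsilon> b C by (intro ennreal_leI mult_left_mono) (auto simp: field_simps)
      finally show "limsup (\<lambda>K. mean_sq_residual \<Omega> \<xi> F r s M (\<lambda>\<omega>. x (R K \<omega>) \<omega>)) \<le> ennreal (C * \<epsilon>)" .
    qed
  qed
qed

end
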